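(* Suppose that $F$ is a quadratically closed field and let $V$ be a non-zero finite dimensional $F$-vector space. Let $f,g:V\times V\to F$ be non-degenerate split bilinear forms with respective asymmetries $\sigma$ and $\tau$. Suppose $\sigma$ and $\tau$ are similar. Then: (i) If $\mathrm{char}(F)\neq 2$, or $\mathrm{char}(F)=2$ and no $(X-1)^m$ with $m$ odd is an elementary divisor of $\sigma$, then $f$ and $g$ are equivalent. (ii) Suppose that $\mathrm{char}(F)=2$ and that $(X-1)^m$, for some odd $m$, is an elementary divisor of $\sigma$. Let $V(\sigma)$ (resp. $V(\tau)$) be the generalized $1$-eigenspace of $V$ with respect to $\sigma$ (resp. $\tau$), and consider any $f$-orthogonal (resp. $g$-orthogonal) decomposition $$V(\sigma)=U_1\perp\cdots\perp U_r\qquad(\text{resp. } V(\tau)=W_1\perp\cdots\perp W_r),$$ where each $U_m$ (resp. $W_m$), $1\le m\le r$, is a free (possibly zero) $F[X]/((X-1)^m)$-module via $\sigma$ (resp. $\tau$). For each odd $m$ with $1\leq m\leq r$, let $f_m$ (resp. $g_m$) be the non-degenerate symmetric bilinear form on $U_m/(\sigma-1)U_m$ (resp. $W_m/(\tau-1)W_m$) given by $$f_m(u+(\sigma-1)U_m,v+(\sigma-1)U_m)=f((\sigma-1)^{m-1}u,v),\quad u,v\in U_m,$$ $$(\text{resp. } g_m(u+(\tau-1)W_m,v+(\tau-1)W_m)=g((\tau-1)^{m-1}u,v),\quad u,v\in W_m).$$ Then $f$ and $g$ are equivalent if and only if for each odd $m$, $1\leq m\leq r$, such that $U_m\neq 0$,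 $f_m$ and $g_m$ are both alternating or both non-alternating.
   Context: A field $F$ is quadratically closed if it has no quadratic extensions, i.e. every polynomial of degree 2 over $F$ has a root in $F$. A bilinear form $f:V\times V\to F$ on a finite dimensional space is non-degenerate if its Gram matrices are invertible. Two bilinear forms $f,g$ on $V$ are equivalent if there is $x\in\mathrm{GL}(V)$ with $g(xu,xv)=f(u,v)$ for all $u,v\in V$. If $f$ is non-degenerate, its asymmetry is the unique $\sigma\in\mathrm{GL}(V)$ with $f(v,u)=f(u,\sigma v)$ for all $u,v\in V$. A non-degenerate form is split if the minimal polynomial of its asymmetry splits into linear factors over $F$. Elementary divisors of $\sigma$ are those of $V$ as an $F[X]$-module with $X$ acting as $\sigma$. An $f$-orthogonal decomposition $U=U_1\perp\cdots\perp U_r$ means $U=U_1\oplus\cdots\oplus U_r$ with $f(U_i,U_j)=0$ for all $i\ne j$. A bilinear form $h$ is alternating if $h(u,u)=0$ for all $u$. *)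

theory Defs
  imports
    "HOL-Computational_Algebra.Polynomial"
    "Jordan_Normal_Form.Matrix"
begin

text \<open>
  The space \<open>V\<close> is a whole type \<open>'v\<close> with an explicit scalar multiplication \<open>s\<close>, as in
  \<open>Vector_Spaces.vector_space\<close>; subspaces and submodules are sets of vectors.
\<close>

definition quadratically_closed :: "'a::field itself \<Rightarrow> bool" where
  "quadratically_closed _ \<longleftrightarrow> (\<forall>p::'a poly. degree p = 2 \<longrightarrow> (\<exists>x. poly p x = 0))"

definition GL :: "('a::field \<Rightarrow> 'v::ab_group_add \<Rightarrow> 'v) \<Rightarrow> ('v \<Rightarrow> 'v) set" where
  "GL s = {x. Vector_Spaces.linear s s x \<and> bij x}"

definition similar_maps ::
  "('a::field \<Rightarrow> 'v::ab_group_add \<Rightarrow> 'v) \<Rightarrow> ('v \<Rightarrow> 'v) \<Rightarrow> ('v \<Rightarrow> 'v) \<Rightarrow> bool" where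
  "similar_maps s \<sigma> \<tau> \<longleftrightarrow> (\<exists>x\<in>GL s. \<tau> \<circ> x = x \<circ> \<sigma>)"


section \<open>Bilinear forms\<close>

definition bilinear_form ::
  "('a::field \<Rightarrow> 'v::ab_group_add \<Rightarrow> 'v) \<Rightarrow> ('v \<Rightarrow> 'v \<Rightarrow> 'a) \<Rightarrow> bool" where
  "bilinear_form s f \<longleftrightarrow>
     (\<forall>v. Vector_Spaces.linear s (*) (\<lambda>u. f u v)) \<and>
     (\<forall>u. Vector_Spaces.linear s (*) (\<lambda>v. f u v))"

definition ordered_basis ::
  "('a::field \<Rightarrow> 'v::ab_group_add \<Rightarrow> 'v) \<Rightarrow> 'v list \<Rightarrow> bool" where
  "ordered_basis s bs \<longleftrightarrow>
     distinct bs \<and> \<not> module.dependent s (set bs) \<and> module.span s (set bs) = UNIV"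

definition gram_mat :: "('b \<Rightarrow> 'b \<Rightarrow> 'a) \<Rightarrow> 'b list \<Rightarrow> 'a mat" where
  "gram_mat f bs = mat (length bs) (length bs) (\<lambda>(i, j). f (bs ! i) (bs ! j))"

definition nondegenerate ::
  "('a::field \<Rightarrow> 'v::ab_group_add \<Rightarrow> 'v) \<Rightarrow> ('v \<Rightarrow> 'v \<Rightarrow> 'a) \<Rightarrow> bool" where
  "nondegenerate s f \<longleftrightarrow> (\<forall>bs. ordered_basis s bs \<longrightarrow> invertible_mat (gram_mat f bs))"

definition equivalent_forms ::
  "('a::field \<Rightarrow> 'v::ab_group_add \<Rightarrow> 'v) \<Rightarrow> ('v \<Rightarrow> 'v \<Rightarrow> 'a) \<Rightarrow> ('v \<Rightarrow> 'v \<Rightarrow> 'a) \<Rightarrow> bool" where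
  "equivalent_forms s f g \<longleftrightarrow> (\<exists>x\<in>GL s. \<forall>u v. g (x u) (x v) = f u v)"

definition asymmetry ::
  "('a::field \<Rightarrow> 'v::ab_group_add \<Rightarrow> 'v) \<Rightarrow> ('v \<Rightarrow> 'v \<Rightarrow> 'a) \<Rightarrow> 'v \<Rightarrow> 'v" where
  "asymmetry s f = (THE \<sigma>. \<sigma> \<in> GL s \<and> (\<forall>u v. f v u = f u (\<sigma> v)))"


section \<open>The module over the polynomial ring defined by an endomorphism\<close>

definition poly_act ::
  "('a::field \<Rightarrow> 'v::ab_group_add \<Rightarrow> 'v) \<Rightarrow> ('v \<Rightarrow> 'v) \<Rightarrow> 'a poly \<Rightarrow> 'v \<Rightarrow> 'v" where
  "poly_act s \<sigma> p v = (\<Sum>i\<le>degree p. s (coeff p i) ((\<sigma> ^^ i) v))"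

definition min_poly ::
  "('a::field \<Rightarrow> 'v::ab_group_add \<Rightarrow> 'v) \<Rightarrow> ('v \<Rightarrow> 'v) \<Rightarrow> 'a poly" where
  "min_poly s \<sigma> = (THE p. lead_coeff p = 1 \<and> (\<forall>v. poly_act s \<sigma> p v = 0) \<and>
     (\<forall>q. (\<forall>v. poly_act s \<sigma> q v = 0) \<longrightarrow> p dvd q))"

definition splits :: "'a::field poly \<Rightarrow> bool" where
  "splits p \<longleftrightarrow> (\<exists>c as. c \<noteq> 0 \<and> p = Polynomial.smult c (\<Prod>a\<leftarrow>as. [:- a, 1:]))"

definition split_form ::
  "('a::field \<Rightarrow> 'v::ab_group_add \<Rightarrow> 'v) \<Rightarrow> ('v \<Rightarrow> 'v \<Rightarrow> 'a) \<Rightarrow> bool" where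
  "split_form s f \<longleftrightarrow> splits (min_poly s (asymmetry s f))"

text \<open>\<open>S\<close> is the internal direct sum of the subspaces \<open>U i\<close>, for \<open>i\<close> in the finite set \<open>I\<close>.\<close>

definition internal_direct_sum ::
  "('a::field \<Rightarrow> 'v::ab_group_add \<Rightarrow> 'v) \<Rightarrow> 'i set \<Rightarrow> ('i \<Rightarrow> 'v set) \<Rightarrow> 'v set \<Rightarrow> bool" where
  "internal_direct_sum s I U S \<longleftrightarrow>
     finite I \<and> (\<forall>i\<in>I. module.subspace s (U i)) \<and>
     S = {\<Sum>i\<in>I. u i | u. \<forall>i\<in>I. u i \<in> U i} \<and>
     (\<forall>u. (\<forall>i\<in>I. u i \<in> U i) \<and> (\<Sum>i\<in>I. u i) = 0 \<longrightarrow> (\<forall>i\<in>I. u i = 0))"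

text \<open>
  A decomposition of \<open>V\<close> as the direct sum of the cyclic submodules generated by the vectors
  \<open>w i\<close>, \<open>i < n\<close>, the annihilator of \<open>w i\<close> being the ideal generated by \<open>q i\<close>, a positive power
  of a monic irreducible polynomial.  The family of the \<open>q i\<close> does not depend on the
  decomposition, up to order, and its members are the elementary divisors.
\<close>

definition primary_cyclic_decomposition ::
  "('a::field \<Rightarrow> 'v::ab_group_add \<Rightarrow> 'v) \<Rightarrow> ('v \<Rightarrow> 'v) \<Rightarrow> nat \<Rightarrow> (nat \<Rightarrow> 'v) \<Rightarrow> (nat \<Rightarrow> 'a poly) \<Rightarrow> bool"
  where
  "primary_cyclic_decomposition s \<sigma> n w q \<longleftrightarrow>
     internal_direct_sum s {..<n} (\<lambda>i. {poly_act s \<sigma> p (w i) | p. True}) UNIV \<and>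
     (\<forall>i<n. (\<exists>p k. irreducible p \<and> lead_coeff p = 1 \<and> 0 < k \<and> q i = p ^ k) \<and>
       (\<forall>p. poly_act s \<sigma> p (w i) = 0 \<longleftrightarrow> q i dvd p))"

definition elementary_divisor ::
  "('a::field \<Rightarrow> 'v::ab_group_add \<Rightarrow> 'v) \<Rightarrow> ('v \<Rightarrow> 'v) \<Rightarrow> 'a poly \<Rightarrow> bool" where
  "elementary_divisor s \<sigma> d \<longleftrightarrow>
     (\<exists>n w q. primary_cyclic_decomposition s \<sigma> n w q \<and> (\<exists>i<n. q i = d))"

text \<open>
  \<open>U\<close> is a submodule, killed by \<open>d\<close>, which is free as a module over \<open>F[X]/(d)\<close>.  A basis is
  required to be finite, which is no restriction when \<open>V\<close> is finite dimensional and \<open>d\<close> is not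
  constant; scalars of \<open>F[X]/(d)\<close> are represented by polynomials.
\<close>

definition free_quotient_module ::
  "('a::field \<Rightarrow> 'v::ab_group_add \<Rightarrow> 'v) \<Rightarrow> ('v \<Rightarrow> 'v) \<Rightarrow> 'a poly \<Rightarrow> 'v set \<Rightarrow> bool" where
  "free_quotient_module s \<sigma> d U \<longleftrightarrow>
     module.subspace s U \<and> \<sigma> ` U \<subseteq> U \<and> (\<forall>u\<in>U. poly_act s \<sigma> d u = 0) \<and>
     (\<exists>B. finite B \<and> B \<subseteq> U \<and>
       (\<forall>u\<in>U. \<exists>p. u = (\<Sum>b\<in>B. poly_act s \<sigma> (p b) b)) \<and>
       (\<forall>p. (\<Sum>b\<in>B. poly_act s \<sigma> (p b) b) = 0 \<longrightarrow> (\<forall>b\<in>B. d dvd p b)))"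

definition minus_id :: "('v::ab_group_add \<Rightarrow> 'v) \<Rightarrow> 'v \<Rightarrow> 'v" where
  "minus_id \<sigma> v = \<sigma> v - v"

definition gen_eigenspace_1 :: "('v::ab_group_add \<Rightarrow> 'v) \<Rightarrow> 'v set" where
  "gen_eigenspace_1 \<sigma> = {v. \<exists>k. (minus_id \<sigma> ^^ k) v = 0}"

text \<open>
  A decomposition of the generalized \<open>1\<close>-eigenspace as the \<open>f\<close>-orthogonal sum of
  \<open>U 1, ..., U r\<close>, with \<open>U m\<close> a free module over \<open>F[X]/((X-1)^m)\<close>.
\<close>

definition orthogonal_free_decomposition ::
  "('a::field \<Rightarrow> 'v::ab_group_add \<Rightarrow> 'v) \<Rightarrow> ('v \<Rightarrow> 'v \<Rightarrow> 'a) \<Rightarrow> ('v \<Rightarrow> 'v) \<Rightarrow> nat \<Rightarrow> (nat \<Rightarrow> 'v set) \<Rightarrow> bool"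
  where
  "orthogonal_free_decomposition s f \<sigma> r U \<longleftrightarrow>
     internal_direct_sum s {1..r} U (gen_eigenspace_1 \<sigma>) \<and>
     (\<forall>i\<in>{1..r}. \<forall>j\<in>{1..r}. i \<noteq> j \<longrightarrow> (\<forall>u\<in>U i. \<forall>v\<in>U j. f u v = 0)) \<and>
     (\<forall>m\<in>{1..r}. free_quotient_module s \<sigma> ([:- 1, 1:] ^ m) (U m))"


section \<open>Forms on quotient spaces\<close>

definition coset :: "'v::ab_group_add set \<Rightarrow> 'v \<Rightarrow> 'v set" where
  "coset W u = {u + w | w. w \<in> W}"

definition quotient_space :: "'v::ab_group_add set \<Rightarrow> 'v set \<Rightarrow> 'v set set" where
  "quotient_space U W = coset W ` U"

text \<open>
  The cosets of the vectors in the list \<open>bs\<close> form an ordered basis of \<open>U/W\<close>: every element of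
  \<open>U\<close> is congruent modulo \<open>W\<close> to exactly one linear combination of \<open>bs\<close>.
\<close>

definition ordered_basis_mod ::
  "('a::field \<Rightarrow> 'v::ab_group_add \<Rightarrow> 'v) \<Rightarrow> 'v set \<Rightarrow> 'v set \<Rightarrow> 'v list \<Rightarrow> bool" where
  "ordered_basis_mod s U W bs \<longleftrightarrow> set bs \<subseteq> U \<and>
     (\<forall>u\<in>U. \<exists>!c. c \<in> carrier_vec (length bs) \<and> u - (\<Sum>i<length bs. s (vec_index c i) (bs ! i)) \<in> W)"

definition quotient_bilinear_form ::
  "('a::field \<Rightarrow> 'v::ab_group_add \<Rightarrow> 'v) \<Rightarrow> 'v set \<Rightarrow> 'v set \<Rightarrow> ('v set \<Rightarrow> 'v set \<Rightarrow> 'a) \<Rightarrow> bool" where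
  "quotient_bilinear_form s U W h \<longleftrightarrow>
     (\<forall>u\<in>U. \<forall>u'\<in>U. \<forall>v\<in>U. \<forall>a b.
        h (coset W (s a u + s b u')) (coset W v) =
          a * h (coset W u) (coset W v) + b * h (coset W u') (coset W v) \<and>
        h (coset W v) (coset W (s a u + s b u')) =
          a * h (coset W v) (coset W u) + b * h (coset W v) (coset W u'))"

definition quotient_symmetric ::
  "'v::ab_group_add set \<Rightarrow> 'v set \<Rightarrow> ('v set \<Rightarrow> 'v set \<Rightarrow> 'a) \<Rightarrow> bool" where
  "quotient_symmetric U W h \<longleftrightarrow>
     (\<forall>C\<in>quotient_space U W. \<forall>D\<in>quotient_space U W. h C D = h D C)"

definition quotient_alternating ::
  "'v::ab_group_add set \<Rightarrow> 'v set \<Rightarrow> ('v set \<Rightarrow> 'v set \<Rightarrow> 'a::zero) \<Rightarrow> bool" where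
  "quotient_alternating U W h \<longleftrightarrow> (\<forall>C\<in>quotient_space U W. h C C = 0)"

definition quotient_nondegenerate ::
  "('a::field \<Rightarrow> 'v::ab_group_add \<Rightarrow> 'v) \<Rightarrow> 'v set \<Rightarrow> 'v set \<Rightarrow> ('v set \<Rightarrow> 'v set \<Rightarrow> 'a) \<Rightarrow> bool" where
  "quotient_nondegenerate s U W h \<longleftrightarrow>
     (\<forall>bs. ordered_basis_mod s U W bs \<longrightarrow> invertible_mat (gram_mat h (map (coset W) bs)))"

text \<open>
  The form \<open>(u + (\<sigma>-1)U, v + (\<sigma>-1)U) \<mapsto> f((\<sigma>-1)^(m-1) u, v)\<close>, as a function of two cosets: the
  common value of the right-hand side over all choices of representatives.
\<close>

definition residual_form ::
  "('v::ab_group_add \<Rightarrow> 'v \<Rightarrow> 'a) \<Rightarrow> ('v \<Rightarrow> 'v) \<Rightarrow> nat \<Rightarrow> 'v set \<Rightarrow> 'v set \<Rightarrow> 'a" where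
  "residual_form f \<sigma> m C D = (THE c. \<forall>u\<in>C. \<forall>v\<in>D. f ((minus_id \<sigma> ^^ (m - 1)) u) v = c)"

text \<open>
  The formula gives a well-defined, non-degenerate symmetric bilinear form on \<open>U/(\<sigma>-1)U\<close>.
\<close>

definition residual_form_nondegenerate_symmetric ::
  "('a::field \<Rightarrow> 'v::ab_group_add \<Rightarrow> 'v) \<Rightarrow> ('v \<Rightarrow> 'v \<Rightarrow> 'a) \<Rightarrow> ('v \<Rightarrow> 'v) \<Rightarrow> nat \<Rightarrow> 'v set \<Rightarrow> bool" where
  "residual_form_nondegenerate_symmetric s f \<sigma> m U \<longleftrightarrow>
     (let W = minus_id \<sigma> ` U; h = residual_form f \<sigma> m in
       (\<forall>u\<in>U. \<forall>v\<in>U. h (coset W u) (coset W v) = f ((minus_id \<sigma> ^^ (m - 1)) u) v) \<and>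
       quotient_bilinear_form s U W h \<and> quotient_symmetric U W h \<and>
       quotient_nondegenerate s U W h)"

end

theory Submission
  imports Defs "HOL-Computational_Algebra.Polynomial_Factorial" "Jordan_Normal_Form.Determinant"
begin

text \<open>
  A form is decomposed by splitting off, for an eigenvalue \<open>c\<close> of its asymmetry \<open>\<sigma>\<close> and the size \<open>m\<close> of
  the largest Jordan blocks for \<open>c\<close>, one of two kinds of non-degenerate \<open>\<sigma>\<close>-invariant summands.  If
  \<open>c = \<plusminus>1\<close> and \<open>f((\<sigma>-c)\<^bsup>m-1\<^esup> u, u) \<noteq> 0\<close> for some \<open>u\<close> killed by \<open>(\<sigma>-c)\<^sup>m\<close>, it is the cyclic module of \<open>u\<close>;
  otherwise it is the sum of two totally isotropic cyclic modules, for the eigenvalues \<open>c\<close> and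
  \<open>c\<^sup>-\<^sup>1\<close>, in duality under \<open>f\<close>.  By successive approximation, solving one quadratic equation at each
  step, the generators can be normalised so that the summand is determined up to isometry by \<open>c\<close>, \<open>m\<close>
  and its kind.  The dimensions of the kernels of the powers of \<open>\<sigma> - c\<close> pass to the orthogonal
  complement, and they determine the kind of the summand in characteristic different from 2.  In
  characteristic 2 the only further invariant is, for each odd \<open>m\<close>, whether \<open>f((\<sigma>-1)\<^bsup>m-1\<^esup> u, u)\<close> vanishes on
  the kernel of \<open>(\<sigma>-1)\<^sup>m\<close>; for even \<open>m\<close> it always does.  Two forms with the same invariants are thus isometric
  by induction on the dimension.
\<close>

text \<open>The familiar route to a normal form extracts square roots of self-adjoint polynomials in
  \<open>\<sigma>\<close>. In characteristic 2 it is closed, since the square of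
  \<open>1 + c s^i\<close> has no linear term in \<open>c\<close>. Generators are therefore changed
  by operators that are not self-adjoint: the norm of \<open>1 + c s^i t\<close> keeps the linear
  term \<open>- e c s^(i+1)\<close> in every characteristic, and a quadratic equation with non-zero
  linear coefficient is solvable over a quadratically closed field. The second obstacle is that
  orthogonal cancellation fails in characteristic 2: isometric cyclic summands can have complements
  of different type at their own size. The summand has to be chosen so that the type of its
  complement depends on dimensions only. Hyperbolic summands, and cyclic ones at other sizes, are
  alternating and lose no information.\<close>

hide_const (open) Module.smult

section \<open>Quadratic equations and characteristic 2\<close>

text \<open>The hypothesis on the field speaks of honest quadratics only. A non-zero linear
  coefficient keeps the equation solvable when the quadratic term drops out, which does happen in
  the approximations below.\<close>

lemma quadratically_closed_root:
  fixes a b c :: "'a::field"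
  assumes "quadratically_closed TYPE('a)" "b \<noteq> 0"
  shows "\<exists>x. a + b * x + c * x\<^sup>2 = 0"
proof (cases "c = 0")
  case True
  then show ?thesis using assms(2) by (intro exI[of _ "- a / b"]) auto
next
  case False
  then have "degree [:a, b, c:] = 2" by simp
  with assms(1) obtain x where "poly [:a, b, c:] x = 0"
    unfolding quadratically_closed_def by blast
  then show ?thesis by (intro exI[of _ x]) (simp add: algebra_simps power2_eq_square)
qed

lemma quadratically_closed_sqrt:
  fixes a :: "'a::field"
  assumes "quadratically_closed TYPE('a)"
  shows "\<exists>x. x\<^sup>2 = a"
proof -
  have "degree [:- a, 0, 1:] = 2" by simp
  with assms obtain x where "poly [:- a, 0, 1:] x = 0"
    unfolding quadratically_closed_def by blast
  then show ?thesis by (intro exI[of _ x]) (simp add: algebra_simps power2_eq_square)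
qed

lemma CHAR_eq_2_iff: "CHAR('a::field) = 2 \<longleftrightarrow> (2::'a) = 0"
proof
  assume "CHAR('a) = 2"
  then show "(2::'a) = 0" using of_nat_CHAR[where 'a = 'a] by simp
next
  assume "(2::'a) = 0"
  then have "of_nat 2 = (0::'a)" by simp
  then have "CHAR('a) dvd 2" unfolding of_nat_eq_0_iff_char_dvd .
  moreover have "CHAR('a) \<noteq> 1" by (metis of_nat_1 of_nat_CHAR one_neq_zero)
  ultimately show "CHAR('a) = 2" by (metis prime_nat_iff two_is_prime_nat)
qed

section \<open>Linear factors and Bezout identities\<close>

definition lin_poly :: "'a::comm_ring_1 \<Rightarrow> 'a poly" where
  "lin_poly c = [:- c, 1:]"

lemma poly_lin_poly [simp]: "poly (lin_poly c) x = x - c"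
  by (simp add: lin_poly_def)

lemma lin_poly_eq: "lin_poly c = [:0, 1:] - [:c:]"
  by (simp add: lin_poly_def)

lemma lin_poly_nonzero [simp]: "lin_poly c \<noteq> 0"
  by (simp add: lin_poly_def)

lemma poly_root_split: "\<exists>q. p = [:poly p c:] + lin_poly c * (q::'a::field poly)"
proof -
  have "poly (p - [:poly p c:]) c = 0" by simp
  then obtain q where "p - [:poly p c:] = lin_poly c * q" unfolding poly_eq_0_iff_dvd lin_poly_def by (rule dvdE)
  then show ?thesis by (intro exI[of _ q]) (simp add: algebra_simps)
qed

text \<open>Since \<open>poly q c\<close> is a unit, \<open>1 = k * (q - lin_poly c * h)\<close>.
  Inserting this factor into the remainder term of the previous identity raises its exponent by
  one.\<close>

lemma lin_poly_power_bezout: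
  assumes "poly q c \<noteq> (0::'a::field)"
  shows "\<exists>w r. w * q + r * lin_poly c ^ M = 1"
proof (induction M)
  case 0
  show ?case by (intro exI[of _ 0] exI[of _ 1]) simp
next
  case (Suc M)
  then obtain w r where wr: "w * q + r * lin_poly c ^ M = 1" by blast
  obtain h where h: "q = [:poly q c:] + lin_poly c * h" using poly_root_split by blast
  define k where "k = [:inverse (poly q c):]"
  have "k * [:poly q c:] = 1" using assms by (simp add: k_def)
  moreover have "[:poly q c:] = q - lin_poly c * h" using h by (metis add_diff_cancel_right')
  ultimately have "k * (q - lin_poly c * h) = 1" by simp
  then have "1 = w * q + r * lin_poly c ^ M * (k * (q - lin_poly c * h))" using wr by simp
  also have "\<dots> = (w + r * lin_poly c ^ M * k) * q + (- r * k * h) * lin_poly c ^ Suc M"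
    by (simp add: algebra_simps)
  finally show ?case by metis
qed

lemma lin_poly_power_coprime:
  assumes "b \<noteq> (c::'a::field)"
  shows "\<exists>w r. w * lin_poly b ^ n + r * lin_poly c ^ M = 1"
  using assms by (intro lin_poly_power_bezout) simp

lemma lin_poly_power_factor:
  fixes p :: "'a::field poly"
  assumes "p \<noteq> 0"
  obtains j q where "p = lin_poly c ^ j * q" "poly q c \<noteq> 0"
proof -
  obtain q where "p = lin_poly c ^ order c p * q" "\<not> lin_poly c dvd q"
    using order_decomp[OF assms] unfolding lin_poly_def by blast
  then show thesis using that by (simp add: poly_eq_0_iff_dvd lin_poly_def)
qed

lemma prod_roots_nonzero: "(\<Prod>a\<leftarrow>as. lin_poly a) \<noteq> (0 :: 'a::field poly)"
  by (induction as) auto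

text \<open>
  Modulo \<open>X \<rho> = 1\<close> the polynomials are generated over \<open>F[s]\<close> by \<open>1\<close> and \<open>\<rho>\<close>,
  since \<open>s = 2 - e X - e \<rho>\<close>.
\<close>

lemma functional_zero:
  fixes \<phi> :: "'a::field poly \<Rightarrow> 'a"
  assumes add: "\<And>p q. \<phi> (p + q) = \<phi> p + \<phi> q" and smult: "\<And>c p. \<phi> (smult c p) = c * \<phi> p"
    and inv: "\<And>p. \<phi> ([:0, 1:] * \<rho> * p) = \<phi> p"
    and e: "e * e = 1" and s: "s = lin_poly e * (\<rho> - [:e:])"
    and refl: "\<And>j. j \<ge> j0 \<Longrightarrow> \<phi> (s ^ j * \<rho>) = \<phi> (s ^ j)"
    and z: "\<And>j. j \<ge> j0 \<Longrightarrow> \<phi> (s ^ j) = 0"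
    and "j \<ge> j0"
  shows "\<phi> (s ^ j * p) = 0"
proof -
  have s': "s = [:0,1:] * \<rho> - smult e [:0,1:] - smult e \<rho> + 1"
  proof -
    have "(x - c) * (\<rho> - c) = x * \<rho> - c * x - c * \<rho> + c * c" for x c :: "'a poly"
      by (simp add: algebra_simps)
    then have "s = [:0,1:] * \<rho> - [:e:] * [:0,1:] - [:e:] * \<rho> + [:e:] * [:e:]"
      unfolding s lin_poly_eq .
    moreover have "[:e:] * [:e:] = 1" using e by (simp add: one_pCons)
    ultimately show ?thesis by simp
  qed
  have diff: "\<phi> (p - q) = \<phi> p - \<phi> q" for p q
    using add[of p "smult (-1) q"] smult[of "-1" q] by simp
  have rec: "\<phi> (s ^ Suc j * p) = 2 * \<phi> (s ^ j * p) - e * \<phi> (s ^ j * p * [:0,1:]) - e * \<phi> (s ^ j * p * \<rho>)" for j p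
  proof -
    have "s ^ Suc j * p = [:0,1:] * \<rho> * (s ^ j * p) - smult e (s ^ j * p * [:0,1:])
        - smult e (s ^ j * p * \<rho>) + s ^ j * p"
      unfolding power_Suc by (subst (1) s') (simp add: algebra_simps)
    then have "\<phi> (s ^ Suc j * p) = \<phi> (s ^ j * p) - e * \<phi> (s ^ j * p * [:0,1:]) - e * \<phi> (s ^ j * p * \<rho>) + \<phi> (s ^ j * p)"
      by (simp only: add diff smult inv)
    then show ?thesis by simp
  qed
  have e0: "e \<noteq> 0" using e by auto
  \<comment> \<open>Two consecutive powers of \<open>X\<close> are carried along because the
    recursion has three terms: \<open>\<rho>\<close> lowers the exponent by one and \<open>X\<close>
    raises it. All \<open>j\<close> are treated together since the left side of \<open>rec\<close>
    lives at \<open>Suc j\<close>.\<close>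
  have mon: "\<forall>j\<ge>j0. \<phi> (s ^ j * [:0,1:] ^ i) = 0 \<and> \<phi> (s ^ j * [:0,1:] ^ Suc i) = 0" for i
  proof (induction i)
    case 0
    show ?case
    proof (intro allI impI conjI)
      fix j assume j: "j \<ge> j0"
      show "\<phi> (s ^ j * [:0,1:] ^ 0) = 0" using z[OF j] by simp
      show "\<phi> (s ^ j * [:0,1:] ^ Suc 0) = 0"
        using rec[of j 1] z[of "Suc j"] z[of j] refl[OF j] j e0 by simp
    qed
  next
    case (Suc i)
    show ?case
    proof (intro allI impI conjI)
      fix j assume j: "j \<ge> j0"
      show "\<phi> (s ^ j * [:0,1:] ^ Suc i) = 0" using Suc j by blast
      have "s ^ j * [:0,1:] ^ Suc i * \<rho> = [:0,1:] * \<rho> * (s ^ j * [:0,1:] ^ i)"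
        by (simp add: algebra_simps)
      then have "\<phi> (s ^ j * [:0,1:] ^ Suc i * \<rho>) = \<phi> (s ^ j * [:0,1:] ^ i)" using inv by metis
      moreover have "s ^ j * [:0,1:] ^ Suc i * [:0,1:] = s ^ j * [:0,1:] ^ Suc (Suc i)"
        by (simp add: algebra_simps)
      moreover have "\<phi> (s ^ Suc j * [:0,1:] ^ Suc i) = 0" using Suc j le_SucI by blast
      ultimately show "\<phi> (s ^ j * [:0,1:] ^ Suc (Suc i)) = 0"
        using rec[of j "[:0,1:] ^ Suc i"] Suc j e0 by simp
    qed
  qed
  have "\<phi> (s ^ j * ([:0,1:] ^ i * p)) = 0" for i
  proof (induction p arbitrary: i)
    case 0
    show ?case using smult[of 0 0] by simp
  next
    case (pCons a p)
    have "s ^ j * ([:0,1:] ^ i * pCons a p) = smult a (s ^ j * [:0,1:] ^ i) + s ^ j * ([:0,1:] ^ Suc i * p)"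
    proof -
      have "pCons a p = [:a:] + [:0,1:] * p" by simp
      then show ?thesis by (simp only:) (simp add: algebra_simps)
    qed
    then show ?case using pCons mon \<open>j \<ge> j0\<close> by (simp only: add smult) simp
  qed
  from this[of 0] show ?thesis by simp
qed

section \<open>Polynomials acting through an endomorphism\<close>

context vector_space
begin

sublocale endo: vector_space_pair scale scale by unfold_locales

lemma poly_act_eq_sum:
  assumes "degree p \<le> n"
  shows "poly_act scale \<sigma> p v = (\<Sum>i\<le>n. coeff p i *s (\<sigma> ^^ i) v)"
  unfolding poly_act_def
  by (rule sum.mono_neutral_left) (use assms in \<open>auto simp: coeff_eq_0\<close>)

lemma poly_act_0 [simp]: "poly_act scale \<sigma> 0 v = 0"
  and poly_act_1 [simp]: "poly_act scale \<sigma> 1 v = v"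
  by (simp_all add: poly_act_def)

lemma poly_act_add: "poly_act scale \<sigma> (p + q) v = poly_act scale \<sigma> p v + poly_act scale \<sigma> q v"
proof -
  define n where "n = max (degree p) (degree q)"
  have "degree p \<le> n" "degree q \<le> n" "degree (p + q) \<le> n"
    unfolding n_def by (auto intro: degree_add_le)
  then show ?thesis by (simp add: poly_act_eq_sum[of _ n] scale_left_distrib sum.distrib)
qed

lemma poly_act_smult: "poly_act scale \<sigma> (smult c p) v = c *s poly_act scale \<sigma> p v"
  by (simp add: poly_act_eq_sum[of _ "degree p"] degree_smult_le scale_sum_right)

lemma poly_act_diff: "poly_act scale \<sigma> (p - q) v = poly_act scale \<sigma> p v - poly_act scale \<sigma> q v"
  using poly_act_add[of \<sigma> p "smult (-1) q" v] poly_act_smult[of \<sigma> "-1" q v] by simp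

lemma poly_act_uminus: "poly_act scale \<sigma> (- p) v = - poly_act scale \<sigma> p v"
  using poly_act_smult[of \<sigma> "-1" p v] by simp

lemma poly_act_sum: "poly_act scale \<sigma> (sum p A) v = (\<Sum>i\<in>A. poly_act scale \<sigma> (p i) v)"
  by (induction A rule: infinite_finite_induct) (auto simp: poly_act_add)

end

locale endomorphism = vector_space scale
  for scale :: "'a::field \<Rightarrow> 'v::ab_group_add \<Rightarrow> 'v" (infixr \<open>*s\<close> 75) +
  fixes \<sigma> :: "'v \<Rightarrow> 'v"
  assumes lin: "Vector_Spaces.linear scale scale \<sigma>"
begin

abbreviation act :: "'a poly \<Rightarrow> 'v \<Rightarrow> 'v" where
  "act \<equiv> poly_act scale \<sigma>"

lemma hom_add: "\<sigma> (x + y) = \<sigma> x + \<sigma> y" and hom_scale: "\<sigma> (c *s x) = c *s \<sigma> x"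
  and hom_0 [simp]: "\<sigma> 0 = 0" and hom_diff: "\<sigma> (x - y) = \<sigma> x - \<sigma> y"
  using lin by (simp_all add: endo.linear_add endo.linear_scale endo.linear_0 endo.linear_diff)

lemma hom_sum: "\<sigma> (sum h A) = (\<Sum>i\<in>A. \<sigma> (h i))"
  by (induction A rule: infinite_finite_induct) (auto simp: hom_add)

lemma act_pCons: "act (pCons a p) v = a *s v + \<sigma> (act p v)"
proof -
  have "act (pCons a p) v = (\<Sum>i\<le>Suc (degree p). coeff (pCons a p) i *s (\<sigma> ^^ i) v)"
    by (rule poly_act_eq_sum) (simp add: degree_pCons_le)
  also have "\<dots> = a *s v + (\<Sum>i\<le>degree p. coeff p i *s \<sigma> ((\<sigma> ^^ i) v))"
    by (simp add: sum.atMost_Suc_shift del: sum.atMost_Suc)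
  finally show ?thesis
    by (simp add: poly_act_def hom_sum hom_scale)
qed

lemma act_add_right: "act p (u + v) = act p u + act p v"
  by (induction p) (auto simp: act_pCons hom_add scale_right_distrib)

lemma act_scale_right: "act p (c *s v) = c *s act p v"
  by (induction p) (auto simp: act_pCons hom_scale scale_right_distrib mult.commute)

lemma act_zero_right [simp]: "act p 0 = 0"
  using act_scale_right[of p 0 0] by simp

lemma act_minus_right: "act p (- v) = - act p v"
  using act_scale_right[of p "-1" v] by simp

lemma act_diff_right: "act p (u - v) = act p u - act p v"
  using act_add_right[of p u "- v"] by (simp add: act_minus_right)

lemma act_sum_right: "act p (sum h A) = (\<Sum>i\<in>A. act p (h i))"
  by (induction A rule: infinite_finite_induct) (auto simp: act_add_right)

lemma act_mult: "act (p * q) v = act p (act q v)"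
  by (induction p) (auto simp: act_pCons poly_act_add poly_act_smult)

lemma act_commute: "act p (act q v) = act q (act p v)"
  by (metis act_mult mult.commute)

lemma act_kill: "act p x = 0 \<Longrightarrow> act p (act q x) = 0"
  by (simp add: act_commute[of p])

lemma act_top: "act (p ^ m) x = 0 \<Longrightarrow> m > 0 \<Longrightarrow> act p (act (p ^ (m - 1)) x) = 0"
  by (metis Suc_diff_1 act_mult power_Suc)

lemma act_linear: "Vector_Spaces.linear scale scale (act p)"
  by unfold_locales (simp_all add: act_add_right act_scale_right)

lemma subspace_kernel_act: "subspace {v. act p v = 0}"
  by (auto simp: subspace_def act_add_right act_scale_right)

lemma act_X [simp]: "act [:0, 1:] v = \<sigma> v" and act_const [simp]: "act [:c:] v = c *s v"
  by (simp_all add: act_pCons)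

lemma act_lin_poly: "act (lin_poly c) v = \<sigma> v - c *s v"
  by (simp add: act_pCons lin_poly_def)

lemma act_dvd_0: "act p v = 0 \<Longrightarrow> p dvd q \<Longrightarrow> act q v = 0"
  by (auto simp: dvd_def act_mult act_commute[of p])

lemma act_power_mono: "act (p ^ m) v = 0 \<Longrightarrow> m \<le> n \<Longrightarrow> act (p ^ n) v = 0"
  using act_dvd_0 le_imp_power_dvd by blast

definition invariant :: "'v set \<Rightarrow> bool" where
  "invariant S \<longleftrightarrow> subspace S \<and> (\<forall>x\<in>S. \<sigma> x \<in> S)"

lemma invariant_act: "invariant S \<Longrightarrow> x \<in> S \<Longrightarrow> act p x \<in> S"
  by (induction p) (auto simp: invariant_def act_pCons subspace_0 subspace_add subspace_scale)

definition cyc :: "'v \<Rightarrow> 'v set" where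
  "cyc u = {act p u | p. True}"

lemma cycI [intro]: "act p u \<in> cyc u"
  by (auto simp: cyc_def)

lemma cyc_self: "u \<in> cyc u"
  using cycI[of 1 u] by simp

lemma invariant_cyc: "invariant (cyc u)"
  unfolding invariant_def subspace_def
proof (intro conjI ballI allI)
  show "0 \<in> cyc u" using cycI[of 0 u] by simp
next
  fix x y assume "x \<in> cyc u" "y \<in> cyc u"
  then obtain p q where "x = act p u" "y = act q u" by (auto simp: cyc_def)
  then show "x + y \<in> cyc u" using cycI[of "p + q" u] by (simp add: poly_act_add)
next
  fix c x assume "x \<in> cyc u"
  then obtain p where "x = act p u" by (auto simp: cyc_def)
  then show "c *s x \<in> cyc u" using cycI[of "smult c p" u] by (simp add: poly_act_smult)
next
  fix x assume "x \<in> cyc u"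
  then obtain p where "x = act p u" by (auto simp: cyc_def)
  then show "\<sigma> x \<in> cyc u" using cycI[of "[:0, 1:] * p" u] by (simp only: act_mult act_X)
qed

lemma cyc_subset: "invariant S \<Longrightarrow> u \<in> S \<Longrightarrow> cyc u \<subseteq> S"
  by (auto simp: cyc_def invariant_act)

text \<open>The submodules of such a cyclic module form a chain, so a power of \<open>X - c\<close>
  pushes any non-zero vector into the bottom line. Non-degeneracy of a cyclic summand thus reduces
  to a single value of the form.\<close>

lemma cyc_socle:
  assumes "act (lin_poly c ^ m) u = 0" "x \<in> cyc u" "x \<noteq> 0"
  obtains r a where "a \<noteq> 0" "act (lin_poly c ^ r) x = a *s act (lin_poly c ^ (m - 1)) u"
proof -
  obtain p where p: "x = act p u" using assms(2) by (auto simp: cyc_def)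
  with assms(3) have "p \<noteq> 0" by auto
  then obtain j q where q: "p = lin_poly c ^ j * q" "poly q c \<noteq> 0" by (rule lin_poly_power_factor)
  have "\<not> m \<le> j"
  proof
    assume "m \<le> j"
    then have "act (lin_poly c ^ j) u = 0" by (rule act_power_mono[OF assms(1)])
    then have "x = 0" using p q(1) by (simp only: act_mult act_commute[of _ q] act_zero_right)
    with assms(3) show False by simp
  qed
  then have jm: "m - 1 - j + j = m - 1" "Suc (m - 1) = m" by auto
  obtain h where h: "q = [:poly q c:] + lin_poly c * h" using poly_root_split by blast
  have "act (lin_poly c ^ (m - 1 - j)) x = act q (act (lin_poly c ^ (m - 1)) u)"
    unfolding p q(1) act_mult[symmetric] mult.assoc[symmetric] power_add[symmetric] jm(1)
    by (simp add: mult.commute)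
  also have "\<dots> = poly q c *s act (lin_poly c ^ (m - 1)) u + act h (act (lin_poly c ^ Suc (m - 1)) u)"
    by (subst h) (simp add: poly_act_add act_mult act_commute[of _ h])
  also have "\<dots> = poly q c *s act (lin_poly c ^ (m - 1)) u"
    unfolding jm(2) assms(1) by simp
  finally show thesis using that q(2) by blast
qed

text \<open>After the powers of \<open>X - c\<close> are split off from \<open>p\<close>, the
  cofactor is invertible modulo \<open>lin_poly c ^ m\<close> and can be cancelled; what remains is
  a comparison of exponents.\<close>

lemma annihilator_cyc:
  assumes "act (lin_poly c ^ m) u = 0" "act (lin_poly c ^ (m - 1)) u \<noteq> 0" "m > 0"
  shows "act p u = 0 \<longleftrightarrow> lin_poly c ^ m dvd p"
proof
  assume 0: "act p u = 0"
  show "lin_poly c ^ m dvd p"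
  proof (cases "p = 0")
    case False
    then obtain j q where q: "p = lin_poly c ^ j * q" "poly q c \<noteq> 0" by (rule lin_poly_power_factor)
    obtain w r where wr: "w * q + r * lin_poly c ^ m = 1" using lin_poly_power_bezout[OF q(2)] by blast
    have "act (lin_poly c ^ j) u = act ((w * q + r * lin_poly c ^ m) * lin_poly c ^ j) u" by (simp add: wr)
    also have "\<dots> = act w (act p u) + act (r * lin_poly c ^ j) (act (lin_poly c ^ m) u)"
      unfolding q(1) act_mult[symmetric] poly_act_add[symmetric] by (simp add: algebra_simps)
    also have "\<dots> = 0" using 0 assms(1) by simp
    finally have "act (lin_poly c ^ j) u = 0" .
    then have "\<not> j \<le> m - 1" using act_power_mono assms(2) by blast
    then have "m \<le> j" by simp
    then show ?thesis unfolding q(1) by (simp add: le_imp_power_dvd dvd_mult2)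
  qed simp
qed (rule act_dvd_0[OF assms(1)])

lemma eigenvector_exists:
  assumes "invariant S" "x \<in> S" "x \<noteq> 0" "act (\<Prod>a\<leftarrow>as. lin_poly a) x = 0"
  shows "\<exists>c y. y \<in> S \<and> y \<noteq> 0 \<and> act (lin_poly c) y = 0"
  using assms(2-)
proof (induction as arbitrary: x)
  case (Cons a as)
  show ?case
  proof (cases "act (lin_poly a) x = 0")
    case False
    have "act (\<Prod>a\<leftarrow>as. lin_poly a) (act (lin_poly a) x) = 0"
      using Cons.prems(3) by (simp add: act_mult act_commute[of "lin_poly a"])
    with Cons.IH[of "act (lin_poly a) x"] show ?thesis
      using False invariant_act[OF assms(1) Cons.prems(1)] by blast
  qed (use Cons in blast)
qed simp

text \<open>Fitting decomposition at \<open>c\<close>: \<open>act w\<close> projects onto the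
  generalized eigenspace along the image of \<open>lin_poly c ^ M\<close>. The lower bound
  \<open>n\<close> allows \<open>M\<close> to exceed the exponent of a vector given in
  advance.\<close>

lemma fitting:
  assumes "\<Omega> \<noteq> 0" "\<And>v. act \<Omega> v = 0"
  obtains M w where "M \<ge> n" "\<And>v k. act (lin_poly c ^ k) v = 0 \<Longrightarrow> act (lin_poly c ^ M) v = 0"
    and "\<And>v. act (lin_poly c ^ M) (act w v) = 0"
    and "\<And>v. \<exists>r. v = act w v + act (lin_poly c ^ M) (act r v)"
proof -
  obtain j q where q: "\<Omega> = lin_poly c ^ j * q" "poly q c \<noteq> 0"
    by (rule lin_poly_power_factor[OF assms(1)])
  define M where "M = max j n"
  then have Mj: "lin_poly c ^ M = lin_poly c ^ (M - j) * lin_poly c ^ j"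
    by (simp flip: power_add)
  have q0: "act (lin_poly c ^ M) (act q v) = 0" for v
    using assms(2)[of v] unfolding Mj q(1) by (simp add: act_mult)
  obtain w r where wr: "w * q + r * lin_poly c ^ M = 1" using lin_poly_power_bezout[OF q(2)] by blast
  show thesis
  proof (rule that[of M "w * q"])
    show "M \<ge> n" by (simp add: M_def)
  next
    fix v k assume k: "act (lin_poly c ^ k) v = 0"
    obtain w' r' where wr': "w' * q + r' * lin_poly c ^ k = 1" using lin_poly_power_bezout[OF q(2)] by blast
    have "act (lin_poly c ^ M) v = act ((w' * q + r' * lin_poly c ^ k) * lin_poly c ^ M) v" by (simp add: wr')
    also have "\<dots> = act w' (act (lin_poly c ^ M) (act q v)) + act (r' * lin_poly c ^ M) (act (lin_poly c ^ k) v)"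
      unfolding act_mult[symmetric] poly_act_add[symmetric] by (simp add: algebra_simps)
    finally show "act (lin_poly c ^ M) v = 0" using k q0 by simp
  next
    fix v
    show "act (lin_poly c ^ M) (act (w * q) v) = 0"
      by (simp add: act_mult act_commute[of _ w] q0)
  next
    fix v
    have "v = act (w * q + r * lin_poly c ^ M) v" by (simp add: wr)
    also have "\<dots> = act (w * q) v + act (lin_poly c ^ M) (act r v)"
      by (simp add: poly_act_add act_mult act_commute[of r])
    finally show "\<exists>r. v = act (w * q) v + act (lin_poly c ^ M) (act r v)" by blast
  qed
qed

end

context finite_dimensional_vector_space
begin

lemma dim_direct_sum:
  assumes A: "subspace A" and C: "subspace C" and AC: "\<And>x. x \<in> A \<Longrightarrow> x \<in> C \<Longrightarrow> x = 0"
    and D: "D = {a + c | a c. a \<in> A \<and> c \<in> C}"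
  shows "dim D = dim A + dim C"
proof -
  obtain B where B: "B \<subseteq> A" "independent B" "A \<subseteq> span B" "card B = dim A" using basis_exists by blast
  obtain E where E: "E \<subseteq> C" "independent E" "C \<subseteq> span E" "card E = dim C" using basis_exists by blast
  have fin: "finite B" "finite E" using B E finiteI_independent by auto
  have sp: "span B = A" "span E = C" using B E A C span_subspace by auto
  have disj: "B \<inter> E = {}"
    using B(1) E(1) AC B(2) dependent_zero by (metis disjoint_iff subsetD)
  have "independent (B \<union> E)"
  proof (rule independent_if_scalars_zero)
    show "finite (B \<union> E)" using fin by simp
  next
    fix h x assume h: "(\<Sum>x\<in>B \<union> E. h x *s x) = 0" and x: "x \<in> B \<union> E"
    have sum0: "(\<Sum>x\<in>B. h x *s x) + (\<Sum>x\<in>E. h x *s x) = 0"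
      using h sum.union_disjoint[OF fin disj, of "\<lambda>x. h x *s x"] by simp
    have 1: "(\<Sum>x\<in>B. h x *s x) \<in> A" "(\<Sum>x\<in>E. h x *s x) \<in> C"
      using B(1) E(1) A C by (auto intro!: subspace_sum subspace_scale)
    have "(\<Sum>x\<in>B. h x *s x) = - (\<Sum>x\<in>E. h x *s x)" using sum0 by (simp add: eq_neg_iff_add_eq_0)
    then have "(\<Sum>x\<in>B. h x *s x) \<in> C" using 1(2) C by (simp add: subspace_neg)
    then have "(\<Sum>x\<in>B. h x *s x) = 0" using AC 1(1) by blast
    moreover from this have "(\<Sum>x\<in>E. h x *s x) = 0" using sum0 by simp
    ultimately show "h x = 0" using x independentD[OF B(2) fin(1)] independentD[OF E(2) fin(2)] by blast
  qed
  moreover have "span (B \<union> E) = D" unfolding span_Un sp D by simp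
  ultimately have "dim D = card (B \<union> E)" using dim_span_eq_card_independent by metis
  then show ?thesis using card_Un_disjoint[OF fin disj] B E by simp
qed

end

section \<open>Forms with their asymmetry\<close>

text \<open>
  The assumption \<open>inv\<close> says that \<open>\<rho>\<close> represents the inverse of the asymmetry, so that the adjoint of
  a polynomial in the asymmetry is again such a polynomial.  Keeping \<open>\<rho>\<close> as a parameter lets two
  forms share it, and then adjoints are taken by the same operation on polynomials.
\<close>

locale asym_form = finite_dimensional_vector_space scale Basis + endomorphism scale \<sigma>
  for scale :: "'a::field \<Rightarrow> 'v::ab_group_add \<Rightarrow> 'v" (infixr \<open>*s\<close> 75)
    and Basis :: "'v set" and \<sigma> :: "'v \<Rightarrow> 'v" +
  fixes f :: "'v \<Rightarrow> 'v \<Rightarrow> 'a" and \<rho> :: "'a poly" and roots :: "'a list"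
  assumes bil: "bilinear_form scale f"
    and nondeg: "(\<And>v. f u v = 0) \<Longrightarrow> u = 0"
    and asym: "f v u = f u (\<sigma> v)"
    and inv: "act ([:0, 1:] * \<rho>) v = v"
    and split: "act (\<Prod>a\<leftarrow>roots. lin_poly a) v = 0"
begin

sublocale fd: finite_dimensional_vector_space_pair scale Basis scale Basis by unfold_locales

lemma
  form_add_left: "f (x + y) z = f x z + f y z" and
  form_add_right: "f z (x + y) = f z x + f z y" and
  form_scale_left: "f (c *s x) z = c * f x z" and
  form_scale_right: "f z (c *s x) = c * f z x"
proof -
  have "Vector_Spaces.linear scale (*) (\<lambda>u. f u z)" "Vector_Spaces.linear scale (*) (\<lambda>u. f z u)"
    using bil by (auto simp: bilinear_form_def)
  then have "module_hom scale (*) (\<lambda>u. f u z)" "module_hom scale (*) (\<lambda>u. f z u)"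
    by (simp_all add: module_hom_iff_linear)
  from module_hom.add[OF this(1)] module_hom.add[OF this(2)]
    module_hom.scale[OF this(1)] module_hom.scale[OF this(2)]
  show "f (x + y) z = f x z + f y z" "f z (x + y) = f z x + f z y"
    "f (c *s x) z = c * f x z" "f z (c *s x) = c * f z x" by auto
qed

lemma form_zero_left [simp]: "f 0 z = 0" and form_zero_right [simp]: "f z 0 = 0"
  using form_scale_left[of 0 0 z] form_scale_right[of z 0 0] by auto

lemma form_minus_left: "f (- x) z = - f x z" and form_minus_right: "f z (- x) = - f z x"
  using form_scale_left[of "-1" x z] form_scale_right[of z "-1" x] by auto

lemma form_diff_left: "f (x - y) z = f x z - f y z"
  and form_diff_right: "f z (x - y) = f z x - f z y"
  using form_add_left[of x "- y" z] form_add_right[of z x "- y"]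
  by (auto simp: form_minus_left form_minus_right)

lemma form_sum_left: "f (sum h A) z = (\<Sum>i\<in>A. f (h i) z)"
  and form_sum_right: "f z (sum h A) = (\<Sum>i\<in>A. f z (h i))"
  by (induction A rule: infinite_finite_induct, auto simp: form_add_left form_add_right)+

lemmas form_simps = form_add_left form_add_right form_scale_left form_scale_right
  form_diff_left form_diff_right form_minus_left form_minus_right

lemma subspace_orth_right: "subspace {x. f y x = 0}"
  by (auto simp: subspace_def form_simps)

lemma act_inv: "\<sigma> (act \<rho> v) = v" "act \<rho> (\<sigma> v) = v"
proof -
  show *: "\<sigma> (act \<rho> v) = v" using inv[of v] unfolding act_mult act_X .
  show "act \<rho> (\<sigma> v) = v" using * act_commute[of "[:0,1:]" \<rho> v] unfolding act_X by simp
qed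

lemma isometry: "f (\<sigma> u) (\<sigma> v) = f u v"
  unfolding asym[of u v] asym[of v "\<sigma> u"] ..

definition star :: "'a poly \<Rightarrow> 'a poly" where
  "star p = pcompose p \<rho>"

lemma star_mult [simp]: "star (p * q) = star p * star q"
  and star_lin_poly: "star (lin_poly c) = \<rho> - [:c:]"
  by (simp_all add: star_def pcompose_mult lin_poly_def pcompose_pCons)

lemma star_power [simp]: "star (p ^ n) = star p ^ n"
  by (induction n) (simp_all, simp add: star_def one_pCons)

lemma adj: "f (act p x) y = f x (act (star p) y)"
proof (induction p arbitrary: y)
  case (pCons a p)
  have "f (\<sigma> (act p x)) y = f (act p x) (act \<rho> y)"
    using isometry[of "act p x" "act \<rho> y"] by (simp add: act_inv)
  then show ?case
    by (simp add: act_pCons form_simps pCons star_def pcompose_pCons poly_act_add act_mult act_commute)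
qed (simp add: star_def)

lemma adj': "f x (act p y) = f (act (star p) x) y"
proof (induction p arbitrary: x)
  case (pCons a p)
  have "f x (\<sigma> (act p y)) = f (act \<rho> x) (act p y)"
    using isometry[of "act \<rho> x" "act p y"] by (simp add: act_inv)
  then show ?case
    by (simp add: act_pCons form_simps pCons star_def pcompose_pCons poly_act_add act_mult act_commute)
qed (simp add: star_def)

lemma form_act_act: "f (act p x) (act q y) = f (act (star q * p) x) y"
  by (simp add: adj' act_mult)

text \<open>Exchanging the arguments costs one application of \<open>\<sigma>\<close>, which an
  invariant subspace absorbs. Left and right orthogonality to such a subspace therefore
  agree.\<close>

lemma form_swap_0: "invariant S \<Longrightarrow> (\<And>y. y \<in> S \<Longrightarrow> f x y = 0) \<Longrightarrow> y \<in> S \<Longrightarrow> f y x = 0"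
  using asym[of y x] by (simp add: invariant_def)

lemma form_swap_0':
  assumes "invariant S" "\<And>y. y \<in> S \<Longrightarrow> f y x = 0" "y \<in> S"
  shows "f x y = 0"
  using asym[of "act \<rho> y" x] assms(2)[OF invariant_act[OF assms(1,3), of \<rho>]]
  by (simp add: act_inv)

section \<open>Orthogonal complements\<close>

text \<open>Testing the left radical suffices: by the two exchange lemmas above, the right radical
  of an invariant subspace is the same.\<close>

definition regular :: "'v set \<Rightarrow> bool" where
  "regular S \<longleftrightarrow> invariant S \<and> (\<forall>x\<in>S. (\<forall>y\<in>S. f x y = 0) \<longrightarrow> x = 0)"

definition ortho :: "'v set \<Rightarrow> 'v set \<Rightarrow> 'v set" where
  "ortho U S = {x\<in>S. \<forall>y\<in>U. f x y = 0}"

lemma regular_invariant: "regular S \<Longrightarrow> invariant S"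
  and regular_subspace: "regular S \<Longrightarrow> subspace S"
  by (auto simp: regular_def invariant_def)

lemma regularD: "regular S \<Longrightarrow> x \<in> S \<Longrightarrow> x \<noteq> 0 \<Longrightarrow> \<exists>y\<in>S. f x y \<noteq> 0"
  by (auto simp: regular_def)

lemma regular_UNIV: "regular UNIV"
  using nondeg by (auto simp: regular_def invariant_def)

lemma represent:
  assumes U: "regular U"
  obtains y where "y \<in> U" "\<And>u. u \<in> U \<Longrightarrow> f (x - y) u = 0"
proof -
  obtain B where B: "B \<subseteq> U" "independent B" "U \<subseteq> span B" "finite B"
    using basis_exists[of U] finiteI_independent by metis
  \<comment> \<open>The values of \<open>f x\<close> on the basis are used as coordinates in that
    same basis. This makes \<open>L\<close> an endomorphism of \<open>U\<close>, so injectivity on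
    \<open>U\<close> already yields surjectivity onto \<open>U\<close>.\<close>
  define L where "L x = (\<Sum>b\<in>B. f x b *s b)" for x
  have L: "Vector_Spaces.linear scale scale L"
    unfolding L_def
    by unfold_locales (simp_all add: form_simps scale_left_distrib sum.distrib scale_sum_right)
  have LU: "L x \<in> U" for x
    unfolding L_def using B(1) regular_subspace[OF U] by (auto intro!: subspace_sum subspace_scale)
  have L0: "(\<forall>u\<in>U. f x u = 0)" if "L x = 0" for x
  proof
    fix u assume "u \<in> U"
    have "f x b = 0" if "b \<in> B" for b
      using independentD[OF B(2,4) order_refl, of "f x"] \<open>L x = 0\<close> that unfolding L_def by blast
    then have "span B \<subseteq> {u. f x u = 0}" by (intro span_minimal subspace_orth_right) auto
    then show "f x u = 0" using \<open>u \<in> U\<close> B(3) by auto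
  qed
  have "span U = U" using regular_subspace[OF U] by simp
  have "\<forall>x\<in>U. L x = 0 \<longrightarrow> x = 0" using L0 U unfolding regular_def by blast
  then have "inj_on L (span U)"
    using module_hom.inj_on_iff_eq_0[OF L[folded module_hom_iff_linear] subspace_span, of U]
    unfolding \<open>span U = U\<close> by blast
  then have "dim (L ` U) = dim U" by (rule fd.dim_image_eq[OF L])
  moreover have "subspace (L ` U)" by (rule module_hom.subspace_image[OF L[folded module_hom_iff_linear] regular_subspace[OF U]])
  ultimately have "L ` U = U" using LU by (intro subspace_dim_equal) (auto simp: regular_subspace[OF U])
  then obtain y where y: "y \<in> U" "L y = L x" using LU[of x] by (metis imageE)
  then have "L (x - y) = 0" by (simp add: module_hom.diff[OF L[folded module_hom_iff_linear]])
  then show thesis using that y(1) L0 by blast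
qed

lemma ortho_subset: "ortho U S \<subseteq> S"
  by (auto simp: ortho_def)

lemma ortho_orth: "c \<in> ortho U S \<Longrightarrow> u \<in> U \<Longrightarrow> f c u = 0"
  by (simp add: ortho_def)

lemma ortho_orth':
  assumes "regular U" "c \<in> ortho U S" "u \<in> U"
  shows "f u c = 0"
  using form_swap_0[OF regular_invariant[OF assms(1)] ortho_orth[OF assms(2)] assms(3)] by simp

lemma ortho_decomp:
  assumes "regular U" "subspace S" "U \<subseteq> S" "x \<in> S"
  obtains u c where "u \<in> U" "c \<in> ortho U S" "x = u + c"
proof -
  obtain u where "u \<in> U" "\<And>v. v \<in> U \<Longrightarrow> f (x - u) v = 0" using represent[OF assms(1)] by blast
  with assms have "x - u \<in> ortho U S" by (auto simp: ortho_def subspace_diff)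
  with \<open>u \<in> U\<close> show thesis using that[of u "x - u"] by simp
qed

lemma ortho_Int: "regular U \<Longrightarrow> u \<in> U \<Longrightarrow> u \<in> ortho U S \<Longrightarrow> u = 0"
  by (auto simp: ortho_def regular_def)

lemma invariant_ortho:
  assumes "invariant U" "invariant S"
  shows "invariant (ortho U S)"
proof -
  have "f (\<sigma> x) y = 0" if "\<forall>y\<in>U. f x y = 0" "y \<in> U" for x y
    using that isometry[of x "act \<rho> y"] invariant_act[OF assms(1) that(2), of \<rho>] by (simp add: act_inv)
  with assms show ?thesis
    by (auto simp: invariant_def ortho_def subspace_def form_simps)
qed

lemma regular_ortho:
  assumes "regular U" "regular S" "U \<subseteq> S"
  shows "regular (ortho U S)"
  unfolding regular_def
proof (intro conjI ballI impI)
  show "invariant (ortho U S)" using assms by (intro invariant_ortho) (auto simp: regular_invariant)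
next
  fix x assume x: "x \<in> ortho U S" "\<forall>y\<in>ortho U S. f x y = 0"
  show "x = 0"
  proof (rule ccontr)
    assume "x \<noteq> 0"
    with x(1) assms(2) obtain y where y: "y \<in> S" "f x y \<noteq> 0" using regularD ortho_subset by blast
    obtain u c where "u \<in> U" "c \<in> ortho U S" "y = u + c"
      using ortho_decomp[OF assms(1) regular_subspace[OF assms(2)] assms(3) y(1)] by blast
    with x y(2) show False by (simp add: form_simps ortho_orth)
  qed
qed

definition ker :: "'v set \<Rightarrow> 'a poly \<Rightarrow> 'v set" where
  "ker S p = {x\<in>S. act p x = 0}"

lemma subspace_ker: "subspace S \<Longrightarrow> subspace (ker S p)"
  by (auto simp: ker_def subspace_def act_add_right act_scale_right)

lemma act_ortho_decomp:
  assumes "regular U" "regular S" "U \<subseteq> S" "u \<in> U" "c \<in> ortho U S" "act p (u + c) = 0"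
  shows "act p u = 0" "act p c = 0"
proof -
  have eq: "act p u = - act p c" using assms(6) by (simp add: act_add_right eq_neg_iff_add_eq_0)
  have cc: "act p c \<in> ortho U S"
    using invariant_act[OF regular_invariant[OF regular_ortho[OF assms(1-3)]] assms(5)] .
  have "act p u \<in> ortho U S"
    unfolding eq using subspace_neg[OF regular_subspace[OF regular_ortho[OF assms(1-3)]] cc] .
  moreover have "act p u \<in> U" using invariant_act[OF regular_invariant[OF assms(1)] assms(4)] .
  ultimately show "act p u = 0" using ortho_Int assms(1) by blast
  with eq show "act p c = 0" by simp
qed

text \<open>Both summands are invariant, so a polynomial kills a vector exactly if it kills both
  components. Through this formula the Jordan type passes to complements; the zero polynomial gives
  the plain dimension formula.\<close>

lemma dim_ker_ortho:
  assumes "regular U" "regular S" "U \<subseteq> S"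
  shows "dim (ker S p) = dim (ker U p) + dim (ker (ortho U S) p)"
proof (rule dim_direct_sum)
  show "subspace (ker U p)" "subspace (ker (ortho U S) p)"
    using assms by (simp_all add: subspace_ker regular_subspace regular_ortho)
  show "x = 0" if "x \<in> ker U p" "x \<in> ker (ortho U S) p" for x
    using that ortho_Int[OF assms(1)] by (auto simp: ker_def)
  show "ker S p = {a + c |a c. a \<in> ker U p \<and> c \<in> ker (ortho U S) p}"
  proof (intro equalityI subsetI)
    fix x assume "x \<in> ker S p"
    then have x: "x \<in> S" "act p x = 0" by (auto simp: ker_def)
    obtain u c where uc: "u \<in> U" "c \<in> ortho U S" "x = u + c"
      using ortho_decomp[OF assms(1) regular_subspace[OF assms(2)] assms(3) x(1)] by blast
    then have "u \<in> ker U p" "c \<in> ker (ortho U S) p"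
      using act_ortho_decomp[OF assms uc(1,2), of p] x(2) by (auto simp: ker_def)
    then show "x \<in> {a + c |a c. a \<in> ker U p \<and> c \<in> ker (ortho U S) p}" using uc(3) by blast
  next
    fix x assume "x \<in> {a + c |a c. a \<in> ker U p \<and> c \<in> ker (ortho U S) p}"
    then obtain a c where x: "x = a + c" "a \<in> ker U p" "c \<in> ker (ortho U S) p" by blast
    then have "a \<in> S" "c \<in> S" using assms(3) ortho_subset[of U S] by (auto simp: ker_def)
    with x show "x \<in> ker S p"
      using subspace_add[OF regular_subspace[OF assms(2)]] by (simp add: ker_def act_add_right)
  qed
qed

lemma ker_0 [simp]: "ker S 0 = S"
  by (simp add: ker_def)

lemma dim_ortho: "regular U \<Longrightarrow> regular S \<Longrightarrow> U \<subseteq> S \<Longrightarrow> dim S = dim U + dim (ortho U S)"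
  using dim_ker_ortho[of U S 0] by simp

section \<open>Generalized eigenspaces\<close>

lemmas fitting_split = fitting[OF prod_roots_nonzero split]

lemma act_lin_0: "act (lin_poly 0 ^ k) v = 0 \<Longrightarrow> v = 0"
proof (induction k arbitrary: v)
  case (Suc k)
  then have "\<sigma> (act (lin_poly 0 ^ k) v) = 0" by (simp add: act_mult act_lin_poly)
  then show ?case using Suc.IH act_inv(2) act_zero_right by metis
qed simp

text \<open>The adjoint of \<open>X - c\<close> is a unit times \<open>X - 1/c\<close>. This is the
  source of the pairing between the eigenvalues \<open>c\<close> and \<open>1/c\<close>, and of the
  special role of 1 and -1.\<close>

lemma star_lin_poly_act:
  assumes "c \<noteq> 0"
  shows "act (star (lin_poly c)) x = (- c) *s act (\<rho> * lin_poly (1 / c)) x"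
proof -
  have "act (\<rho> * lin_poly (1 / c)) x = x - (1 / c) *s act \<rho> x"
    by (simp add: act_mult act_lin_poly act_diff_right act_scale_right act_inv)
  with assms show ?thesis
    by (simp add: star_lin_poly poly_act_diff scale_right_diff_distrib)
qed

lemma star_lin_poly_power_act:
  assumes "c \<noteq> 0"
  shows "act (star (lin_poly c) ^ n) x = act (smult (- c) \<rho> ^ n) (act (lin_poly (1 / c) ^ n) x)"
proof (induction n)
  case (Suc n)
  have "act (star (lin_poly c) ^ Suc n) x = act (smult (- c) \<rho> * lin_poly (1 / c)) (act (star (lin_poly c) ^ n) x)"
    using star_lin_poly_act[OF assms, of "act (star (lin_poly c) ^ n) x"]
    by (simp only: power_Suc act_mult poly_act_smult mult_smult_left)
  then show ?case unfolding Suc by (simp add: act_mult[symmetric] ac_simps)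
qed simp

lemma act_rho_power: "act ([:0, 1:] ^ n) (act (\<rho> ^ n) x) = x"
proof (induction n)
  case (Suc n)
  have "act ([:0, 1:] ^ Suc n) (act (\<rho> ^ Suc n) x) = act ([:0, 1:] ^ n) (act ([:0,1:] * \<rho>) (act (\<rho> ^ n) x))"
    unfolding power_Suc act_mult act_commute[of "[:0,1:]" "[:0,1:] ^ n"] ..
  then show ?case using Suc inv by simp
qed simp

lemma unit_act_inv:
  assumes "c \<noteq> 0"
  obtains q where "\<And>x. act q (act (smult c \<rho> ^ n) x) = x"
proof
  fix x
  have "act (smult c \<rho> ^ n) x = c ^ n *s act (\<rho> ^ n) x"
    using poly_act_smult[of \<sigma> "c ^ n" "\<rho> ^ n" x] by (simp only: smult_power)
  then show "act (smult ((1 / c) ^ n) ([:0, 1:] ^ n)) (act (smult c \<rho> ^ n) x) = x"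
    using assms by (simp only: poly_act_smult act_scale_right scale_scale act_rho_power) (simp add: power_divide)
qed

text \<open>If \<open>1/b\<close> differs from \<open>c\<close>, then the adjoint of
  \<open>(X - b)^m\<close> is invertible on the generalized eigenspace of \<open>c\<close>. So
  \<open>y\<close> can be divided by it, and moving the factor to the left kills
  \<open>x\<close>.\<close>

lemma orth_eigenspaces:
  assumes "act (lin_poly b ^ m) x = 0" "act (lin_poly c ^ n) y = 0" "b * c \<noteq> 1"
  shows "f x y = 0"
proof (cases "b = 0")
  case True
  then have "x = 0" using assms(1) act_lin_0 by blast
  then show ?thesis by simp
next
  case False
  with assms(3) have "1 / b \<noteq> c" by auto
  then obtain w r where wr: "w * lin_poly (1 / b) ^ m + r * lin_poly c ^ n = 1"
    using lin_poly_power_coprime by blast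
  have "y = act (w * lin_poly (1 / b) ^ m + r * lin_poly c ^ n) y" by (simp add: wr)
  also have "\<dots> = act (lin_poly (1 / b) ^ m) (act w y)"
    using assms(2) by (simp add: poly_act_add act_mult act_commute[of w])
  finally have y: "y = act (lin_poly (1 / b) ^ m) (act w y)" .
  obtain q where q: "\<And>x. act q (act (smult (- b) \<rho> ^ m) x) = x"
    using unit_act_inv[of "- b" m] False by auto
  have "y = act q (act (star (lin_poly b) ^ m) (act w y))"
    unfolding star_lin_poly_power_act[OF False] q using y by simp
  also have "\<dots> = act (star (lin_poly b ^ m)) (act q (act w y))" by (simp add: act_commute[of q])
  finally have "f x y = f (act (lin_poly b ^ m) x) (act q (act w y))" unfolding adj by simp
  then show ?thesis using assms(1) by simp
qed

text \<open>Take any partner of \<open>x\<close> and keep its Fitting component at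
  \<open>1/c\<close>. The rest lies in the image of a high power of \<open>X - 1/c\<close>, whose
  adjoint kills \<open>x\<close>, so the pairing is unchanged.\<close>

lemma eigen_pairing:
  assumes "regular S" "x \<in> S" "x \<noteq> 0" "act (lin_poly c ^ k) x = 0"
  obtains y M where "y \<in> S" "act (lin_poly (1 / c) ^ M) y = 0" "f x y \<noteq> 0"
proof -
  have c: "c \<noteq> 0" using assms(3,4) act_lin_0 by blast
  obtain M w where M: "M \<ge> k" "\<And>v. act (lin_poly (1 / c) ^ M) (act w v) = 0"
    "\<And>v. \<exists>r. v = act w v + act (lin_poly (1 / c) ^ M) (act r v)"
    by (rule fitting_split[of k "1 / c"]) (rule that)
  obtain y where y: "y \<in> S" "f x y \<noteq> 0" using regularD assms by blast
  obtain r where r: "y = act w y + act (lin_poly (1 / c) ^ M) (act r y)" using M(3) by blast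
  have "f x (act (lin_poly (1 / c) ^ M) (act r y)) = 0"
  proof -
    have "act (lin_poly c ^ M) x = 0" using act_power_mono[OF assms(4) M(1)] .
    then have "act (star (lin_poly (1 / c) ^ M)) x = 0"
      using star_lin_poly_power_act[of "1 / c" M x] c by simp
    then show ?thesis unfolding adj' by simp
  qed
  moreover have "f x y = f x (act w y) + f x (act (lin_poly (1 / c) ^ M) (act r y))"
    by (subst (1) r) (rule form_add_right)
  ultimately have "f x (act w y) \<noteq> 0" using y(2) by simp
  then show thesis using that[of "act w y" M] M(2) invariant_act[OF regular_invariant[OF assms(1)] y(1)] by blast
qed

end

section \<open>The eigenvalues 1 and -1\<close>

text \<open>
  With \<open>t = \<sigma> - e\<close> and \<open>t\<^sup>* = \<sigma>\<^sup>-\<^sup>1 - e\<close>, this is the self-adjoint operator \<open>t t\<^sup>*\<close>, which equals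
  \<open>- e (t + t\<^sup>*)\<close> and is a unit times \<open>t\<^sup>2\<close>.
\<close>

definition norm_poly :: "'a::field poly \<Rightarrow> 'a \<Rightarrow> 'a poly" where
  "norm_poly \<rho> e = lin_poly e * (\<rho> - [:e:])"

lemma square_eq_1: "e * e = (1::'a::field) \<longleftrightarrow> e = 1 \<or> e = -1"
  by (metis power2_eq_1_iff power2_eq_square)

declare smult_minus_left [simp del]

context asym_form
begin

abbreviation "N \<equiv> norm_poly \<rho>"

lemma N_star: "N e = lin_poly e * star (lin_poly e)"
  by (simp add: norm_poly_def star_lin_poly)

text \<open>Composing \<open>\<rho>\<close> with itself need not return the polynomial
  \<open>X\<close>; \<open>star\<close> is an involution only on the operators, by uniqueness of
  adjoints.\<close>

lemma star_star_act: "act (star (star p)) x = act p x"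
proof -
  have "f (act (star (star p)) x - act p x) y = 0" for y
    using adj[of p x y] adj'[of x "star p" y] by (simp add: form_simps)
  from nondeg[OF this] show ?thesis by simp
qed

lemma N_self_adjoint: "f (act (N e ^ j) x) y = f x (act (N e ^ j) y)"
proof -
  have "act (star (N e) ^ j) y = act (N e ^ j) y" for y
    by (induction j arbitrary: y)
      (simp_all add: N_star act_mult star_star_act act_commute[of "lin_poly e"])
  then show ?thesis by (simp add: adj)
qed

lemma inv_square_1: "e * e = 1 \<Longrightarrow> 1 / e = (e::'a)"
  by (metis mult_1 mult_zero_left nonzero_eq_divide_eq)

lemma star_lin_power:
  "e * e = 1 \<Longrightarrow> act (star (lin_poly e) ^ n) x = act (smult (- e) \<rho> ^ n) (act (lin_poly e ^ n) x)"
  using star_lin_poly_power_act[of e n x] inv_square_1[of e] by (cases "e = 0") auto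

lemma N_power_act:
  assumes "e * e = 1"
  shows "act (N e ^ j) x = act (smult (- e) \<rho> ^ j) (act (lin_poly e ^ (2 * j)) x)"
proof -
  have "act (N e ^ j) x = act (star (lin_poly e) ^ j) (act (lin_poly e ^ j) x)"
    by (simp add: N_star power_mult_distrib act_mult act_commute)
  then show ?thesis
    using star_lin_power[OF assms] by (simp add: mult_2 power_add act_mult)
qed

lemma N_high: "e * e = 1 \<Longrightarrow> act (lin_poly e ^ m) x = 0 \<Longrightarrow> m \<le> 2 * j \<Longrightarrow> act (N e ^ j) x = 0"
  using act_power_mono[of "lin_poly e" m x "2 * j"] by (simp add: N_power_act)

lemma form_shift:
  "e * e = 1 \<Longrightarrow> f x (act (lin_poly e ^ j) y) = f (act (smult (- e) \<rho> ^ j) (act (lin_poly e ^ j) x)) y"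
  using adj'[of x "lin_poly e ^ j" y] star_lin_power[of e j x] by simp

lemma form_high:
  assumes "e * e = 1" "act (lin_poly e ^ m) x = 0" "m \<le> a + b"
  shows "f (act p (act (lin_poly e ^ a) x)) (act q (act (lin_poly e ^ b) y)) = 0"
proof -
  have "act (lin_poly e ^ (b + a)) x = 0"
    using act_power_mono[OF assms(2)] assms(3) by (simp add: add.commute)
  then have "act (lin_poly e ^ b) (act (star q) (act p (act (lin_poly e ^ a) x))) = 0"
    by (simp add: act_commute[of "lin_poly e ^ b"] power_add act_mult)
  then show ?thesis
    unfolding adj'[of _ q] form_shift[OF assms(1)] by simp
qed

lemma form_high_N:
  assumes "e * e = 1" "act (lin_poly e ^ m) x = 0" "m \<le> 2 * j + a + b"
  shows "f (act (N e ^ j) (act (lin_poly e ^ a) x)) (act (lin_poly e ^ b) y) = 0"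
  using form_high[OF assms(1,2), of "2 * j + a" b "smult (- e) \<rho> ^ j" 1 y] assms(3)
  by (simp add: N_power_act[OF assms(1)] power_add act_mult)

text \<open>On an eigenvector for \<open>e\<close> the inverse of \<open>\<sigma>\<close> acts as
  \<open>1/e = e\<close>, so the unit \<open>- e \<rho>\<close> produced by adjoints acts as -1. All
  the signs in the following lemmas come from here.\<close>

lemma unit_top:
  assumes "e * e = 1" "act (lin_poly e) z = 0"
  shows "act (smult (- e) \<rho> ^ n) z = (-1) ^ n *s z"
proof -
  have "\<sigma> z = e *s z" using assms(2) by (simp add: act_lin_poly)
  then have "z = e *s act \<rho> z" using act_inv(2)[of z] by (simp add: act_scale_right)
  then have "e *s z = e *s (e *s act \<rho> z)" by simp
  then have "act \<rho> z = e *s z" using assms(1) by simp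
  then have 1: "act (smult (- e) \<rho>) z = - z" using assms(1) by (simp add: poly_act_smult)
  show ?thesis
  proof (induction n)
    case (Suc n)
    have "act (smult (- e) \<rho> ^ Suc n) z = act (smult (- e) \<rho>) (act (smult (- e) \<rho> ^ n) z)"
      by (simp only: power_Suc act_mult)
    then show ?case by (simp only: Suc act_scale_right 1) simp
  qed simp
qed

lemma form_top:
  assumes "e * e = 1" "act (lin_poly e ^ m) x = 0" "a + b + 1 = m"
  shows "f (act (lin_poly e ^ a) x) (act (lin_poly e ^ b) y) = (-1) ^ b * f (act (lin_poly e ^ (m - 1)) x) y"
proof -
  have "act (lin_poly e) (act (lin_poly e ^ (m - 1)) x) = 0"
    using assms(2,3) by (intro act_top) simp_all
  from unit_top[OF assms(1) this] have "act (smult (- e) \<rho> ^ b) (act (lin_poly e ^ (b + a)) x) = (-1) ^ b *s act (lin_poly e ^ (m - 1)) x"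
    using assms(3) by (simp add: add.commute flip: assms(3))
  then show ?thesis
    unfolding form_shift[OF assms(1)] by (simp add: power_add act_mult form_simps)
qed

lemma form_top_N:
  assumes "e * e = 1" "act (lin_poly e ^ m) x = 0" "2 * j + b + 1 = m"
  shows "f (act (N e ^ j) x) (act (lin_poly e ^ b) y) = (-1) ^ (j + b) * f (act (lin_poly e ^ (m - 1)) x) y"
proof -
  have 0: "act (lin_poly e) (act (lin_poly e ^ (m - 1)) x) = 0"
    using assms(2,3) by (intro act_top) simp_all
  have "f (act (N e ^ j) x) (act (lin_poly e ^ b) y)
      = f (act (smult (- e) \<rho> ^ b) (act (lin_poly e ^ b) (act (smult (- e) \<rho> ^ j) (act (lin_poly e ^ (2 * j)) x)))) y"
    unfolding form_shift[OF assms(1)] N_power_act[OF assms(1)] ..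
  also have "\<dots> = f (act (smult (- e) \<rho> ^ (j + b)) (act (lin_poly e ^ (2 * j + b)) x)) y"
    unfolding act_mult[symmetric] power_add by (simp only: ac_simps)
  also have "2 * j + b = m - 1" using assms(3) by simp
  finally show ?thesis unfolding unit_top[OF assms(1) 0] form_scale_left .
qed

text \<open>Exchanging the arguments applies \<open>\<sigma>\<close> to an eigenvector, which gives
  the factor \<open>e\<close>; moving \<open>m - 1\<close> factors \<open>X - e\<close> across gives
  the power of -1. So the form induced on the kernel is symmetric or skew according to this
  sign.\<close>

lemma top_sym:
  assumes "e * e = 1" "act (lin_poly e ^ m) x = 0" "act (lin_poly e ^ m) y = 0" "m > 0"
  shows "f (act (lin_poly e ^ (m - 1)) y) x = e * (-1) ^ (m - 1) * f (act (lin_poly e ^ (m - 1)) x) y"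
proof -
  have "act (lin_poly e) (act (lin_poly e ^ (m - 1)) y) = 0"
    using assms(3,4) by (rule act_top)
  then have "\<sigma> (act (lin_poly e ^ (m - 1)) y) = e *s act (lin_poly e ^ (m - 1)) y" by (simp add: act_lin_poly)
  then have "f (act (lin_poly e ^ (m - 1)) y) x = e * f x (act (lin_poly e ^ (m - 1)) y)"
    unfolding asym[of "act (lin_poly e ^ (m - 1)) y" x] by (simp add: form_simps)
  then show ?thesis
    using form_top[OF assms(1,2), of 0 "m - 1" y] assms(4) by simp
qed

lemma lin_plus_star:
  assumes "e * e = 1"
  shows "act (lin_poly e) x + act (star (lin_poly e)) x = (- e) *s act (N e) x"
proof -
  have "act (N e) x = \<sigma> (act \<rho> x - e *s x) - e *s (act \<rho> x - e *s x)"
    by (simp add: N_star star_lin_poly act_mult act_lin_poly poly_act_diff)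
  also have "\<dots> = x - e *s \<sigma> x - e *s act \<rho> x + x"
    using assms by (simp add: hom_diff hom_scale act_inv scale_right_diff_distrib algebra_simps)
  finally have "(- e) *s act (N e) x = - (e *s x) + (e * e) *s \<sigma> x + (e * e) *s act \<rho> x - e *s x"
    by (simp add: scale_right_diff_distrib scale_right_distrib)
  then show ?thesis using assms by (simp add: act_lin_poly star_lin_poly poly_act_diff)
qed

text \<open>Supplies the reflection hypothesis of \<open>functional_zero\<close>. It holds because
  \<open>N e\<close> is self-adjoint and the asymmetry turns \<open>f x (\<sigma> u)\<close> into
  \<open>f u x\<close>.\<close>

lemma form_N_rho: "f (act (N e ^ j * \<rho>) u) u = f (act (N e ^ j) u) u"
proof -
  have "f (act (N e ^ j * \<rho>) u) u = f (act \<rho> (act (N e ^ j) u)) u"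
    by (simp add: act_mult act_commute)
  also have "\<dots> = f (act (N e ^ j) u) (\<sigma> u)"
    using isometry[of "act \<rho> (act (N e ^ j) u)" u] by (simp add: act_inv)
  also have "\<dots> = f u (act (N e ^ j) u)" by (rule asym[symmetric])
  finally show ?thesis by (simp add: N_self_adjoint)
qed

lemma act_inv_mult: "act ([:0, 1:] * \<rho> * p) u = act p u"
  using inv[of "act p u"] by (simp only: act_mult)

text \<open>The numbers \<open>f (act (N e ^ j) u) u\<close> control every value of the form on
  \<open>cyc u\<close>. For this reason the normal forms below prescribe nothing else.\<close>

lemma form_functional:
  assumes "e * e = 1" "\<And>j. j \<ge> j0 \<Longrightarrow> f (act (N e ^ j) u) u = 0" "j \<ge> j0"
  shows "f (act (N e ^ j * p) u) u = 0"
proof (rule functional_zero[of "\<lambda>p. f (act p u) u" \<rho> e "N e" j0 j p])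
  show "N e = lin_poly e * (\<rho> - [:e:])" by (rule norm_poly_def)
qed (simp_all only: poly_act_add poly_act_smult form_simps act_inv_mult form_N_rho assms)

lemma isotropic_if:
  assumes "e * e = 1" "\<And>j. f (act (N e ^ j) u) u = 0"
  shows "f (act p u) u = 0"
  using form_functional[OF assms(1), of 0 u 0 p] assms(2) by simp

lemma isotropic_cyc:
  assumes "\<And>p. f (act p u) u = 0" "x \<in> cyc u" "y \<in> cyc u"
  shows "f x y = 0"
  using assms by (auto simp: cyc_def form_act_act)

section \<open>Cyclic summands\<close>

lemma regular_cyc:
  assumes "e * e = 1" "act (lin_poly e ^ m) u = 0" "f (act (lin_poly e ^ (m - 1)) u) u \<noteq> 0"
  shows "regular (cyc u)"
  unfolding regular_def
proof (intro conjI ballI impI)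
  fix x assume x: "x \<in> cyc u" "\<forall>y\<in>cyc u. f x y = 0"
  show "x = 0"
  proof (rule ccontr)
    assume "x \<noteq> 0"
    then obtain r a where ra: "a \<noteq> 0" "act (lin_poly e ^ r) x = a *s act (lin_poly e ^ (m - 1)) u"
      by (rule cyc_socle[OF assms(2) x(1)])
    have "f (act (lin_poly e ^ r) x) u = f x (act (star (lin_poly e ^ r)) u)" by (rule adj)
    also have "\<dots> = 0" using x(2) by blast
    finally show False using ra assms(3) by (simp add: form_simps)
  qed
qed (rule invariant_cyc)

text \<open>For \<open>y = 1 + c s\<^sup>i t\<close> one has \<open>y\<^sup>* y = 1 - e c s\<^bsup>i+1\<^esup> + c\<^sup>2 s\<^bsup>2i+1\<^esup>\<close>.\<close>

lemma norm_step:
  assumes "e * e = 1" and u': "u' = u + c *s act (N e ^ i * lin_poly e) u"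
  shows "f (act (N e ^ l) u') u' = f (act (N e ^ l) u) u - e * c * f (act (N e ^ (l + i + 1)) u) u
    + c\<^sup>2 * f (act (N e ^ (l + 2 * i + 1)) u) u"
proof -
  define w where "w = act (N e ^ i * lin_poly e) u"
  have 1: "f (act (N e ^ l) w) u + f (act (N e ^ l) u) w = - e * f (act (N e ^ (l + i + 1)) u) u"
  proof -
    have "f (act (N e ^ l) u) w = f (act (star (lin_poly e)) (act (N e ^ (l + i)) u)) u"
      unfolding w_def act_mult N_self_adjoint[symmetric] adj'[of _ "lin_poly e"]
      by (simp add: power_add act_mult act_commute)
    moreover have "f (act (N e ^ l) w) u = f (act (lin_poly e) (act (N e ^ (l + i)) u)) u"
      unfolding w_def by (simp add: power_add act_mult act_commute)
    ultimately have "f (act (N e ^ l) w) u + f (act (N e ^ l) u) w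
      = f (act (lin_poly e) (act (N e ^ (l + i)) u) + act (star (lin_poly e)) (act (N e ^ (l + i)) u)) u"
      by (simp add: form_simps)
    then show ?thesis unfolding lin_plus_star[OF assms(1)] by (simp add: form_simps act_mult)
  qed
  have 2: "f (act (N e ^ l) w) w = f (act (N e ^ (l + 2 * i + 1)) u) u"
  proof -
    have "f (act (N e ^ l) w) w = f (act (star (lin_poly e)) (act (N e ^ i) (act (N e ^ l) (act (N e ^ i) (act (lin_poly e) u))))) u"
      unfolding w_def act_mult[of _ "lin_poly e"] adj'[of _ "lin_poly e"] N_self_adjoint[of e i, symmetric] ..
    also have "\<dots> = f (act (N e ^ (l + i + i) * (lin_poly e * star (lin_poly e))) u) u"
      unfolding act_mult[symmetric] power_add by (simp only: ac_simps)
    also have "N e ^ (l + i + i) * (lin_poly e * star (lin_poly e)) = N e ^ (l + 2 * i + 1)"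
      unfolding N_star[symmetric] by (simp add: mult_2 power_add mult.assoc[symmetric])
    finally show ?thesis .
  qed
  have "f (act (N e ^ l) u') u' = f (act (N e ^ l) u) u + c * (f (act (N e ^ l) w) u + f (act (N e ^ l) u) w)
    + c\<^sup>2 * f (act (N e ^ l) w) w"
    unfolding u' w_def[symmetric]
    by (simp add: act_add_right act_scale_right form_simps algebra_simps power2_eq_square)
  then show ?thesis unfolding 1 2 by simp
qed

text \<open>\<open>N e ^ K\<close> acts as a unit times \<open>(X - e)^(2K)\<close>, and
  \<open>2K\<close> is at most \<open>m - 1\<close> for either parity of \<open>m\<close>. Hence
  \<open>(X - e)^(m-1)\<close> factors through \<open>N e ^ K\<close>, and if the value were zero,
  all values behind that factor would vanish.\<close>

lemma top_value:
  assumes "e * e = 1" "act (lin_poly e ^ m) u = 0" "f (act (lin_poly e ^ (m - 1)) u) u \<noteq> 0"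
  shows "f (act (N e ^ ((m - 1) div 2)) u) u \<noteq> 0"
proof
  define K where "K = (m - 1) div 2"
  assume 0: "f (act (N e ^ ((m - 1) div 2)) u) u = 0"
  have "f (act (N e ^ j) u) u = 0" if "j \<ge> K" for j
  proof (cases "j = K")
    case False
    with that have "m \<le> 2 * j" unfolding K_def by linarith
    then show ?thesis using N_high[OF assms(1,2)] by simp
  qed (use 0 K_def in simp)
  then have z: "f (act (N e ^ K * p) u) u = 0" for p by (intro form_functional[OF assms(1)]) auto
  \<comment> \<open>Applying \<open>\<sigma>\<close> cancels \<open>\<rho>\<close> in the formula
    for \<open>N e\<close>, so \<open>(X - e)^2\<close> acts as \<open>- e X\<close> times
    \<open>N e\<close>.\<close>
  have sq: "act (lin_poly e ^ 2) x = act (smult (- e) [:0, 1:] * N e) x" for x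
  proof -
    have "act (N e) x = (- e) *s act \<rho> (act (lin_poly e ^ 2) x)"
      using N_power_act[OF assms(1), of 1 x] by (simp add: poly_act_smult poly_act_uminus)
    then have "\<sigma> (act (N e) x) = (- e) *s act (lin_poly e ^ 2) x" by (simp only: hom_scale act_inv)
    then have "(- e) *s \<sigma> (act (N e) x) = (e * e) *s act (lin_poly e ^ 2) x" by simp
    then show ?thesis unfolding act_mult poly_act_smult act_X assms(1) by simp
  qed
  have pw: "act (lin_poly e ^ (2 * k)) x = act ((smult (- e) [:0, 1:] * N e) ^ k) x" for k x
  proof (induction k arbitrary: x)
    case (Suc k)
    have "act (lin_poly e ^ (2 * Suc k)) x = act (lin_poly e ^ (2 * k)) (act (lin_poly e ^ 2) x)"
      unfolding act_mult[symmetric] power_add[symmetric] by simp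
    then show ?case by (simp only: sq Suc power_Suc2 act_mult)
  qed simp
  have "m - 1 = 2 * K + (m - 1 - 2 * K)" unfolding K_def by simp
  then have "lin_poly e ^ (m - 1) = lin_poly e ^ (2 * K) * lin_poly e ^ (m - 1 - 2 * K)"
    by (metis power_add)
  then have "act (lin_poly e ^ (m - 1)) u = act (N e ^ K * (smult (- e) [:0, 1:] ^ K * lin_poly e ^ (m - 1 - 2 * K))) u"
    by (simp only: act_mult[of "lin_poly e ^ (2 * K)"] pw) (simp only: act_mult[symmetric] power_mult_distrib ac_simps)
  with z assms(3) show False by simp
qed

lemma cyc_normal:
  assumes qc: "quadratically_closed TYPE('a)" and e: "e * e = 1" and m: "m > 0"
    and u: "act (lin_poly e ^ m) u = 0" "f (act (lin_poly e ^ (m - 1)) u) u \<noteq> 0"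
  obtains u' c where "u' \<in> cyc u" "act (lin_poly e ^ m) u' = 0" "c \<noteq> 0"
    "act (lin_poly e ^ (m - 1)) u' = c *s act (lin_poly e ^ (m - 1)) u"
    "f (act (lin_poly e ^ (m - 1)) u') u' \<noteq> 0"
    "\<And>j. f (act (N e ^ j) u') u' = (if j = (m - 1) div 2 then 1 else 0)"
proof -
  define K where "K = (m - 1) div 2"
  have "\<exists>u' c. u' \<in> cyc u \<and> act (lin_poly e ^ m) u' = 0 \<and> c \<noteq> 0 \<and>
    act (lin_poly e ^ (m - 1)) u' = c *s act (lin_poly e ^ (m - 1)) u \<and>
    f (act (lin_poly e ^ (m - 1)) u') u' \<noteq> 0 \<and>
    (\<forall>j. K \<le> j + n \<longrightarrow> f (act (N e ^ j) u') u' = (if j = K then 1 else 0))" for n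
  proof (induction n)
    case 0
    have K0: "f (act (N e ^ K) u) u \<noteq> 0" unfolding K_def by (rule top_value[OF e u])
    obtain a where a: "a\<^sup>2 = 1 / f (act (N e ^ K) u) u" using quadratically_closed_sqrt[OF qc] by blast
    have a0: "a \<noteq> 0" using a K0 by auto
    have "f (act (N e ^ j) u) u = 0" if "j > K" for j
    proof -
      from that have "m \<le> 2 * j" unfolding K_def by linarith
      then show ?thesis using N_high[OF e u(1)] by simp
    qed
    then show ?case
      using u a0 a K0 cycI[of "[:a:]" u]
      by (intro exI[of _ "a *s u"] exI[of _ a]) (auto simp: act_scale_right form_simps power2_eq_square[symmetric] mult.assoc[symmetric])
  next
    case (Suc n)
    then obtain u' c where u': "u' \<in> cyc u" "act (lin_poly e ^ m) u' = 0" "c \<noteq> 0"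
      "act (lin_poly e ^ (m - 1)) u' = c *s act (lin_poly e ^ (m - 1)) u"
      "f (act (lin_poly e ^ (m - 1)) u') u' \<noteq> 0"
      and val: "\<And>j. K \<le> j + n \<Longrightarrow> f (act (N e ^ j) u') u' = (if j = K then 1 else 0)" by blast
    show ?case
    proof (cases "K \<le> n")
      case True
      then have "\<And>j. K \<le> j + n" by simp
      then show ?thesis using u' val by (intro exI[of _ u'] exI[of _ c]) simp
    next
      case False
      define j0 where "j0 = K - n - 1"
      have j0: "j0 + n + 1 = K" using False by (simp add: j0_def)
      \<comment> \<open>In \<open>norm_step\<close> with \<open>l = j0\<close> and
        \<open>i = n\<close> the linear term sits at index \<open>j0 + n + 1 = K\<close>, where the
        value is already 1. The quadratic term sits at \<open>K + n\<close> and survives only for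
        \<open>n = 0\<close>. For larger indices both correction terms lie beyond \<open>K\<close>
        and vanish.\<close>
      have "- e \<noteq> 0" using e by auto
      then obtain d where d: "f (act (N e ^ j0) u') u' + (- e) * d + f (act (N e ^ (K + n)) u') u' * d\<^sup>2 = 0"
        using quadratically_closed_root[OF qc] by blast
      define w where "w = u' + d *s act (N e ^ n * lin_poly e) u'"
      have tw: "act (lin_poly e ^ k) w = act (lin_poly e ^ k) u' + d *s act (N e ^ n) (act (lin_poly e ^ Suc k) u')" for k
        unfolding w_def act_add_right act_scale_right act_mult[symmetric] power_Suc by (simp only: ac_simps)
      have "w \<in> cyc u" unfolding w_def
        using invariant_cyc[of u] u'(1)
        by (intro subspace_add subspace_scale invariant_act) (auto simp: invariant_def)
      moreover have "act (lin_poly e ^ Suc m) u' = 0" by (rule act_power_mono[OF u'(2)]) simp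
      then have "act (lin_poly e ^ m) w = 0" unfolding tw using u'(2) by simp
      moreover have tw1: "act (lin_poly e ^ (m - 1)) w = act (lin_poly e ^ (m - 1)) u'"
        unfolding tw using u'(2) m by simp
      moreover have "f (act (lin_poly e ^ (m - 1)) w) w \<noteq> 0"
      proof -
        have "f (act (lin_poly e ^ (m - 1)) u') (act (N e ^ n) (act (lin_poly e ^ 1) u')) = 0"
          using form_high[OF e u'(2), of "m - 1" 1 1] by simp
        then show ?thesis unfolding tw1 using u'(5)
          by (simp add: w_def form_simps act_mult)
      qed
      moreover have "f (act (N e ^ j) w) w = (if j = K then 1 else 0)" if "K \<le> j + Suc n" for j
      proof (cases "j = j0")
        case True
        have j2: "j0 + 2 * n + 1 = K + n" using j0 by simp
        show ?thesis
          unfolding w_def norm_step[OF e refl] True j0 j2 using d j0 val[of K] by (simp add: mult.commute)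
      next
        case False
        then have jn: "K \<le> j + n" using that j0 by simp
        then show ?thesis unfolding w_def norm_step[OF e refl] using val[OF jn] val[of "j + n + 1"] val[of "j + 2 * n + 1"]
          by simp
      qed
      ultimately show ?thesis using u'(3,4) by metis
    qed
  qed
  from this[of K] show thesis using that unfolding K_def by (metis le_add2)
qed

section \<open>Hyperbolic summands\<close>

text \<open>The last clause puts the pairing of the two isotropic halves into a normal form that
  involves only \<open>c\<close> and \<open>m\<close>, so that any two such pairs have the same Gram
  data.\<close>

definition hyper :: "'a \<Rightarrow> nat \<Rightarrow> 'v \<Rightarrow> 'v \<Rightarrow> bool" where
  "hyper c m u v \<longleftrightarrow> c \<noteq> 0 \<and> m > 0 \<and> act (lin_poly c ^ m) u = 0 \<and> act (lin_poly (1 / c) ^ m) v = 0 \<and>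
     (\<forall>p. f (act p u) u = 0) \<and> (\<forall>p. f (act p v) v = 0) \<and>
     (\<forall>i. f (act (lin_poly c ^ i) u) v = (if i = m - 1 then 1 else 0))"

definition hyp :: "'v \<Rightarrow> 'v \<Rightarrow> 'v set" where
  "hyp u v = {x + y | x y. x \<in> cyc u \<and> y \<in> cyc v}"

lemma invariant_hyp: "invariant (hyp u v)"
  unfolding invariant_def
proof
  show "subspace (hyp u v)" unfolding hyp_def
    using invariant_cyc by (intro subspace_sums) (auto simp: invariant_def)
  show "\<forall>x\<in>hyp u v. \<sigma> x \<in> hyp u v"
  proof
    fix x assume "x \<in> hyp u v"
    then obtain y z where x: "x = y + z" "y \<in> cyc u" "z \<in> cyc v" by (auto simp: hyp_def)
    then have "\<sigma> y \<in> cyc u" "\<sigma> z \<in> cyc v" using invariant_cyc by (auto simp: invariant_def)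
    then show "\<sigma> x \<in> hyp u v" unfolding x(1) hom_add hyp_def by blast
  qed
qed

lemma hyp_subset: "invariant S \<Longrightarrow> u \<in> S \<Longrightarrow> v \<in> S \<Longrightarrow> hyp u v \<subseteq> S"
  using cyc_subset by (fastforce simp: hyp_def invariant_def intro: subspace_add)

lemma hypI: "x \<in> cyc u \<Longrightarrow> y \<in> cyc v \<Longrightarrow> x + y \<in> hyp u v"
  by (auto simp: hyp_def)

lemma zero_cyc: "0 \<in> cyc u"
  using cycI[of 0 u] by simp

lemma cyc_hyp: "cyc u \<subseteq> hyp u v" "cyc v \<subseteq> hyp u v"
  using hypI[of _ u 0 v] hypI[of 0 u _ v] zero_cyc by auto

lemma hyper_faithful:
  assumes h: "hyper c m u v"
  shows "x \<in> cyc u \<Longrightarrow> (\<And>y. y \<in> cyc v \<Longrightarrow> f x y = 0) \<Longrightarrow> x = 0"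
    and "x \<in> cyc v \<Longrightarrow> (\<And>y. y \<in> cyc u \<Longrightarrow> f x y = 0) \<Longrightarrow> x = 0"
proof -
  have top: "f (act (lin_poly c ^ (m - 1)) u) v = 1" using h by (simp add: hyper_def)
  assume x: "x \<in> cyc u" "\<And>y. y \<in> cyc v \<Longrightarrow> f x y = 0"
  show "x = 0"
  proof (rule ccontr)
    assume "x \<noteq> 0"
    have "act (lin_poly c ^ m) u = 0" using h by (simp add: hyper_def)
    then obtain r a where ra: "a \<noteq> 0" "act (lin_poly c ^ r) x = a *s act (lin_poly c ^ (m - 1)) u"
      by (rule cyc_socle[OF _ x(1) \<open>x \<noteq> 0\<close>])
    have "f (act (lin_poly c ^ r) x) v = f x (act (star (lin_poly c ^ r)) v)" by (rule adj)
    also have "\<dots> = 0" using x(2) by blast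
    finally show False using ra top by (simp add: form_simps)
  qed
next
  have top: "f (act (lin_poly c ^ (m - 1)) u) v = 1" and c: "c \<noteq> 0" using h by (auto simp: hyper_def)
  assume x: "x \<in> cyc v" "\<And>y. y \<in> cyc u \<Longrightarrow> f x y = 0"
  show "x = 0"
  proof (rule ccontr)
    assume "x \<noteq> 0"
    have "act (lin_poly (1 / c) ^ m) v = 0" using h by (simp add: hyper_def)
    then obtain r a where ra: "a \<noteq> 0" "act (lin_poly (1 / c) ^ r) x = a *s act (lin_poly (1 / c) ^ (m - 1)) v"
      by (rule cyc_socle[OF _ x(1) \<open>x \<noteq> 0\<close>])
    \<comment> \<open>\<open>E\<close> is the unit by which the adjoint of
      \<open>(X - c)^(m-1)\<close> differs from \<open>(X - 1/c)^(m-1)\<close>. Applying its adjoint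
      to \<open>u\<close> turns the pairing with the bottom line of \<open>cyc v\<close> into the
      normalised value 1.\<close>
    define E where "E = smult (- c) \<rho> ^ (m - 1)"
    have "f (act (star E) u) (act (lin_poly (1 / c) ^ r) x)
      = f (act (star (lin_poly (1 / c) ^ r)) (act (star E) u)) x" by (rule adj')
    also have "\<dots> = f x (\<sigma> (act (star (lin_poly (1 / c) ^ r)) (act (star E) u)))" by (rule asym)
    also have "\<dots> = 0"
      using x(2) invariant_cyc[of u] invariant_act[OF invariant_cyc] cycI by (auto simp: invariant_def)
    finally have "f (act (star E) u) (act (lin_poly (1 / c) ^ (m - 1)) v) = 0" using ra by (simp add: form_simps)
    moreover have "f (act (star E) u) (act (lin_poly (1 / c) ^ (m - 1)) v) = f (act (lin_poly c ^ (m - 1)) u) v"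
      unfolding adj'[symmetric] adj[of "lin_poly c ^ (m - 1)"] star_power star_lin_poly_power_act[OF c] E_def[symmetric] ..
    ultimately show False using top by simp
  qed
qed

lemma regular_hyp:
  assumes h: "hyper c m u v"
  shows "regular (hyp u v)"
  unfolding regular_def
proof (intro conjI ballI impI)
  fix x assume "x \<in> hyp u v" and x: "\<forall>y\<in>hyp u v. f x y = 0"
  then obtain x1 x2 where x12: "x1 \<in> cyc u" "x2 \<in> cyc v" "x = x1 + x2" by (auto simp: hyp_def)
  have iso: "f y z = 0" if "y \<in> cyc u \<and> z \<in> cyc u \<or> y \<in> cyc v \<and> z \<in> cyc v" for y z
    using that h isotropic_cyc by (auto simp: hyper_def)
  have "f x1 y = 0" if "y \<in> cyc v" for y
    using bspec[OF x subsetD[OF cyc_hyp(2) that]] that iso[of x2 y] x12 by (simp add: form_simps)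
  then have "x1 = 0" using hyper_faithful(1)[OF h x12(1)] by blast
  have "f x2 y = 0" if "y \<in> cyc u" for y
    using bspec[OF x subsetD[OF cyc_hyp(1) that]] that iso[of x1 y] x12 by (simp add: form_simps)
  then have "x2 = 0" using hyper_faithful(2)[OF h x12(2)] by blast
  show "x = 0" using \<open>x1 = 0\<close> \<open>x2 = 0\<close> x12 by simp
qed (rule invariant_hyp)

lemma hyper_scale:
  assumes uv: "c \<noteq> 0" "m > 0" "act (lin_poly c ^ m) u = 0" "act (lin_poly (1 / c) ^ m) v = 0"
     "\<And>p. f (act p u) u = 0" "\<And>p. f (act p v) v = 0" "f (act (lin_poly c ^ (m - 1)) u) v \<noteq> 0"
  obtains v' where "v' \<in> cyc v" "hyper c m u v'"
proof -
  have high: "act (lin_poly c ^ i) u = 0" if "i > m - 1" for i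
    using act_power_mono[OF uv(3), of i] that by simp
  have "\<exists>v'\<in>cyc v. \<forall>i. m - 1 \<le> i + n \<longrightarrow> f (act (lin_poly c ^ i) u) v' = (if i = m - 1 then 1 else 0)" for n
  proof (induction n)
    case 0
    define a where "a = 1 / f (act (lin_poly c ^ (m - 1)) u) v"
    show ?case
      using high uv(7) cycI[of "[:a:]" v]
      by (intro bexI[of _ "a *s v"]) (auto simp: a_def form_simps)
  next
    case (Suc n)
    then obtain v' where v': "v' \<in> cyc v"
      "\<And>i. m - 1 \<le> i + n \<Longrightarrow> f (act (lin_poly c ^ i) u) v' = (if i = m - 1 then 1 else 0)" by blast
    show ?case
    proof (cases "m - 1 \<le> n")
      case True
      then show ?thesis using v' by (intro bexI[of _ v']) auto
    next
      case False
      define i0 where "i0 = m - 1 - n - 1"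
      have i0: "i0 + n + 1 = m - 1" using False by (simp add: i0_def)
      \<comment> \<open>The adjoint moves \<open>(X - c)^(n+1)\<close> over to \<open>u\<close>,
        shifting the index \<open>i0\<close> to \<open>m - 1\<close>, where the value is 1. Larger
        indices are shifted past \<open>m - 1\<close> and stay as they are.\<close>
      define w where "w = v' - f (act (lin_poly c ^ i0) u) v' *s act (star (lin_poly c ^ (n + 1))) v'"
      have w: "f (act (lin_poly c ^ i) u) w
        = f (act (lin_poly c ^ i) u) v' - f (act (lin_poly c ^ i0) u) v' * f (act (lin_poly c ^ (i + n + 1)) u) v'" for i
        unfolding w_def form_diff_right form_scale_right adj[symmetric] act_mult[symmetric] power_add[symmetric]
        by (simp add: ac_simps)
      have "w \<in> cyc v" unfolding w_def
        using invariant_cyc[of v] v'(1)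
        by (intro subspace_diff subspace_scale invariant_act) (auto simp: invariant_def)
      moreover have "f (act (lin_poly c ^ i) u) w = (if i = m - 1 then 1 else 0)" if "m - 1 \<le> i + Suc n" for i
      proof (cases "i = i0")
        case True
        then show ?thesis unfolding w True i0 using v'(2)[of "m - 1"] i0 by simp
      next
        case False
        then have "m - 1 \<le> i + n" using that i0 by simp
        then show ?thesis unfolding w using v'(2)[of i] v'(2)[of "i + n + 1"] by simp
      qed
      ultimately show ?thesis by blast
    qed
  qed
  from this[of "m - 1"] obtain v' where v': "v' \<in> cyc v"
    "\<And>i. f (act (lin_poly c ^ i) u) v' = (if i = m - 1 then 1 else 0)" by auto
  obtain q where q: "v' = act q v" using v'(1) by (auto simp: cyc_def)
  have "hyper c m u v'"
    unfolding hyper_def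
  proof (intro conjI allI)
    show "act (lin_poly (1 / c) ^ m) v' = 0"
      unfolding q act_commute[of _ q] uv(4) by simp
    show "f (act p v') v' = 0" for p
      using isotropic_cyc[OF uv(6)] v'(1) invariant_act[OF invariant_cyc] by blast
  qed (use uv v' in auto)
  with v'(1) show thesis using that by blast
qed

text \<open>
  The values \<open>f(s\<^sup>i u, u)\<close> are killed one after the other, for decreasing \<open>i\<close>, by replacing \<open>u\<close> by
  \<open>u + c t\<^sup>d v\<close>.  The linear term in \<open>c\<close> is \<open>f(s\<^sup>i u, (1 + \<sigma>) t\<^sup>d v)\<close>, and \<open>1 + \<sigma>\<close> is \<open>t\<close> if \<open>e = -1\<close>
  (in particular in characteristic 2) and a unit otherwise; hence the two choices of \<open>d\<close>.
\<close>

lemma isotropic_vector_exists: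
  assumes qc: "quadratically_closed TYPE('a)" and e: "e * e = 1" and m: "m > 0"
    and S: "invariant S"
    and alt: "\<And>x. x \<in> S \<Longrightarrow> act (lin_poly e ^ m) x = 0 \<Longrightarrow> f (act (lin_poly e ^ (m - 1)) x) x = 0"
    and u: "u \<in> S" "act (lin_poly e ^ m) u = 0"
    and v: "v \<in> S" "act (lin_poly e ^ m) v = 0"
    and uv: "f (act (lin_poly e ^ (m - 1)) u) v \<noteq> 0"
  obtains u' where "u' \<in> S" "act (lin_poly e ^ m) u' = 0" "f (act (lin_poly e ^ (m - 1)) u') v \<noteq> 0"
    "\<And>p. f (act p u') u' = 0"
proof -
  \<comment> \<open>Start of the descent: up to a unit \<open>N e ^ i\<close> is
    \<open>(X - e)^(2i)\<close>, and for \<open>2i = m - 1\<close> the value is, up to sign, the one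
    assumed to vanish.\<close>
  have H: "f (act (N e ^ i) x) x = 0" if x: "x \<in> S" "act (lin_poly e ^ m) x = 0" and i: "m \<le> 2 * i + 1" for i x
  proof (cases "m \<le> 2 * i")
    case True
    then show ?thesis using N_high[OF e x(2)] by simp
  next
    case False
    with i have "2 * i + 0 + 1 = m" by simp
    from form_top_N[OF e x(2) this, of x] alt[OF x] show ?thesis by simp
  qed
  have "\<exists>u'\<in>S. act (lin_poly e ^ m) u' = 0 \<and> f (act (lin_poly e ^ (m - 1)) u') v \<noteq> 0 \<and>
    (\<forall>i. m \<le> i + n \<longrightarrow> f (act (N e ^ i) u') u' = 0)" for n
  proof (induction n)
    case 0
    show ?case using u uv H by (intro bexI[of _ u]) auto
  next
    case (Suc n)
    then obtain u' where u': "u' \<in> S" "act (lin_poly e ^ m) u' = 0"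
      "f (act (lin_poly e ^ (m - 1)) u') v \<noteq> 0"
      and val: "\<And>i. m \<le> i + n \<Longrightarrow> f (act (N e ^ i) u') u' = 0" by blast
    show ?case
    proof (cases "m \<le> n \<or> m \<le> 2 * (m - n - 1) + 1")
      case True
      have "f (act (N e ^ i) u') u' = 0" if "m \<le> i + Suc n" for i
        using True val[of i] H[OF u'(1,2), of i] that by (cases "m \<le> i + n") auto
      then show ?thesis using u' by blast
    next
      case False
      define j where "j = m - n - 1"
      have j: "j + n + 1 = m" "2 * j + 2 \<le> m" using False by (auto simp: j_def)
      \<comment> \<open>In both cases the leading term of \<open>(1 + \<sigma>) (X - e)^d v\<close>
        is a non-zero multiple of \<open>(X - e)^(m-1-2j) v\<close>, the exponent complementary to
        that of \<open>N e ^ j\<close>. The factor \<open>1 + \<sigma>\<close> contributes one power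
        of \<open>X - e\<close> exactly when \<open>e = -1\<close>.\<close>
      define d where "d = (if e = -1 then m - 2 - 2 * j else m - 1 - 2 * j)"
      define w where "w = act (lin_poly e ^ d) v"
      have w: "w \<in> S" "act (lin_poly e ^ m) w = 0"
        using invariant_act[OF S v(1)] v(2) by (simp_all add: w_def act_commute[of _ "lin_poly e ^ d"])
      have one_plus: "w + \<sigma> w = (if e = -1 then act (lin_poly e ^ (d + 1)) v
          else 2 *s act (lin_poly e ^ d) v + act (lin_poly e ^ (d + 1)) v)"
      proof -
        have "act (lin_poly e ^ (d + 1)) v = \<sigma> w - e *s w"
          by (simp add: w_def act_mult act_lin_poly)
        moreover have "2 *s w = w + w" using scale_left_distrib[of 1 1 w] by simp
        moreover have "e = 1" if "e \<noteq> - 1" using e that square_eq_1 by blast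
        ultimately show ?thesis unfolding w_def[symmetric] by auto
      qed
      define \<kappa> where "\<kappa> i = f (act (N e ^ i) u') (w + \<sigma> w)" for i
      have \<kappa>_high: "\<kappa> i = 0" if "i > j" for i
      proof -
        have 1: "f (act (N e ^ i) u') (act (lin_poly e ^ b) v) = 0" if "m \<le> 2 * i + b" for b
          using form_high_N[OF e u'(2), of i 0 b v] that by simp
        show ?thesis
        proof (cases "e = -1")
          case True
          then have "m \<le> 2 * i + (d + 1)" using j that by (simp add: d_def)
          then show ?thesis unfolding \<kappa>_def one_plus using True 1[of "d + 1"] by simp
        next
          case False
          then have "m \<le> 2 * i + d" "m \<le> 2 * i + (d + 1)" using j that by (auto simp: d_def)
          then show ?thesis unfolding \<kappa>_def one_plus using False 1[of "d + 1"] 1[of d]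
            by (simp only: if_False form_simps) simp
        qed
      qed
      have \<kappa>_j: "\<kappa> j \<noteq> 0"
      proof (cases "e = -1")
        case True
        then have "2 * j + (d + 1) + 1 = m" using j by (simp add: d_def)
        from form_top_N[OF e u'(2) this] show ?thesis
          unfolding \<kappa>_def one_plus using True u'(3) by simp
      next
        case False
        then have e1: "e = 1" using e square_eq_1 by blast
        have two: "(2::'a) \<noteq> 0"
        proof
          assume "(2::'a) = 0"
          then have "(1::'a) = -1" by (metis add.inverse_unique one_add_one)
          with False e1 show False by simp
        qed
        have "2 * j + d + 1 = m" "m \<le> 2 * j + 0 + (d + 1)" using False j by (auto simp: d_def)
        then have "f (act (N e ^ j) u') (act (lin_poly e ^ d) v) \<noteq> 0"
          "f (act (N e ^ j) u') (act (lin_poly e ^ (d + 1)) v) = 0"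
          using form_top_N[OF e u'(2), of j d v] u'(3) form_high_N[OF e u'(2), of j 0 "d + 1" v] by auto
        then show ?thesis unfolding \<kappa>_def one_plus using False two by (simp only: if_False form_simps) simp
      qed
      have ww: "f (act (N e ^ i) w) w = 0" if "i > j" for i
      proof -
        have "m \<le> 2 * i + d + d" using j that by (auto simp: d_def)
        then show ?thesis unfolding w_def using form_high_N[OF e v(2)] by simp
      qed
      obtain c where c: "f (act (N e ^ j) u') u' + \<kappa> j * c + f (act (N e ^ j) w) w * c\<^sup>2 = 0"
        using quadratically_closed_root[OF qc \<kappa>_j] by blast
      define z where "z = u' + c *s w"
      have zz: "f (act (N e ^ i) z) z = f (act (N e ^ i) u') u' + \<kappa> i * c + f (act (N e ^ i) w) w * c\<^sup>2" for i
      proof -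
        have "f (act (N e ^ i) w) u' = f (act (N e ^ i) u') (\<sigma> w)"
          unfolding N_self_adjoint[of e i w] asym[of w "act (N e ^ i) u'"] ..
        then show ?thesis
          unfolding z_def \<kappa>_def
          by (simp add: act_add_right act_scale_right form_simps power2_eq_square algebra_simps)
      qed
      have "z \<in> S" unfolding z_def
        using S u'(1) w(1) by (simp add: invariant_def subspace_add subspace_scale)
      moreover have "act (lin_poly e ^ m) z = 0"
        unfolding z_def using u'(2) w(2) by (simp add: act_add_right act_scale_right)
      \<comment> \<open>The correction must not destroy the pairing with \<open>v\<close>: for
        \<open>d = 0\<close> its contribution vanishes by the alternating hypothesis, for
        \<open>d > 0\<close> because \<open>(X - e)^m\<close> kills \<open>v\<close>.\<close>
      moreover have "f (act (lin_poly e ^ (m - 1)) w) v = 0"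
      proof (cases d)
        case 0
        then show ?thesis using alt[OF v] by (simp add: w_def)
      next
        case (Suc d')
        have "act (lin_poly e ^ (m - 1)) w = act (lin_poly e ^ (m + d')) v"
          unfolding w_def act_mult[symmetric] power_add[symmetric] using m Suc by simp
        then show ?thesis using act_power_mono[OF v(2), of "m + d'"] by simp
      qed
      then have "f (act (lin_poly e ^ (m - 1)) z) v \<noteq> 0"
        unfolding z_def using u'(3) by (simp add: act_add_right act_scale_right form_simps)
      moreover have "f (act (N e ^ i) z) z = 0" if i: "m \<le> i + Suc n" for i
      proof (cases "i = j")
        case True
        then show ?thesis using c zz by simp
      next
        case False
        then have "i > j" "m \<le> i + n" using i j by auto
        then show ?thesis unfolding zz using val \<kappa>_high ww by simp
      qed
      ultimately show ?thesis by blast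
    qed
  qed
  from this[of m] obtain u' where u': "u' \<in> S" "act (lin_poly e ^ m) u' = 0"
    "f (act (lin_poly e ^ (m - 1)) u') v \<noteq> 0" "\<And>i. f (act (N e ^ i) u') u' = 0" by auto
  then show thesis using that isotropic_if[OF e u'(4)] by blast
qed

definition top_exp :: "'v set \<Rightarrow> 'a \<Rightarrow> nat \<Rightarrow> bool" where
  "top_exp S c m \<longleftrightarrow> m > 0 \<and> (\<forall>k. ker S (lin_poly c ^ k) \<subseteq> ker S (lin_poly c ^ m)) \<and>
     \<not> ker S (lin_poly c ^ m) \<subseteq> ker S (lin_poly c ^ (m - 1))"

lemma top_expD: "top_exp S c m \<Longrightarrow> x \<in> S \<Longrightarrow> act (lin_poly c ^ k) x = 0 \<Longrightarrow> act (lin_poly c ^ m) x = 0"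
  by (auto simp: top_exp_def ker_def)

lemma top_expE:
  assumes "top_exp S c m"
  obtains x where "x \<in> S" "act (lin_poly c ^ m) x = 0" "act (lin_poly c ^ (m - 1)) x \<noteq> 0"
  using assms by (auto simp: top_exp_def ker_def)

lemma top_exp_exists:
  assumes "invariant S" "x \<in> S" "x \<noteq> 0"
  obtains c m where "top_exp S c m"
proof -
  obtain c y where y: "y \<in> S" "y \<noteq> 0" "act (lin_poly c) y = 0"
    using eigenvector_exists[OF assms split] by blast
  obtain M where M: "\<And>v k. act (lin_poly c ^ k) v = 0 \<Longrightarrow> act (lin_poly c ^ M) v = 0"
    by (rule fitting_split[of 0 c]) (rule that)
  define P where "P m \<longleftrightarrow> (\<forall>k. ker S (lin_poly c ^ k) \<subseteq> ker S (lin_poly c ^ m))" for m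
  define m where "m = (LEAST m. P m)"
  have "P M" using M by (auto simp: P_def ker_def)
  then have Pm: "P m" unfolding m_def by (rule LeastI)
  have m0: "m > 0"
  proof (rule ccontr)
    assume "\<not> m > 0"
    then have "ker S (lin_poly c ^ 1) \<subseteq> ker S (lin_poly c ^ 0)" using Pm unfolding P_def by blast
    then show False using y by (auto simp: ker_def)
  qed
  then have "\<not> P (m - 1)" using not_less_Least[of "m - 1" P] unfolding m_def by simp
  then have "\<not> ker S (lin_poly c ^ m) \<subseteq> ker S (lin_poly c ^ (m - 1))"
    using Pm unfolding P_def by blast
  then show thesis using that Pm m0 by (auto simp: top_exp_def P_def)
qed

lemma ker_mono: "k \<le> l \<Longrightarrow> ker S (lin_poly c ^ k) \<subseteq> ker S (lin_poly c ^ l)"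
  by (auto simp: ker_def act_power_mono)

text \<open>The kernels are nested, so inclusions between them can be read off from dimensions. In
  this form the largest block size is carried over to the other form.\<close>

lemma top_exp_dim:
  assumes "subspace S"
  shows "top_exp S c m \<longleftrightarrow> m > 0 \<and>
    (\<forall>k. dim (ker S (lin_poly c ^ k)) \<le> dim (ker S (lin_poly c ^ m))) \<and>
    dim (ker S (lin_poly c ^ (m - 1))) < dim (ker S (lin_poly c ^ m))"
proof -
  have sub: "ker S (lin_poly c ^ k) \<subseteq> ker S (lin_poly c ^ l) \<longleftrightarrow>
    dim (ker S (lin_poly c ^ k)) \<le> dim (ker S (lin_poly c ^ l))" for k l
  proof
    assume le: "dim (ker S (lin_poly c ^ k)) \<le> dim (ker S (lin_poly c ^ l))"
    show "ker S (lin_poly c ^ k) \<subseteq> ker S (lin_poly c ^ l)"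
    proof (cases "k \<le> l")
      case False
      then have "ker S (lin_poly c ^ l) = ker S (lin_poly c ^ k)"
        using le assms by (intro subspace_dim_equal ker_mono) (auto simp: subspace_ker)
      then show ?thesis by simp
    qed (rule ker_mono)
  qed (rule dim_subset)
  show ?thesis unfolding top_exp_def sub by auto
qed

text \<open>By duality blocks for \<open>1/c\<close> are no longer than those for \<open>c\<close>:
  otherwise \<open>(X - 1/c)^m y\<close> would pair non-trivially with a generalized eigenvector for
  \<open>c\<close>, which is killed by the adjoint of that power.\<close>

lemma top_pairing:
  assumes S: "regular S" and t: "top_exp S c m" and x: "x \<in> S" "x \<noteq> 0" "act (lin_poly c ^ k) x = 0"
  obtains y where "y \<in> S" "act (lin_poly (1 / c) ^ m) y = 0" "f x y \<noteq> 0"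
proof -
  have c: "c \<noteq> 0" using x(2,3) act_lin_0 by blast
  obtain y M where y: "y \<in> S" "act (lin_poly (1 / c) ^ M) y = 0" "f x y \<noteq> 0"
    using eigen_pairing[OF S x] by blast
  have "act (lin_poly (1 / c) ^ m) y = 0"
  proof (rule ccontr)
    assume 0: "act (lin_poly (1 / c) ^ m) y \<noteq> 0"
    have "act (lin_poly (1 / c) ^ M) (act (lin_poly (1 / c) ^ m) y) = 0"
      using y(2) by (simp add: act_commute[of _ "lin_poly (1 / c) ^ m"])
    from eigen_pairing[OF S invariant_act[OF regular_invariant[OF S] y(1)] 0 this]
    obtain z K where z: "z \<in> S" "act (lin_poly (1 / (1 / c)) ^ K) z = 0" "f (act (lin_poly (1 / c) ^ m) y) z \<noteq> 0"
      by blast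
    have "act (lin_poly c ^ m) z = 0" using top_expD[OF t z(1)] z(2) c by simp
    then have "act (star (lin_poly (1 / c) ^ m)) z = 0"
      using star_lin_poly_power_act[of "1 / c" m z] c by simp
    with z(3) show False unfolding adj by simp
  qed
  with y that show thesis by blast
qed

text \<open>For \<open>c * c\<close> different from 1 a generalized eigenspace is orthogonal to
  itself and isotropy is automatic. For \<open>c * c = 1\<close> the two generators are made
  isotropic one after the other, each time keeping the pairing with the partner; only then are they
  normalised.\<close>

lemma split_hyper:
  assumes qc: "quadratically_closed TYPE('a)" and S: "regular S" and t: "top_exp S c m"
    and alt: "\<And>x. c * c = 1 \<Longrightarrow> x \<in> S \<Longrightarrow> act (lin_poly c ^ m) x = 0 \<Longrightarrow> f (act (lin_poly c ^ (m - 1)) x) x = 0"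
  obtains u v where "u \<in> S" "v \<in> S" "hyper c m u v"
proof -
  have m: "m > 0" using t by (simp add: top_exp_def)
  obtain u where u: "u \<in> S" "act (lin_poly c ^ m) u = 0" "act (lin_poly c ^ (m - 1)) u \<noteq> 0"
    using top_expE[OF t] by blast
  have c: "c \<noteq> 0" using u(2,3) act_lin_0 act_zero_right by metis
  note inv = regular_invariant[OF S]
  have "act (lin_poly c ^ m) (act (lin_poly c ^ (m - 1)) u) = 0"
    by (rule act_kill[OF u(2)])
  from top_pairing[OF S t invariant_act[OF inv u(1)] u(3) this]
  obtain v where v: "v \<in> S" "act (lin_poly (1 / c) ^ m) v = 0" "f (act (lin_poly c ^ (m - 1)) u) v \<noteq> 0" by blast
  show thesis
  proof (cases "c * c = 1")
    case False
    have "f (act p u) u = 0" for p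
      using orth_eigenspaces[of c m "act p u" c m u] u(2) False by (simp add: act_commute[of _ p])
    moreover have "f (act p v) v = 0" for p
      using orth_eigenspaces[of "1 / c" m "act p v" "1 / c" m v] v(2) False c by (simp add: act_commute[of _ p])
    ultimately obtain v' where v': "v' \<in> cyc v" "hyper c m u v'"
      using hyper_scale[OF c m u(2) v(2) _ _ v(3)] by blast
    then show thesis using that u(1) cyc_subset[OF inv v(1)] by blast
  next
    case True
    then have cc: "1 / c = c" by (rule inv_square_1)
    note v2 = v(2)[unfolded cc]
    note alt' = alt[OF True]
    obtain u' where u': "u' \<in> S" "act (lin_poly c ^ m) u' = 0" "f (act (lin_poly c ^ (m - 1)) u') v \<noteq> 0"
      "\<And>p. f (act p u') u' = 0"
      using isotropic_vector_exists[OF qc True m inv alt' u(1,2) v(1) v2 v(3)] by blast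
    have "c * (-1) ^ (m - 1) \<noteq> 0" using c by simp
    then have "f (act (lin_poly c ^ (m - 1)) v) u' \<noteq> 0"
      using top_sym[OF True u'(2) v2 m] u'(3) by simp
    from isotropic_vector_exists[OF qc True m inv alt' v(1) v2 u'(1,2) this]
    obtain v' where v': "v' \<in> S" "act (lin_poly c ^ m) v' = 0" "f (act (lin_poly c ^ (m - 1)) v') u' \<noteq> 0"
      "\<And>p. f (act p v') v' = 0" by blast
    have uv': "f (act (lin_poly c ^ (m - 1)) u') v' \<noteq> 0"
      using top_sym[OF True u'(2) v'(2) m] v'(3) by auto
    have v'2: "act (lin_poly (1 / c) ^ m) v' = 0" by (simp only: cc v'(2))
    obtain v'' where "v'' \<in> cyc v'" "hyper c m u' v''"
      using hyper_scale[OF c m u'(2) v'2 u'(4) v'(4) uv'] by blast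
    then show thesis using that u'(1) cyc_subset[OF inv v'(1)] by blast
  qed
qed

section \<open>The alternating type\<close>

text \<open>For an orthogonal decomposition as in part (ii), \<open>alt UNIV k\<close> says that \<open>f\<^sub>k\<close> is alternating.\<close>

definition alt :: "'v set \<Rightarrow> nat \<Rightarrow> bool" where
  "alt S k \<longleftrightarrow> (\<forall>x\<in>S. act (lin_poly 1 ^ k) x = 0 \<longrightarrow> f (act (lin_poly 1 ^ (k - 1)) x) x = 0)"

lemma alt_0 [simp]: "alt S 0"
  by (simp add: alt_def)

lemma alt_ortho:
  assumes "regular U" "regular S" "U \<subseteq> S"
  shows "alt S k \<longleftrightarrow> alt U k \<and> alt (ortho U S) k"
proof
  assume "alt S k"
  then show "alt U k \<and> alt (ortho U S) k" using assms(3) ortho_subset by (fastforce simp: alt_def)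
next
  assume A: "alt U k \<and> alt (ortho U S) k"
  show "alt S k" unfolding alt_def
  proof (intro ballI impI)
    fix x assume x: "x \<in> S" "act (lin_poly 1 ^ k) x = 0"
    obtain u c where uc: "u \<in> U" "c \<in> ortho U S" "x = u + c"
      using ortho_decomp[OF assms(1) regular_subspace[OF assms(2)] assms(3) x(1)] by blast
    have "act (lin_poly 1 ^ k) u = 0" "act (lin_poly 1 ^ k) c = 0"
      using act_ortho_decomp[OF assms uc(1,2)] x(2) uc(3) by auto
    moreover have "f (act (lin_poly 1 ^ (k - 1)) u) c = 0"
      by (rule ortho_orth'[OF assms(1) uc(2) invariant_act[OF regular_invariant[OF assms(1)] uc(1)]])
    moreover have "f (act (lin_poly 1 ^ (k - 1)) c) u = 0"
      by (rule ortho_orth[OF invariant_act[OF regular_invariant[OF regular_ortho[OF assms]] uc(2)] uc(1)])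
    ultimately show "f (act (lin_poly 1 ^ (k - 1)) x) x = 0"
      using A uc by (simp add: alt_def act_add_right form_simps)
  qed
qed

text \<open>The isotropic halves contribute nothing, and the two cross terms are equal by symmetry,
  so the value is a multiple of 2.\<close>

lemma alt_hyp:
  assumes "(2::'a) = 0" "hyper c m u v"
  shows "alt (hyp u v) k"
proof (cases k)
  case (Suc l)
  show ?thesis unfolding alt_def
  proof (intro ballI impI)
    fix x assume "x \<in> hyp u v" and x: "act (lin_poly 1 ^ k) x = 0"
    then obtain x1 x2 where x12: "x1 \<in> cyc u" "x2 \<in> cyc v" "x = x1 + x2" by (auto simp: hyp_def)
    have iso: "f y z = 0" if "y \<in> cyc u \<and> z \<in> cyc u \<or> y \<in> cyc v \<and> z \<in> cyc v" for y z
      using that assms(2) isotropic_cyc by (auto simp: hyper_def)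
    have in_cyc: "act p x1 \<in> cyc u" "act p x2 \<in> cyc v" for p
      using x12 invariant_act[OF invariant_cyc] by auto
    have "act (lin_poly 1 ^ k) x1 = act (- (lin_poly 1 ^ k)) x2"
      using x x12(3) by (simp add: act_add_right poly_act_uminus eq_neg_iff_add_eq_0)
    then have "act (lin_poly 1 ^ k) x1 \<in> cyc v" using in_cyc(2) by metis
    then have 1: "act (lin_poly 1 ^ k) x1 = 0"
      using iso hyper_faithful(1)[OF assms(2) in_cyc(1)] by blast
    then have 2: "act (lin_poly 1 ^ k) x2 = 0" using x x12(3) by (simp add: act_add_right)
    have neg: "(-1::'a) = 1" using assms(1) by (metis add.inverse_unique one_add_one)
    then have "f (act (lin_poly 1 ^ (k - 1)) x2) x1 = f (act (lin_poly 1 ^ (k - 1)) x1) x2"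
      using top_sym[OF _ 1 2] Suc by (simp only: neg power_one mult_1 zero_less_Suc)
    then have "f (act (lin_poly 1 ^ (k - 1)) x) x = 2 * f (act (lin_poly 1 ^ (k - 1)) x1) x2"
      using iso in_cyc x12 by (simp add: act_add_right form_simps)
    then show "f (act (lin_poly 1 ^ (k - 1)) x) x = 0" using assms(1) by simp
  qed
qed simp

text \<open>For \<open>k < m\<close> a vector killed by \<open>(X - 1)^k\<close> is a multiple of
  \<open>(X - 1)^(m-k) u\<close>. The total exponent in the value is then
  \<open>(m - 1) + (m - k)\<close>, which is at least \<open>m\<close>. For \<open>k > m\<close>
  already the \<open>(k-1)\<close>-th power kills everything.\<close>

lemma alt_cyc:
  assumes "act (lin_poly 1 ^ m) u = 0" "act (lin_poly 1 ^ (m - 1)) u \<noteq> 0" "m > 0" "k \<noteq> m"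
  shows "alt (cyc u) k"
  unfolding alt_def
proof (intro ballI impI)
  fix x assume "x \<in> cyc u" and x: "act (lin_poly 1 ^ k) x = 0"
  then obtain p where p: "x = act p u" by (auto simp: cyc_def)
  show "f (act (lin_poly 1 ^ (k - 1)) x) x = 0"
  proof (cases "k < m")
    case False
    with assms(4) have "m \<le> k - 1" by simp
    then have "act (lin_poly 1 ^ (k - 1)) x = 0"
      using act_power_mono[OF assms(1)] unfolding p act_commute[of _ p] by simp
    then show ?thesis by simp
  next
    case True
    have "act (lin_poly 1 ^ k * p) u = 0" using x p by (simp add: act_mult)
    then have "lin_poly 1 ^ m dvd lin_poly 1 ^ k * p" using annihilator_cyc[OF assms(1-3)] by simp
    then have "lin_poly 1 ^ k * lin_poly 1 ^ (m - k) dvd lin_poly 1 ^ k * p"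
      using True by (simp flip: power_add)
    then have "lin_poly 1 ^ (m - k) dvd p" by (subst (asm) dvd_mult_cancel_left) auto
    then obtain q where q: "p = q * lin_poly 1 ^ (m - k)" by (metis dvd_def mult.commute)
    define y where "y = act (lin_poly 1 ^ (m - k)) u"
    show ?thesis
    proof (cases "k = 0")
      case True
      then show ?thesis using x by simp
    next
      case False
      have "lin_poly 1 ^ (k - 1) * lin_poly 1 ^ (m - k) = (lin_poly 1 ^ (m - 1) :: 'a poly)"
        using \<open>k < m\<close> False by (simp flip: power_add)
      then have "act (lin_poly 1 ^ (k - 1)) x = act q (act (lin_poly 1 ^ (m - 1)) u)"
        unfolding p q by (metis act_mult mult.left_commute)
      moreover have "x = act q (act (lin_poly 1 ^ (m - k)) u)" unfolding p q act_mult ..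
      ultimately show ?thesis using form_high[OF _ assms(1), of "m - 1" "m - k" q q u] \<open>k < m\<close> by simp
    qed
  qed
qed

section \<open>Choosing the cyclic summand\<close>

definition nonalt :: "'v set \<Rightarrow> 'a \<Rightarrow> nat \<Rightarrow> bool" where
  "nonalt S e m \<longleftrightarrow> (\<exists>u\<in>S. act (lin_poly e ^ m) u = 0 \<and> f (act (lin_poly e ^ (m - 1)) u) u \<noteq> 0)"

text \<open>With 2 invertible the sign decides: a non-zero symmetric form has an anisotropic vector
  by polarization, and a skew form has none.\<close>

lemma nonalt_iff:
  assumes "(2::'a) \<noteq> 0" "e * e = 1" "regular S" "top_exp S e m"
  shows "nonalt S e m \<longleftrightarrow> e * (-1) ^ (m - 1) = 1"
proof
  have m: "m > 0" using assms(4) by (simp add: top_exp_def)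
  assume 1: "e * (-1) ^ (m - 1) = 1"
  obtain x where x: "x \<in> S" "act (lin_poly e ^ m) x = 0" "act (lin_poly e ^ (m - 1)) x \<noteq> 0"
    using top_expE[OF assms(4)] by blast
  have "act (lin_poly e ^ m) (act (lin_poly e ^ (m - 1)) x) = 0"
    by (rule act_kill[OF x(2)])
  from top_pairing[OF assms(3,4) invariant_act[OF regular_invariant[OF assms(3)] x(1)] x(3) this]
  obtain y where y: "y \<in> S" "act (lin_poly e ^ m) y = 0" "f (act (lin_poly e ^ (m - 1)) x) y \<noteq> 0"
    unfolding inv_square_1[OF assms(2)] by blast
  have sym: "f (act (lin_poly e ^ (m - 1)) y) x = f (act (lin_poly e ^ (m - 1)) x) y"
    using top_sym[OF assms(2) x(2) y(2) m] 1 by simp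
  show "nonalt S e m"
  proof (rule ccontr)
    assume "\<not> nonalt S e m"
    then have z: "f (act (lin_poly e ^ (m - 1)) z) z = 0" if "z \<in> S" "act (lin_poly e ^ m) z = 0" for z
      using that by (auto simp: nonalt_def)
    have "f (act (lin_poly e ^ (m - 1)) (x + y)) (x + y) = 0"
      using x y subspace_add[OF regular_subspace[OF assms(3)]] by (intro z) (auto simp: act_add_right)
    then have "2 * f (act (lin_poly e ^ (m - 1)) x) y = 0"
      using z x y sym by (simp add: act_add_right form_simps)
    with assms(1) y(3) show False by simp
  qed
next
  have m: "m > 0" using assms(4) by (simp add: top_exp_def)
  assume "nonalt S e m"
  then obtain u where u: "act (lin_poly e ^ m) u = 0" "f (act (lin_poly e ^ (m - 1)) u) u \<noteq> 0"
    by (auto simp: nonalt_def)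
  from top_sym[OF assms(2) u(1) u(1) m] u(2) show "e * (-1) ^ (m - 1) = 1" by simp
qed

text \<open>
  In characteristic 2, splitting off a cyclic summand of the largest size \<open>m\<close> may leave a complement
  of alternating or of non-alternating type at \<open>m\<close>.  The second is possible exactly if there are two
  vectors as in the following definition, and by the next lemma this only depends on the Jordan type.
\<close>

definition nonalt_pair :: "'v set \<Rightarrow> nat \<Rightarrow> bool" where
  "nonalt_pair S m \<longleftrightarrow> (\<exists>u\<in>S. \<exists>w\<in>S. act (lin_poly 1 ^ m) u = 0 \<and> act (lin_poly 1 ^ m) w = 0 \<and>
     f (act (lin_poly 1 ^ (m - 1)) u) u \<noteq> 0 \<and> f (act (lin_poly 1 ^ (m - 1)) u) w = 0 \<and>
     f (act (lin_poly 1 ^ (m - 1)) w) w \<noteq> 0)"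

text \<open>On \<open>K\<close> the form \<open>B\<close> is symmetric with radical
  \<open>K'\<close>, so the condition on dimensions says that \<open>K\<close> modulo
  \<open>K'\<close> is not a line. A non-alternating symmetric space that is not a line always
  contains two orthogonal anisotropic vectors.\<close>

lemma nonalt_pair_iff:
  assumes two: "(2::'a) = 0" and S: "regular S" and t: "top_exp S 1 m" and n: "nonalt S 1 m"
  shows "nonalt_pair S m \<longleftrightarrow> dim (ker S (lin_poly 1 ^ m)) \<noteq> dim (ker S (lin_poly 1 ^ (m - 1))) + 1"
proof -
  have m: "m > 0" using t by (simp add: top_exp_def)
  define B where "B x y = f (act (lin_poly 1 ^ (m - 1)) x) y" for x y
  define K where "K = ker S (lin_poly 1 ^ m)"
  define K' where "K' = ker S (lin_poly 1 ^ (m - 1))"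
  have B: "B (x + y) z = B x z + B y z" "B z (x + y) = B z x + B z y" "B (c *s x) z = c * B x z"
    "B z (c *s x) = c * B z x" "B (x - y) z = B x z - B y z" "B z (x - y) = B z x - B z y" for x y z c
    by (simp_all add: B_def act_add_right act_scale_right act_diff_right form_simps)
  have neg: "(-1::'a) = 1" using two by (metis add.inverse_unique one_add_one)
  have sym: "B y x = B x y" if "x \<in> K" "y \<in> K" for x y
  proof -
    have "B y x = 1 * (-1) ^ (m - 1) * B x y"
      unfolding B_def by (rule top_sym) (use that m in \<open>auto simp: K_def ker_def\<close>)
    then show ?thesis by (simp only: neg power_one mult_1)
  qed
  have sub: "subspace K" "subspace K'" "K' \<subseteq> K" unfolding K_def K'_def
    using regular_subspace[OF S] ker_mono by (auto simp: subspace_ker)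
  have K'0: "B x y = 0" if "x \<in> K'" for x y using that by (auto simp: B_def K'_def ker_def)
  have pairB: "nonalt_pair S m \<longleftrightarrow> (\<exists>u\<in>K. \<exists>w\<in>K. B u u \<noteq> 0 \<and> B u w = 0 \<and> B w w \<noteq> 0)"
    unfolding nonalt_pair_def B_def K_def ker_def by auto
  obtain u where u: "u \<in> K" "B u u \<noteq> 0" using n by (auto simp: nonalt_def K_def B_def ker_def)
  have uK': "u \<notin> K'" using u(2) K'0 by auto
  show ?thesis
  proof
    assume "nonalt_pair S m"
    then obtain x y where xy: "x \<in> K" "y \<in> K" "B x x \<noteq> 0" "B x y = 0" "B y y \<noteq> 0" unfolding pairB by blast
    show "dim (ker S (lin_poly 1 ^ m)) \<noteq> dim (ker S (lin_poly 1 ^ (m - 1))) + 1"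
      unfolding K_def[symmetric] K'_def[symmetric]
    proof
      assume d: "dim K = dim K' + 1"
      have xK': "x \<notin> span K'" using xy(3) K'0 sub(2) by (metis span_eq_iff)
      have "dim (insert x K') = dim K' + 1" using dim_insert[of x K'] xK' by simp
      then have "span (insert x K') = K"
        using d sub xy(1) by (intro subspace_dim_equal span_minimal) auto
      then obtain k where "y - k *s x \<in> span K'" using xy(2) span_breakdown_eq by blast
      then have y': "y - k *s x \<in> K'" using sub(2) by (metis span_eq_iff)
      have "B x (y - k *s x) = 0"
        using sym[of x "y - k *s x"] K'0[OF y'] xy(1) y' sub(3) by auto
      then have "k = 0" using xy by (simp add: B)
      then have "y \<in> K'" using y' by simp
      then show False using K'0 xy(5) by simp
    qed
  next
    assume d: "dim (ker S (lin_poly 1 ^ m)) \<noteq> dim (ker S (lin_poly 1 ^ (m - 1))) + 1"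
    show "nonalt_pair S m"
    proof (rule ccontr)
      assume nr: "\<not> nonalt_pair S m"
      have perp: "w \<in> K'" if w: "w \<in> K" "B u w = 0" for w
      proof (rule ccontr)
        assume "w \<notin> K'"
        then have w1: "act (lin_poly 1 ^ (m - 1)) w \<noteq> 0" "w \<in> S"
          using w(1) by (auto simp: K'_def K_def ker_def)
        have "act (lin_poly 1 ^ m) (act (lin_poly 1 ^ (m - 1)) w) = 0"
          using w(1) by (intro act_kill) (simp add: K_def ker_def)
        from top_pairing[OF S t invariant_act[OF regular_invariant[OF S] w1(2)] w1(1) this]
        obtain y where y: "y \<in> K" "B w y \<noteq> 0" by (auto simp: B_def K_def ker_def)
        have ww: "B w w = 0" using nr w u unfolding pairB by blast
        define y0 where "y0 = y - (B u y / B u u) *s u"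
        have y0: "y0 \<in> K" unfolding y0_def using y(1) u(1) sub(1) by (simp add: subspace_diff subspace_scale)
        have uy0: "B u y0 = 0" using u(2) by (simp add: y0_def B)
        have wy0: "B w y0 \<noteq> 0" using y(2) sym[OF w(1) u(1)] w(2) by (simp add: y0_def B)
        have yy0: "B y0 y0 = 0" using nr y0 uy0 u unfolding pairB by blast
        \<comment> \<open>Here \<open>u\<close> is anisotropic and orthogonal to the hyperbolic
          plane of \<open>w\<close> and \<open>y0\<close>. Adding \<open>w\<close> to one copy of
          \<open>u\<close> and a multiple of \<open>y0\<close> to another keeps both anisotropic,
          and \<open>a\<close> makes \<open>B u u + a * B w y0\<close> vanish, so the two become
          orthogonal.\<close>
        define a where "a = - (B u u / B w y0)"
        define x1 x2 where "x1 = u + w" and "x2 = u + a *s y0"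
        have "x1 \<in> K" "x2 \<in> K" unfolding x1_def x2_def
          using u(1) w(1) y0 sub(1) by (simp_all add: subspace_add subspace_scale)
        moreover have "B x1 x1 \<noteq> 0" unfolding x1_def using sym[OF u(1) w(1)] w(2) ww u(2) by (simp add: B)
        moreover have "B x2 x2 \<noteq> 0" unfolding x2_def using sym[OF u(1) y0] uy0 yy0 u(2) by (simp add: B)
        moreover have "B x1 x2 = 0" unfolding x1_def x2_def
          using sym[OF u(1) w(1)] w(2) uy0 wy0 by (simp add: B a_def)
        ultimately show False using nr unfolding pairB by blast
      qed
      have "K \<subseteq> span (insert u K')"
      proof
        fix x assume x: "x \<in> K"
        define k where "k = B u x / B u u"
        have "x - k *s u \<in> K" using x u(1) sub(1) by (simp add: subspace_diff subspace_scale)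
        moreover have "B u (x - k *s u) = 0" using u(2) by (simp add: B k_def)
        ultimately have "x - k *s u \<in> span K'" using perp span_base by blast
        then show "x \<in> span (insert u K')" unfolding span_breakdown_eq by blast
      qed
      moreover have "span (insert u K') \<subseteq> K" using sub u(1) by (intro span_minimal) auto
      ultimately have "dim K = dim (insert u K')" using dim_span[of "insert u K'"] by simp
      also have "\<dots> = dim K' + 1"
        using dim_insert[of u K'] uK' sub(2) by (metis span_eq_iff)
      finally show False using d by (simp add: K_def K'_def)
    qed
  qed
qed

text \<open>Whenever a pair as in \<open>nonalt_pair\<close> exists, its first vector is taken, so
  that the second can witness that the complement is non-alternating. Normalising only rescales
  \<open>(X - e)^(m-1) u\<close>, hence the orthogonality of the pair survives.\<close>

lemma cyc_choice:
  assumes qc: "quadratically_closed TYPE('a)" and e: "e * e = 1" and S: "regular S"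
    and m: "m > 0" and n: "nonalt S e m"
  obtains u where "u \<in> S" "act (lin_poly e ^ m) u = 0" "f (act (lin_poly e ^ (m - 1)) u) u \<noteq> 0"
    "\<And>j. f (act (N e ^ j) u) u = (if j = (m - 1) div 2 then 1 else 0)"
    "(2::'a) = 0 \<Longrightarrow> e = 1 \<Longrightarrow> alt (ortho (cyc u) S) m \<longleftrightarrow> \<not> nonalt_pair S m"
proof -
  obtain u where u: "u \<in> S" "act (lin_poly e ^ m) u = 0" "f (act (lin_poly e ^ (m - 1)) u) u \<noteq> 0"
    and r: "(2::'a) = 0 \<Longrightarrow> e = 1 \<Longrightarrow> nonalt_pair S m \<Longrightarrow> \<exists>w\<in>S. act (lin_poly 1 ^ m) w = 0 \<and>
      f (act (lin_poly 1 ^ (m - 1)) u) w = 0 \<and> f (act (lin_poly 1 ^ (m - 1)) w) w \<noteq> 0"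
  proof (cases "e = 1 \<and> nonalt_pair S m")
    case True
    then obtain u w where "u \<in> S" "w \<in> S" "act (lin_poly 1 ^ m) u = 0" "act (lin_poly 1 ^ m) w = 0"
     "f (act (lin_poly 1 ^ (m - 1)) u) u \<noteq> 0" "f (act (lin_poly 1 ^ (m - 1)) u) w = 0"
     "f (act (lin_poly 1 ^ (m - 1)) w) w \<noteq> 0" unfolding nonalt_pair_def by blast
    then show thesis using that[of u] True by blast
  next
    case False
    then show thesis using that n unfolding nonalt_def by blast
  qed
  obtain u' c where u': "u' \<in> cyc u" "act (lin_poly e ^ m) u' = 0" "c \<noteq> 0"
    "act (lin_poly e ^ (m - 1)) u' = c *s act (lin_poly e ^ (m - 1)) u"
    "f (act (lin_poly e ^ (m - 1)) u') u' \<noteq> 0"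
    "\<And>j. f (act (N e ^ j) u') u' = (if j = (m - 1) div 2 then 1 else 0)"
    by (rule cyc_normal[OF qc e m u(2,3)]) (rule that)
  have u'S: "u' \<in> S" using u'(1) cyc_subset[OF regular_invariant[OF S] u(1)] by blast
  have "alt (ortho (cyc u') S) m \<longleftrightarrow> \<not> nonalt_pair S m" if two: "(2::'a) = 0" and e1: "e = 1"
  proof
    assume A: "alt (ortho (cyc u') S) m"
    show "\<not> nonalt_pair S m"
    proof
      assume "nonalt_pair S m"
      then obtain w where w: "w \<in> S" "act (lin_poly 1 ^ m) w = 0"
        "f (act (lin_poly 1 ^ (m - 1)) u) w = 0" "f (act (lin_poly 1 ^ (m - 1)) w) w \<noteq> 0"
        using r two e1 by blast
      have gc: "regular (cyc u')" by (rule regular_cyc[OF e u'(2,5)])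
      have sub: "cyc u' \<subseteq> S" using cyc_subset[OF regular_invariant[OF S] u'S] .
      obtain x z where xz: "x \<in> cyc u'" "z \<in> ortho (cyc u') S" "w = x + z"
        using ortho_decomp[OF gc regular_subspace[OF S] sub w(1)] by blast
      have x0: "act (lin_poly 1 ^ m) x = 0" "act (lin_poly 1 ^ m) z = 0"
        using act_ortho_decomp[OF gc S sub xz(1,2)] w(2) xz(3) by auto
      have tu': "act (lin_poly 1 ^ (m - 1)) u' \<in> cyc u'" by blast
      have o1: "f (act (lin_poly 1 ^ (m - 1)) u') z = 0" by (rule ortho_orth'[OF gc xz(2) tu'])
      have "f (act (lin_poly 1 ^ (m - 1)) u') w = 0" using u'(4) w(3) e1 by (simp add: form_simps)
      then have "f (act (lin_poly 1 ^ (m - 1)) u') x = 0" using o1 xz(3) by (simp add: form_simps)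
      then have ux: "f (act (lin_poly 1 ^ (m - 1)) x) u' = 0"
        using top_sym[of 1 m u' x] x0 u'(2) m e1 by simp
      \<comment> \<open>Writing the component of \<open>w\<close> in \<open>cyc u'\<close> as
        \<open>p\<close> applied to \<open>u'\<close>, orthogonality forces \<open>p\<close> to
        vanish at 1. So \<open>(X - 1)^(m-1)\<close> kills this component, and the non-zero value at
        \<open>w\<close> comes from the complement.\<close>
      obtain p where p: "x = act p u'" using xz(1) by (auto simp: cyc_def)
      obtain q where q: "p = [:poly p 1:] + lin_poly 1 * q" using poly_root_split by blast
      have "act (lin_poly 1 ^ (m - 1)) x = act p (act (lin_poly 1 ^ (m - 1)) u')"
        unfolding p by (rule act_commute)
      also have "\<dots> = poly p 1 *s act (lin_poly 1 ^ (m - 1)) u' + act q (act (lin_poly 1 * lin_poly 1 ^ (m - 1)) u')"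
        by (subst q) (simp add: poly_act_add act_mult act_commute[of q])
      also have "lin_poly 1 * lin_poly 1 ^ (m - 1) = (lin_poly 1 ^ m :: 'a poly)" using m by (simp flip: power_Suc)
      finally have tx: "act (lin_poly 1 ^ (m - 1)) x = poly p 1 *s act (lin_poly 1 ^ (m - 1)) u'"
        using u'(2) e1 by simp
      then have "poly p 1 = 0" using ux u'(5) e1 by (simp add: form_simps)
      then have tx0: "act (lin_poly 1 ^ (m - 1)) x = 0" using tx by simp
      have "f (act (lin_poly 1 ^ (m - 1)) z) x = 0"
        by (rule ortho_orth[OF invariant_act[OF regular_invariant[OF regular_ortho[OF gc S sub]] xz(2)] xz(1)])
      then have "f (act (lin_poly 1 ^ (m - 1)) w) w = 0"
        using tx0 A xz x0 unfolding alt_def by (simp add: act_add_right form_simps)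
      with w(4) show False by simp
    qed
  next
    assume nr: "\<not> nonalt_pair S m"
    show "alt (ortho (cyc u') S) m" unfolding alt_def
    proof (intro ballI impI)
      fix x assume x: "x \<in> ortho (cyc u') S" "act (lin_poly 1 ^ m) x = 0"
      have gc: "regular (cyc u')" by (rule regular_cyc[OF e u'(2,5)])
      have "f (act (lin_poly 1 ^ (m - 1)) u') x = 0" by (rule ortho_orth'[OF gc x(1)]) blast
      then show "f (act (lin_poly 1 ^ (m - 1)) x) x = 0"
        using nr u'S x ortho_subset u'(2,5) e1 unfolding nonalt_pair_def by blast
    qed
  qed
  then show thesis using that[OF u'S u'(2,5,6)] by blast
qed

end

section \<open>Isometries\<close>

locale two_forms =
  F: asym_form scale Basis \<sigma> f \<rho> roots + G: asym_form scale Basis \<tau> g \<rho> roots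
  for scale :: "'a::field \<Rightarrow> 'v::ab_group_add \<Rightarrow> 'v" (infixr \<open>*s\<close> 75)
    and Basis :: "'v set" and \<sigma> f \<tau> g \<rho> roots
begin

definition compat :: "('v \<times> 'v) set \<Rightarrow> bool" where
  "compat R \<longleftrightarrow> (\<forall>(a, b)\<in>R. \<forall>(a', b')\<in>R. f a a' = g b b')"

text \<open>
  Isometries are handled as relations between generating families with equal Gram matrices; orthogonal
  sums of isometries are then unions of relations.
\<close>

definition iso :: "'v set \<Rightarrow> 'v set \<Rightarrow> bool" where
  "iso S T \<longleftrightarrow> (\<exists>R. R \<subseteq> S \<times> T \<and> S \<subseteq> F.span (fst ` R) \<and> T \<subseteq> F.span (snd ` R) \<and> compat R)"

lemma compatD: "compat R \<Longrightarrow> (a, b) \<in> R \<Longrightarrow> (a', b') \<in> R \<Longrightarrow> f a a' = g b b'"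
  by (auto simp: compat_def)

text \<open>Equal Gram data turn the relation into the graph of a map: choose a basis among the
  first components, extend linearly, and use regularity of both sides to see that nothing depended
  on the choice.\<close>

lemma iso_map:
  assumes S: "F.regular S" and T: "G.regular T" and iso: "iso S T"
  obtains x where "Vector_Spaces.linear scale scale x" "x ` S = T" "inj_on x S"
    "\<And>a b. a \<in> S \<Longrightarrow> b \<in> S \<Longrightarrow> g (x a) (x b) = f a b"
    "\<And>a p. a \<in> S \<Longrightarrow> x (F.act p a) = G.act p (x a)"
proof -
  obtain R where R: "R \<subseteq> S \<times> T" "S \<subseteq> F.span (fst ` R)" "T \<subseteq> F.span (snd ` R)" "compat R"
    using iso by (auto simp: iso_def)
  obtain B where B: "B \<subseteq> fst ` R" "F.independent B" "fst ` R \<subseteq> F.span B"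
    using F.maximal_independent_subset by blast
  have "\<forall>b\<in>B. \<exists>y. (b, y) \<in> R" using B(1) by force
  then obtain h where h: "\<And>b. b \<in> B \<Longrightarrow> (b, h b) \<in> R" by metis
  obtain x where x: "\<And>b. b \<in> B \<Longrightarrow> x b = h b" and lx: "Vector_Spaces.linear scale scale x"
    using F.endo.linear_independent_extend[OF B(2), of h] by blast
  note mx = lx[folded module_hom_iff_linear]
  note x_simps = module_hom.add[OF mx] module_hom.scale[OF mx] module_hom.zero[OF mx] module_hom.diff[OF mx]
  have sS: "F.subspace S" and sT: "F.subspace T"
    using F.regular_subspace[OF S] G.regular_subspace[OF T] by auto
  have spS: "F.span B = S"
  proof
    have "fst ` R \<subseteq> S" using R(1) by auto
    then show "F.span B \<subseteq> S" using B(1) by (intro F.span_minimal sS) auto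
    show "S \<subseteq> F.span B" using R(2) F.span_mono[OF B(3)] unfolding F.span_span by blast
  qed
  have spT: "F.span (snd ` R) = T"
    using R by (intro equalityI F.span_minimal sT) auto
  have bx: "(b, x b) \<in> R" if "b \<in> B" for b using h x that by simp
  have half: "g (x a) b' = f a a'" if a: "a \<in> S" and ab: "(a', b') \<in> R" for a a' b'
  proof -
    have "F.subspace {a. g (x a) b' = f a a'}"
      unfolding F.subspace_def by (simp add: x_simps F.form_simps G.form_simps)
    then have "F.span B \<subseteq> {a. g (x a) b' = f a a'}"
      using compatD[OF R(4) bx ab] by (intro F.span_minimal) auto
    then show ?thesis using a spS by auto
  qed
  have full: "g (x a) (x b) = f a b" if a: "a \<in> S" and b: "b \<in> S" for a b
  proof -
    have "F.subspace {b. g (x a) (x b) = f a b}"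
      unfolding F.subspace_def by (simp add: x_simps F.form_simps G.form_simps)
    then have "F.span B \<subseteq> {b. g (x a) (x b) = f a b}"
      using half[OF a bx] by (intro F.span_minimal) auto
    then show ?thesis using b spS by auto
  qed
  have xT: "x a \<in> T" if "a \<in> S" for a
  proof -
    have "F.subspace {a. x a \<in> T}" using sT unfolding F.subspace_def by (simp add: x_simps)
    then have "F.span B \<subseteq> {a. x a \<in> T}"
      using bx R(1) by (intro F.span_minimal) auto
    then show ?thesis using that spS by auto
  qed
  \<comment> \<open>All pairs of \<open>R\<close> lie on the graph, not only those over the chosen
    basis: the difference is orthogonal to the generators of \<open>T\<close>. Surjectivity onto
    \<open>T\<close> rests on this.\<close>
  have xR: "x a = b" if ab: "(a, b) \<in> R" for a b
  proof -
    have aS: "a \<in> S" "b \<in> T" using ab R(1) by auto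
    have "g (x a - b) b' = 0" if b': "b' \<in> T" for b'
    proof -
      have "g (x a - b) d = 0" if d: "d \<in> snd ` R" for d
      proof -
        obtain c where cd: "(c, d) \<in> R" using d by auto
        then show ?thesis
          using half[OF aS(1) cd] compatD[OF R(4) ab cd] by (simp add: G.form_simps)
      qed
      then have "F.span (snd ` R) \<subseteq> {d. g (x a - b) d = 0}"
        by (intro F.span_minimal G.subspace_orth_right) auto
      then show ?thesis using b' spT by auto
    qed
    moreover have "x a - b \<in> T" using xT[OF aS(1)] aS(2) sT by (simp add: F.subspace_diff)
    ultimately have "x a - b = 0" using T unfolding G.regular_def by blast
    then show ?thesis by simp
  qed
  have "snd ` R \<subseteq> x ` S" using xR R(1) by force
  moreover have "F.subspace (x ` S)" by (rule module_hom.subspace_image[OF mx sS])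
  ultimately have "T \<subseteq> x ` S" using spT F.span_minimal by blast
  with xT have im: "x ` S = T" by auto
  have "inj_on x S"
  proof (rule inj_onI)
    fix a b assume ab: "a \<in> S" "b \<in> S" "x a = x b"
    have d: "a - b \<in> S" using ab sS by (simp add: F.subspace_diff)
    have "f (a - b) c = 0" if "c \<in> S" for c
      using full[OF d that] ab(3) by (simp add: x_simps)
    then have "a - b = 0" using S d unfolding F.regular_def by blast
    then show "a = b" by simp
  qed
  \<comment> \<open>An isometry transports the asymmetry, since both sides have the same pairing
    with every vector of \<open>T\<close>. Compatibility with the polynomial action need not be
    built into \<open>iso\<close>.\<close>
  have tw: "x (\<sigma> a) = \<tau> (x a)" if a: "a \<in> S" for a
  proof -
    have sa: "\<sigma> a \<in> S" using F.regular_invariant[OF S] a by (simp add: F.invariant_def)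
    have ta: "\<tau> (x a) \<in> T" using G.regular_invariant[OF T] xT[OF a] by (simp add: G.invariant_def)
    have "g b (x (\<sigma> a) - \<tau> (x a)) = 0" if bT: "b \<in> T" for b
    proof -
      obtain c where c: "c \<in> S" "b = x c" using bT unfolding im[symmetric] by blast
      show ?thesis unfolding c(2) G.form_diff_right full[OF c(1) sa] G.asym[symmetric]
        full[OF a c(1)] F.asym[symmetric] by simp
    qed
    moreover have dT: "x (\<sigma> a) - \<tau> (x a) \<in> T" using xT[OF sa] ta sT by (simp add: F.subspace_diff)
    ultimately have "\<forall>b\<in>T. g (x (\<sigma> a) - \<tau> (x a)) b = 0"
      using G.form_swap_0'[OF G.regular_invariant[OF T], of "x (\<sigma> a) - \<tau> (x a)"] by blast
    then have "x (\<sigma> a) - \<tau> (x a) = 0" using T dT unfolding G.regular_def by blast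
    then show ?thesis by simp
  qed
  have "x (F.act p a) = G.act p (x a)" if a: "a \<in> S" for a p
  proof (induction p)
    case (pCons c p)
    have "F.act p a \<in> S" using F.invariant_act[OF F.regular_invariant[OF S] a] .
    then show ?case using pCons by (simp add: F.act_pCons G.act_pCons x_simps tw)
  qed (simp add: x_simps)
  then show thesis using that lx im \<open>inj_on x S\<close> full by blast
qed

lemma iso_dim:
  assumes "F.regular S" "G.regular T" "iso S T"
  shows "F.dim (F.ker S p) = F.dim (G.ker T p)"
proof -
  obtain x where x: "Vector_Spaces.linear scale scale x" "x ` S = T" "inj_on x S"
    "\<And>a b. a \<in> S \<Longrightarrow> b \<in> S \<Longrightarrow> g (x a) (x b) = f a b"
    "\<And>a p. a \<in> S \<Longrightarrow> x (F.act p a) = G.act p (x a)"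
    by (rule iso_map[OF assms]) (rule that)
  have x0: "x 0 = 0" using module_hom.zero[OF x(1)[folded module_hom_iff_linear]] .
  have S0: "0 \<in> S" using F.subspace_0[OF F.regular_subspace[OF assms(1)]] .
  have K: "F.act p a = 0 \<longleftrightarrow> G.act p (x a) = 0" if "a \<in> S" for a
    using x(5)[OF that, of p] x0 inj_onD[OF x(3) _ F.invariant_act[OF F.regular_invariant[OF assms(1)] that] S0, of p] by auto
  have "x ` F.ker S p = G.ker T p"
    unfolding F.ker_def G.ker_def x(2)[symmetric] using K by auto
  moreover have sp: "F.span (F.ker S p) = F.ker S p"
    using F.subspace_ker[OF F.regular_subspace[OF assms(1)]] by simp
  have "inj_on x (F.span (F.ker S p))"
    unfolding sp by (rule inj_on_subset[OF x(3)]) (auto simp: F.ker_def)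
  ultimately show ?thesis using F.fd.dim_image_eq[OF x(1), of "F.ker S p"] by simp
qed

lemma iso_alt:
  assumes "F.regular S" "G.regular T" "iso S T"
  shows "F.alt S k \<longleftrightarrow> G.alt T k"
proof -
  obtain x where x: "Vector_Spaces.linear scale scale x" "x ` S = T" "inj_on x S"
    "\<And>a b. a \<in> S \<Longrightarrow> b \<in> S \<Longrightarrow> g (x a) (x b) = f a b"
    "\<And>a p. a \<in> S \<Longrightarrow> x (F.act p a) = G.act p (x a)"
    by (rule iso_map[OF assms]) (rule that)
  have x0: "x 0 = 0" using module_hom.zero[OF x(1)[folded module_hom_iff_linear]] .
  have S0: "0 \<in> S" using F.subspace_0[OF F.regular_subspace[OF assms(1)]] .
  have inS: "F.act p a \<in> S" if "a \<in> S" for p a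
    using F.invariant_act[OF F.regular_invariant[OF assms(1)] that] .
  have K: "F.act p a = 0 \<longleftrightarrow> G.act p (x a) = 0" if "a \<in> S" for a p
    using x(5)[OF that, of p] x0 inj_onD[OF x(3) _ inS[OF that] S0, of p] by auto
  have "f (F.act p a) a = g (G.act p (x a)) (x a)" if "a \<in> S" for a p
    using x(4)[OF inS[OF that] that] x(5)[OF that] by simp
  then show ?thesis
    unfolding F.alt_def G.alt_def x(2)[symmetric] using K by simp
qed

lemma iso_glue:
  assumes S: "F.regular S" "F.regular U" "U \<subseteq> S" and T: "G.regular T" "G.regular W" "W \<subseteq> T"
    and iso: "iso U W" "iso (F.ortho U S) (G.ortho W T)"
  shows "iso S T"
proof -
  obtain R where R: "R \<subseteq> U \<times> W" "U \<subseteq> F.span (fst ` R)" "W \<subseteq> F.span (snd ` R)" "compat R"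
    using iso(1) by (auto simp: iso_def)
  obtain Q where Q: "Q \<subseteq> F.ortho U S \<times> G.ortho W T" "F.ortho U S \<subseteq> F.span (fst ` Q)"
    "G.ortho W T \<subseteq> F.span (snd ` Q)" "compat Q"
    using iso(2) by (auto simp: iso_def)
  have "R \<union> Q \<subseteq> S \<times> T" using R(1) Q(1) S(3) T(3) F.ortho_subset G.ortho_subset by blast
  moreover have "S \<subseteq> F.span (fst ` (R \<union> Q))"
  proof
    fix s assume "s \<in> S"
    then obtain u c where "u \<in> U" "c \<in> F.ortho U S" "s = u + c"
      using F.ortho_decomp[OF S(2) F.regular_subspace[OF S(1)] S(3)] by blast
    then show "s \<in> F.span (fst ` (R \<union> Q))"
      using R(2) Q(2) F.span_mono[of "fst ` R" "fst ` (R \<union> Q)"] F.span_mono[of "fst ` Q" "fst ` (R \<union> Q)"]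
      by (auto intro!: F.span_add)
  qed
  moreover have "T \<subseteq> F.span (snd ` (R \<union> Q))"
  proof
    fix s assume "s \<in> T"
    then obtain u c where "u \<in> W" "c \<in> G.ortho W T" "s = u + c"
      using G.ortho_decomp[OF T(2) G.regular_subspace[OF T(1)] T(3)] by blast
    then show "s \<in> F.span (snd ` (R \<union> Q))"
      using R(3) Q(3) F.span_mono[of "snd ` R" "snd ` (R \<union> Q)"] F.span_mono[of "snd ` Q" "snd ` (R \<union> Q)"]
      by (auto intro!: F.span_add)
  qed
  moreover have "compat (R \<union> Q)"
  proof -
    have "f a a' = g b b'" if ab: "(a, b) \<in> R \<union> Q" and ab': "(a', b') \<in> R \<union> Q" for a b a' b'
    proof -
      consider "(a, b) \<in> R" "(a', b') \<in> R" | "(a, b) \<in> Q" "(a', b') \<in> Q"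
        | "(a, b) \<in> R" "(a', b') \<in> Q" | "(a, b) \<in> Q" "(a', b') \<in> R"
        using ab ab' by blast
      then show ?thesis
      proof cases
        case 3
        then have "a \<in> U" "b \<in> W" "a' \<in> F.ortho U S" "b' \<in> G.ortho W T" using R(1) Q(1) by auto
        then show ?thesis using F.ortho_orth'[OF S(2)] G.ortho_orth'[OF T(2)] by simp
      next
        case 4
        then have "a' \<in> U" "b' \<in> W" "a \<in> F.ortho U S" "b \<in> G.ortho W T" using R(1) Q(1) by auto
        then show ?thesis using F.ortho_orth G.ortho_orth by simp
      qed (use R(4) Q(4) compatD in auto)
    qed
    then show ?thesis by (auto simp: compat_def)
  qed
  ultimately show ?thesis unfolding iso_def by blast
qed

text \<open>\<open>functional_zero\<close> is applied to the difference of the two functionals,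
  which is possible because both forms share \<open>\<rho>\<close>.\<close>

lemma iso_cyc:
  assumes e: "e * e = 1" and eq: "\<And>j. f (F.act (F.N e ^ j) u) u = g (G.act (F.N e ^ j) u') u'"
  shows "iso (F.cyc u) (G.cyc u')"
proof -
  have val: "f (F.act p u) u = g (G.act p u') u'" for p
  proof -
    have "f (F.act (F.N e ^ 0 * p) u) u - g (G.act (F.N e ^ 0 * p) u') u' = 0"
    proof (rule functional_zero[of "\<lambda>p. f (F.act p u) u - g (G.act p u') u'" \<rho> e "F.N e" 0 0 p])
      show "F.N e = lin_poly e * (\<rho> - [:e:])" by (rule norm_poly_def)
    qed (simp_all only: F.poly_act_add F.poly_act_smult F.form_simps G.form_simps F.act_inv_mult
      G.act_inv_mult F.form_N_rho G.form_N_rho e eq right_diff_distrib diff_self, simp)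
    then show ?thesis by simp
  qed
  define R where "R = {(F.act p u, G.act p u') | p. True}"
  have "compat R" unfolding compat_def R_def
    using val by (auto simp: F.form_act_act G.form_act_act F.star_def G.star_def)
  moreover have "F.cyc u \<subseteq> fst ` R" "G.cyc u' \<subseteq> snd ` R"
    by (force simp: R_def F.cyc_def G.cyc_def)+
  then have "F.cyc u \<subseteq> F.span (fst ` R)" "G.cyc u' \<subseteq> F.span (snd ` R)"
    using F.span_superset by blast+
  moreover have "R \<subseteq> F.cyc u \<times> G.cyc u'" by (auto simp: R_def)
  ultimately show ?thesis unfolding iso_def by blast
qed

text \<open>The powers of \<open>X - c\<close> span all polynomials, so the normalised values fix
  the pairing of \<open>u\<close> with all of \<open>cyc v\<close>. The asymmetry gives the pairing
  in the other order, and isotropy the remaining entries.\<close>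

lemma iso_hyp:
  assumes h: "F.hyper c m u v" "G.hyper c m u' v'"
  shows "iso (F.hyp u v) (G.hyp u' v')"
proof -
  have pow: "f (F.act (lin_poly c ^ i) u) v = g (G.act (lin_poly c ^ i) u') v'" for i
    using h by (simp add: F.hyper_def G.hyper_def)
  have val: "f (F.act (lin_poly c ^ i * p) u) v = g (G.act (lin_poly c ^ i * p) u') v'" for i p
  proof (induction p arbitrary: i)
    case (pCons a p)
    have X: "lin_poly c + [:c:] = [:0, 1:]" by (simp add: lin_poly_def)
    have "pCons a p = [:a:] + (lin_poly c + [:c:]) * p" unfolding X by simp
    then have eq: "lin_poly c ^ i * pCons a p
      = smult a (lin_poly c ^ i) + (lin_poly c ^ Suc i * p + smult c (lin_poly c ^ i * p))"
      by (simp add: algebra_simps)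
    show ?case unfolding eq
      by (simp only: F.poly_act_add F.poly_act_smult F.form_simps G.form_simps pow pCons)
  qed simp
  have val0: "f (F.act p u) v = g (G.act p u') v'" for p
    using val[of 0 p] by simp
  have uv: "f (F.act p u) (F.act q v) = g (G.act p u') (G.act q v')" for p q
    unfolding F.form_act_act G.form_act_act F.star_def G.star_def val0 ..
  have vu: "f (F.act q v) (F.act p u) = g (G.act q v') (G.act p u')" for p q
    unfolding F.asym[of "F.act q v"] G.asym[of "G.act q v'"]
    using uv[of p "[:0,1:] * q"] by (simp only: F.act_mult G.act_mult F.act_X G.act_X)
  have z: "f (F.act p u) (F.act q u) = 0" "f (F.act p v) (F.act q v) = 0"
    "g (G.act p u') (G.act q u') = 0" "g (G.act p v') (G.act q v') = 0" for p q
    using h by (simp_all add: F.hyper_def G.hyper_def F.form_act_act G.form_act_act)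
  define R where "R = {(F.act p u + F.act q v, G.act p u' + G.act q v') | p q. True}"
  have "compat R" unfolding compat_def R_def
    using uv vu z by (auto simp: F.form_simps G.form_simps)
  moreover have "F.hyp u v \<subseteq> fst ` R" "G.hyp u' v' \<subseteq> snd ` R"
    by (force simp: R_def F.cyc_def G.cyc_def F.hyp_def G.hyp_def)+
  then have "F.hyp u v \<subseteq> F.span (fst ` R)" "G.hyp u' v' \<subseteq> F.span (snd ` R)"
    using F.span_superset by blast+
  moreover have "R \<subseteq> F.hyp u v \<times> G.hyp u' v'"
    by (auto simp: R_def intro!: F.hypI G.hypI)
  ultimately show ?thesis unfolding iso_def by blast
qed

lemma split_summand:
  assumes qc: "quadratically_closed TYPE('a)" and S: "F.regular S" and T: "G.regular T"
    and S0: "x \<in> S" "x \<noteq> 0"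
    and dims: "\<And>c k. F.dim (F.ker S (lin_poly c ^ k)) = F.dim (G.ker T (lin_poly c ^ k))"
    and alts: "\<And>k. (2::'a) = 0 \<Longrightarrow> F.alt S k \<longleftrightarrow> G.alt T k"
  obtains U W where "F.regular U" "U \<subseteq> S" "\<exists>u\<in>U. u \<noteq> 0" "G.regular W" "W \<subseteq> T" "iso U W"
    "\<And>k. (2::'a) = 0 \<Longrightarrow> F.alt (F.ortho U S) k \<longleftrightarrow> G.alt (G.ortho W T) k"
proof -
  note iS = F.regular_invariant[OF S] and iT = G.regular_invariant[OF T]
  obtain c m where tS: "F.top_exp S c m"
    using F.top_exp_exists[OF iS S0] by blast
  then have tT: "G.top_exp T c m"
    unfolding F.top_exp_dim[OF F.regular_subspace[OF S]] G.top_exp_dim[OF G.regular_subspace[OF T]] dims .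
  have m: "m > 0" using tS by (simp add: F.top_exp_def)
  have na_alt: "\<not> F.nonalt S 1 m \<longleftrightarrow> F.alt S m" "\<not> G.nonalt T 1 m \<longleftrightarrow> G.alt T m"
    by (auto simp: F.nonalt_def F.alt_def G.nonalt_def G.alt_def)
  have e1: "c = 1" if "(2::'a) = 0" "c * c = 1"
    using that square_eq_1[of c] by (metis add.inverse_unique one_add_one)
  have na: "F.nonalt S c m \<longleftrightarrow> G.nonalt T c m" if cc: "c * c = 1"
  proof (cases "(2::'a) = 0")
    case True
    then show ?thesis using na_alt alts[of m] e1[OF True cc] by blast
  next
    case False
    then show ?thesis using F.nonalt_iff[OF False cc S tS] G.nonalt_iff[OF False cc T tT] by simp
  qed
  show thesis
  proof (cases "c * c = 1 \<and> F.nonalt S c m")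
    case True
    then have cc: "c * c = 1" and nS: "F.nonalt S c m" and nT: "G.nonalt T c m" using na by auto
    obtain u where u: "u \<in> S" "F.act (lin_poly c ^ m) u = 0" "f (F.act (lin_poly c ^ (m - 1)) u) u \<noteq> 0"
      "\<And>j. f (F.act (F.N c ^ j) u) u = (if j = (m - 1) div 2 then 1 else 0)"
      "(2::'a) = 0 \<Longrightarrow> c = 1 \<Longrightarrow> F.alt (F.ortho (F.cyc u) S) m \<longleftrightarrow> \<not> F.nonalt_pair S m"
      by (rule F.cyc_choice[OF qc cc S m nS]) (rule that)
    obtain w where w: "w \<in> T" "G.act (lin_poly c ^ m) w = 0" "g (G.act (lin_poly c ^ (m - 1)) w) w \<noteq> 0"
      "\<And>j. g (G.act (F.N c ^ j) w) w = (if j = (m - 1) div 2 then 1 else 0)"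
      "(2::'a) = 0 \<Longrightarrow> c = 1 \<Longrightarrow> G.alt (G.ortho (G.cyc w) T) m \<longleftrightarrow> \<not> G.nonalt_pair T m"
      by (rule G.cyc_choice[OF qc cc T m nT]) (rule that)
    have gU: "F.regular (F.cyc u)" by (rule F.regular_cyc[OF cc u(2,3)])
    have gW: "G.regular (G.cyc w)" by (rule G.regular_cyc[OF cc w(2,3)])
    have U: "F.cyc u \<subseteq> S" by (rule F.cyc_subset[OF iS u(1)])
    have W: "G.cyc w \<subseteq> T" by (rule G.cyc_subset[OF iT w(1)])
    have iUW: "iso (F.cyc u) (G.cyc w)"
      by (rule iso_cyc[OF cc]) (simp add: u(4) w(4))
    have "F.alt (F.ortho (F.cyc u) S) k \<longleftrightarrow> G.alt (G.ortho (G.cyc w) T) k" if two: "(2::'a) = 0" for k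
    proof (cases "k = m")
      case True
      have c1: "c = 1" using e1[OF two cc] .
      have "F.nonalt_pair S m \<longleftrightarrow> G.nonalt_pair T m"
        using F.nonalt_pair_iff[OF two S] G.nonalt_pair_iff[OF two T] tS tT nS nT dims unfolding c1 by simp
      then show ?thesis using u(5)[OF two c1] w(5)[OF two c1] True by simp
    next
      case False
      have c1: "c = 1" using e1[OF two cc] .
      have "F.act (lin_poly 1 ^ (m - 1)) u \<noteq> 0" "G.act (lin_poly 1 ^ (m - 1)) w \<noteq> 0"
        using u(3) w(3) c1 by auto
      then have "F.alt (F.cyc u) k" "G.alt (G.cyc w) k"
        using F.alt_cyc[of m u k] G.alt_cyc[of m w k] u(2) w(2) c1 m False by auto
      then show ?thesis
        using F.alt_ortho[OF gU S U, of k] G.alt_ortho[OF gW T W, of k] alts[OF two, of k] by blast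
    qed
    moreover have "u \<noteq> 0" using u(3) by auto
    ultimately show thesis using that[OF gU U _ gW W iUW] F.cyc_self by blast
  next
    case False
    have aS: "f (F.act (lin_poly c ^ (m - 1)) y) y = 0"
      if "c * c = 1" "y \<in> S" "F.act (lin_poly c ^ m) y = 0" for y
      using False that by (auto simp: F.nonalt_def)
    have aT: "g (G.act (lin_poly c ^ (m - 1)) y) y = 0"
      if "c * c = 1" "y \<in> T" "G.act (lin_poly c ^ m) y = 0" for y
      using False na that by (auto simp: G.nonalt_def)
    obtain u v where uv: "u \<in> S" "v \<in> S" "F.hyper c m u v"
      by (rule F.split_hyper[OF qc S tS aS]) (assumption | rule that)+
    obtain u' v' where uv': "u' \<in> T" "v' \<in> T" "G.hyper c m u' v'"
      by (rule G.split_hyper[OF qc T tT aT]) (assumption | rule that)+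
    have gU: "F.regular (F.hyp u v)" by (rule F.regular_hyp[OF uv(3)])
    have gW: "G.regular (G.hyp u' v')" by (rule G.regular_hyp[OF uv'(3)])
    have U: "F.hyp u v \<subseteq> S" by (rule F.hyp_subset[OF iS uv(1,2)])
    have W: "G.hyp u' v' \<subseteq> T" by (rule G.hyp_subset[OF iT uv'(1,2)])
    have "f (F.act (lin_poly c ^ (m - 1)) u) v = 1" using uv(3) by (simp add: F.hyper_def)
    then have "u \<noteq> 0" by auto
    moreover have "u \<in> F.hyp u v" using F.cyc_hyp(1) F.cyc_self by blast
    moreover have "F.alt (F.ortho (F.hyp u v) S) k \<longleftrightarrow> G.alt (G.ortho (G.hyp u' v') T) k"
      if two: "(2::'a) = 0" for k
      using F.alt_ortho[OF gU S U, of k] G.alt_ortho[OF gW T W, of k] alts[OF two, of k]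
        F.alt_hyp[OF two uv(3)] G.alt_hyp[OF two uv'(3)] by blast
    ultimately show thesis using that[OF gU U _ gW W iso_hyp[OF uv(3) uv'(3)]] by blast
  qed
qed

theorem iso_if_same_type:
  assumes qc: "quadratically_closed TYPE('a)" and "F.regular S" "G.regular T"
    and "\<And>c k. F.dim (F.ker S (lin_poly c ^ k)) = F.dim (G.ker T (lin_poly c ^ k))"
    and "\<And>k. (2::'a) = 0 \<Longrightarrow> F.alt S k \<longleftrightarrow> G.alt T k"
  shows "iso S T"
  using assms(2-)
proof (induction "F.dim S" arbitrary: S T rule: less_induct)
  case less
  note S = less.prems(1) and T = less.prems(2) and dims = less.prems(3) and alts = less.prems(4)
  show ?case
  proof (cases "S \<subseteq> {0}")
    case True
    \<comment> \<open>A non-zero \<open>T\<close> would have an eigenvalue, hence a kernel of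
      positive dimension, whereas the matching kernels in \<open>S\<close> are zero.\<close>
    have "T \<subseteq> {0}"
    proof (rule ccontr)
      assume "\<not> T \<subseteq> {0}"
      then obtain y where "y \<in> T" "y \<noteq> 0" by blast
      then obtain c m where "G.top_exp T c m" by (rule G.top_exp_exists[OF G.regular_invariant[OF T]])
      then have "F.dim (G.ker T (lin_poly c ^ m)) > 0"
        unfolding G.top_exp_dim[OF G.regular_subspace[OF T]] by linarith
      moreover have "F.ker S (lin_poly c ^ m) \<subseteq> {0}" using True by (auto simp: F.ker_def)
      then have "F.dim (F.ker S (lin_poly c ^ m)) = 0" unfolding F.dim_eq_0 .
      ultimately show False using dims[of c m] by linarith
    qed
    moreover have "compat {}" by (simp add: compat_def)
    ultimately show ?thesis using True by (auto simp: iso_def intro!: exI[of _ "{}"])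
  next
    case False
    then obtain x where "x \<in> S" "x \<noteq> 0" by blast
    from split_summand[OF qc S T this dims alts]
    obtain U W where UW: "F.regular U" "U \<subseteq> S" "\<exists>u\<in>U. u \<noteq> 0" "G.regular W" "W \<subseteq> T" "iso U W"
      "\<And>k. (2::'a) = 0 \<Longrightarrow> F.alt (F.ortho U S) k \<longleftrightarrow> G.alt (G.ortho W T) k" by blast
    have "F.dim U \<noteq> 0" using UW(3) F.dim_eq_0[of U] by blast
    then have "F.dim (F.ortho U S) < F.dim S" using F.dim_ortho[OF UW(1) S UW(2)] by linarith
    moreover have "F.dim (F.ker (F.ortho U S) (lin_poly c ^ k)) = F.dim (G.ker (G.ortho W T) (lin_poly c ^ k))" for c k
      using F.dim_ker_ortho[OF UW(1) S UW(2)] G.dim_ker_ortho[OF UW(4) T UW(5)] dims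
        iso_dim[OF UW(1,4,6)] by (metis add_left_cancel)
    ultimately have "iso (F.ortho U S) (G.ortho W T)"
      using UW(7) F.regular_ortho[OF UW(1) S UW(2)] G.regular_ortho[OF UW(4) T UW(5)]
      by (intro less.hyps)
    then show ?thesis by (rule iso_glue[OF S UW(1,2) T UW(4,5,6)])
  qed
qed

end

context asym_form
begin

section \<open>Elementary divisors\<close>

definition primary_decomp :: "'v set \<Rightarrow> nat \<Rightarrow> (nat \<Rightarrow> 'v) \<Rightarrow> (nat \<Rightarrow> 'a poly) \<Rightarrow> bool" where
  "primary_decomp S n w q \<longleftrightarrow> internal_direct_sum scale {..<n} (\<lambda>i. cyc (w i)) S \<and>
     (\<forall>i<n. (\<exists>p k. irreducible p \<and> lead_coeff p = 1 \<and> 0 < k \<and> q i = p ^ k) \<and>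
       (\<forall>p. act p (w i) = 0 \<longleftrightarrow> q i dvd p))"

lemma primary_decomp_UNIV: "primary_decomp UNIV n w q \<longleftrightarrow> primary_cyclic_decomposition scale \<sigma> n w q"
  unfolding primary_decomp_def primary_cyclic_decomposition_def cyc_def ..

lemma primary_decomp_extend:
  assumes C: "primary_decomp C n w q" and S: "S = {x + y | x y. x \<in> cyc u \<and> y \<in> C}"
    and int: "\<And>x. x \<in> cyc u \<Longrightarrow> x \<in> C \<Longrightarrow> x = 0" and C_sub: "subspace C"
    and u: "act (lin_poly c ^ m) u = 0" "act (lin_poly c ^ (m - 1)) u \<noteq> 0" "m > 0"
  shows "primary_decomp S (Suc n) (w(n := u)) (q(n := lin_poly c ^ m))"
proof -
  have ids: "internal_direct_sum scale {..<n} (\<lambda>i. cyc (w i)) C"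
    using C by (simp add: primary_decomp_def)
  have C_eq: "C = {\<Sum>i<n. h i | h. \<forall>i<n. h i \<in> cyc (w i)}"
    and C_ind: "\<And>h. (\<forall>i<n. h i \<in> cyc (w i)) \<Longrightarrow> (\<Sum>i<n. h i) = 0 \<Longrightarrow> \<forall>i<n. h i = 0"
    using ids unfolding internal_direct_sum_def by auto
  have mem: "(\<forall>i\<in>{..<Suc n}. h i \<in> cyc ((w(n := u)) i)) \<longleftrightarrow> (\<forall>i<n. h i \<in> cyc (w i)) \<and> h n \<in> cyc u" for h
    by (auto simp: less_Suc_eq)
  have "internal_direct_sum scale {..<Suc n} (\<lambda>i. cyc ((w(n := u)) i)) S"
    unfolding internal_direct_sum_def
  proof (intro conjI allI impI)
    show "\<forall>i\<in>{..<Suc n}. subspace (cyc ((w(n := u)) i))"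
      using invariant_cyc unfolding invariant_def by blast
    show "S = {\<Sum>i\<in>{..<Suc n}. h i | h. \<forall>i\<in>{..<Suc n}. h i \<in> cyc ((w(n := u)) i)}"
      unfolding mem
    proof (intro equalityI subsetI)
      fix s assume "s \<in> S"
      then obtain x h where xh: "x \<in> cyc u" "\<forall>i<n. h i \<in> cyc (w i)" "s = x + (\<Sum>i<n. h i)"
        unfolding S C_eq by auto
      then have "s = (\<Sum>i\<in>{..<Suc n}. (h(n := x)) i)" by (simp add: add.commute)
      moreover have "(\<forall>i<n. (h(n := x)) i \<in> cyc (w i)) \<and> (h(n := x)) n \<in> cyc u" using xh by simp
      ultimately show "s \<in> {\<Sum>i\<in>{..<Suc n}. h i | h. (\<forall>i<n. h i \<in> cyc (w i)) \<and> h n \<in> cyc u}" by blast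
    next
      fix s assume "s \<in> {\<Sum>i\<in>{..<Suc n}. h i | h. (\<forall>i<n. h i \<in> cyc (w i)) \<and> h n \<in> cyc u}"
      then obtain h where h: "s = (\<Sum>i\<in>{..<Suc n}. h i)" "\<forall>i<n. h i \<in> cyc (w i)" "h n \<in> cyc u" by blast
      have "s = h n + (\<Sum>i<n. h i)" using h(1) by (simp add: add.commute)
      moreover have "(\<Sum>i<n. h i) \<in> C" unfolding C_eq using h(2) by blast
      ultimately show "s \<in> S" unfolding S using h(3) by blast
    qed
  next
    fix h assume "(\<forall>i\<in>{..<Suc n}. h i \<in> cyc ((w(n := u)) i)) \<and> (\<Sum>i\<in>{..<Suc n}. h i) = 0"
    then have h: "\<forall>i<n. h i \<in> cyc (w i)" "h n \<in> cyc u" "(\<Sum>i<n. h i) + h n = 0" unfolding mem by auto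
    have s: "(\<Sum>i<n. h i) \<in> C" unfolding C_eq using h(1) by blast
    have "h n = - (\<Sum>i<n. h i)" using h(3) by (simp add: eq_neg_iff_add_eq_0 add.commute)
    then have "h n \<in> C" using subspace_neg[OF C_sub s] by simp
    then have "h n = 0" using int h(2) by blast
    then have "(\<Sum>i<n. h i) = 0" using h(3) by simp
    then show "\<forall>i\<in>{..<Suc n}. h i = 0" using C_ind[OF h(1)] \<open>h n = 0\<close> by (auto simp: less_Suc_eq)
  qed simp
  moreover have "\<forall>i<n. (\<exists>p k. irreducible p \<and> lead_coeff p = 1 \<and> 0 < k \<and> q i = p ^ k) \<and>
       (\<forall>p. act p (w i) = 0 \<longleftrightarrow> q i dvd p)"
    using C by (simp add: primary_decomp_def)
  moreover have "irreducible (lin_poly c)" "lead_coeff (lin_poly c) = 1"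
    by (simp_all add: lin_poly_def irreducible_linear_field_poly)
  then have "\<exists>p k. irreducible p \<and> lead_coeff p = 1 \<and> 0 < k \<and> lin_poly c ^ m = p ^ k"
    using u(3) by blast
  ultimately show ?thesis
    using annihilator_cyc[OF u] unfolding primary_decomp_def by (auto simp: less_Suc_eq)
qed

lemma ortho_sum: "regular U \<Longrightarrow> regular S \<Longrightarrow> U \<subseteq> S \<Longrightarrow> S = {x + y | x y. x \<in> U \<and> y \<in> ortho U S}"
proof (intro equalityI subsetI)
  assume "regular U" "regular S" "U \<subseteq> S"
  fix x
  show "x \<in> S \<Longrightarrow> x \<in> {x + y | x y. x \<in> U \<and> y \<in> ortho U S}"
    by (rule ortho_decomp[OF \<open>regular U\<close> regular_subspace[OF \<open>regular S\<close>] \<open>U \<subseteq> S\<close>]) auto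
  show "x \<in> {x + y | x y. x \<in> U \<and> y \<in> ortho U S} \<Longrightarrow> x \<in> S"
    using \<open>U \<subseteq> S\<close> ortho_subset[of U S] subspace_add[OF regular_subspace[OF \<open>regular S\<close>]] by auto
qed

lemma hyper_tops:
  assumes "hyper c m u v"
  shows "act (lin_poly c ^ (m - 1)) u \<noteq> 0" "act (lin_poly (1 / c) ^ (m - 1)) v \<noteq> 0"
proof -
  have top: "f (act (lin_poly c ^ (m - 1)) u) v = 1" and c: "c \<noteq> 0" using assms by (auto simp: hyper_def)
  then show "act (lin_poly c ^ (m - 1)) u \<noteq> 0" by auto
  show "act (lin_poly (1 / c) ^ (m - 1)) v \<noteq> 0"
    using top unfolding adj star_power star_lin_poly_power_act[OF c] by auto
qed

text \<open>The decomposition comes from splitting the form, following the same induction as the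
  isometry theorem; a hyperbolic summand contributes two cyclic modules, added one at a
  time.\<close>

lemma primary_decomp_exists:
  assumes qc: "quadratically_closed TYPE('a)" and "regular S"
  shows "\<exists>n w q. primary_decomp S n w q"
  using assms(2)
proof (induction "dim S" arbitrary: S rule: less_induct)
  case less
  note S = less.prems
  show ?case
  proof (cases "S \<subseteq> {0}")
    case True
    then have "S = {0}" using subspace_0[OF regular_subspace[OF S]] by auto
    then have "primary_decomp S 0 (\<lambda>_. 0) (\<lambda>_. 0)"
      by (auto simp: primary_decomp_def internal_direct_sum_def)
    then show ?thesis by blast
  next
    case False
    then obtain x where x: "x \<in> S" "x \<noteq> 0" by blast
    obtain c m where t: "top_exp S c m" using top_exp_exists[OF regular_invariant[OF S] x] by blast
    have m: "m > 0" using t by (simp add: top_exp_def)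
    have IH: "\<exists>n w q. primary_decomp (ortho U S) n w q"
      if U: "regular U" "U \<subseteq> S" and z: "z \<in> U" "z \<noteq> 0" for U z
    proof (rule less.hyps)
      have "dim U \<noteq> 0" using z dim_eq_0[of U] by blast
      then show "dim (ortho U S) < dim S" using dim_ortho[OF U(1) S U(2)] by linarith
      show "regular (ortho U S)" by (rule regular_ortho[OF U(1) S U(2)])
    qed
    show ?thesis
    proof (cases "c * c = 1 \<and> nonalt S c m")
      case True
      then obtain u where u: "u \<in> S" "act (lin_poly c ^ m) u = 0" "f (act (lin_poly c ^ (m - 1)) u) u \<noteq> 0"
        and cc: "c * c = 1" by (auto simp: nonalt_def)
      have g: "regular (cyc u)" by (rule regular_cyc[OF cc u(2,3)])
      have sub: "cyc u \<subseteq> S" by (rule cyc_subset[OF regular_invariant[OF S] u(1)])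
      have u0: "act (lin_poly c ^ (m - 1)) u \<noteq> 0" using u(3) by auto
      then have "u \<noteq> 0" by auto
      then obtain n w q where "primary_decomp (ortho (cyc u) S) n w q"
        using IH[OF g sub cyc_self] by blast
      moreover have "x = 0" if "x \<in> cyc u" "x \<in> ortho (cyc u) S" for x by (rule ortho_Int[OF g that])
      ultimately show ?thesis
        using primary_decomp_extend[OF _ ortho_sum[OF g S sub] _ regular_subspace[OF regular_ortho[OF g S sub]] u(2) u0 m]
        by blast
    next
      case False
      then have al: "f (act (lin_poly c ^ (m - 1)) y) y = 0"
        if "c * c = 1" "y \<in> S" "act (lin_poly c ^ m) y = 0" for y
        using that by (auto simp: nonalt_def)
      obtain u v where uv: "u \<in> S" "v \<in> S" "hyper c m u v"
        by (rule split_hyper[OF qc S t al]) (assumption | rule that)+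
      have g: "regular (hyp u v)" by (rule regular_hyp[OF uv(3)])
      have sub: "hyp u v \<subseteq> S" by (rule hyp_subset[OF regular_invariant[OF S] uv(1,2)])
      define C where "C = ortho (hyp u v) S"
      have gC: "subspace C" unfolding C_def by (rule regular_subspace[OF regular_ortho[OF g S sub]])
      note tops = hyper_tops[OF uv(3)]
      have "u \<noteq> 0" "u \<in> hyp u v" using tops cyc_hyp(1) cyc_self by auto
      then obtain n w q where C: "primary_decomp C n w q" unfolding C_def using IH[OF g sub] by blast
      define D where "D = {x + y | x y. x \<in> cyc v \<and> y \<in> C}"
      have sub_v: "subspace (cyc v)" using invariant_cyc by (simp add: invariant_def)
      have "subspace D" unfolding D_def by (rule subspace_sums[OF sub_v gC])
      have kv: "act (lin_poly (1 / c) ^ m) v = 0" and ku: "act (lin_poly c ^ m) u = 0"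
        using uv(3) by (auto simp: hyper_def)
      have "x = 0" if "x \<in> cyc v" "x \<in> C" for x
        using ortho_Int[OF g, of x S] that cyc_hyp(2) by (auto simp: C_def)
      from primary_decomp_extend[OF C D_def this gC kv tops(2) m]
      have D: "primary_decomp D (Suc n) (w(n := v)) (q(n := lin_poly (1 / c) ^ m))" .
      have "x = 0" if x: "x \<in> cyc u" "x \<in> D" for x
      proof -
        obtain y z where yz: "y \<in> cyc v" "z \<in> C" "x = y + z" using x(2) unfolding D_def by blast
        have "x - y \<in> hyp u v"
          using x(1) yz(1) cyc_hyp[of u v] cyc_hyp[of v u] regular_subspace[OF g] by (meson subsetD subspace_diff cyc_hyp)
        then have "z = 0" using ortho_Int[OF g, of z S] yz by (simp add: C_def)
        then have "x \<in> cyc v" using yz by simp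
        then have "f x y = 0" if "y \<in> cyc v" for y
          using isotropic_cyc[of v x y] uv(3) that by (simp add: hyper_def)
        then show ?thesis using hyper_faithful(1)[OF uv(3) x(1)] by blast
      qed
      moreover have "S = {x + y | x y. x \<in> cyc u \<and> y \<in> D}"
      proof -
        have "S = {x + y | x y. x \<in> hyp u v \<and> y \<in> C}" unfolding C_def by (rule ortho_sum[OF g S sub])
        also have "\<dots> = {x + y | x y. x \<in> cyc u \<and> y \<in> D}"
        proof (intro equalityI subsetI)
          fix s assume "s \<in> {x + y | x y. x \<in> hyp u v \<and> y \<in> C}"
          then obtain a b z where "a \<in> cyc u" "b \<in> cyc v" "z \<in> C" "s = a + b + z" unfolding hyp_def by blast
          then have "s = a + (b + z)" "b + z \<in> D" unfolding D_def by (auto simp: add.assoc)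
          then show "s \<in> {x + y | x y. x \<in> cyc u \<and> y \<in> D}" using \<open>a \<in> cyc u\<close> by blast
        next
          fix s assume "s \<in> {x + y | x y. x \<in> cyc u \<and> y \<in> D}"
          then obtain a b z where "a \<in> cyc u" "b \<in> cyc v" "z \<in> C" "s = a + (b + z)" unfolding D_def by blast
          then have "s = (a + b) + z" "a + b \<in> hyp u v" unfolding hyp_def by (auto simp: add.assoc)
          then show "s \<in> {x + y | x y. x \<in> hyp u v \<and> y \<in> C}" using \<open>z \<in> C\<close> by blast
        qed
        finally show ?thesis .
      qed
      ultimately show ?thesis using primary_decomp_extend[OF D _ _ \<open>subspace D\<close> ku tops(1) m] by blast
    qed
  qed
qed

text \<open>Such a vector generates a regular cyclic module, so it can be completed to a primary
  decomposition through its orthogonal complement. Contrapositively, absence of odd elementary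
  divisors makes every odd level alternating.\<close>

lemma elementary_divisor_if:
  assumes qc: "quadratically_closed TYPE('a)" and m: "m > 0"
    and u: "act (lin_poly 1 ^ m) u = 0" "f (act (lin_poly 1 ^ (m - 1)) u) u \<noteq> 0"
  shows "elementary_divisor scale \<sigma> (lin_poly 1 ^ m)"
proof -
  have g: "regular (cyc u)" using regular_cyc[OF _ u] by simp
  have u0: "act (lin_poly 1 ^ (m - 1)) u \<noteq> 0" using u(2) by auto
  obtain n w q where "primary_decomp (ortho (cyc u) UNIV) n w q"
    using primary_decomp_exists[OF qc regular_ortho[OF g regular_UNIV]] by blast
  moreover have "x = 0" if "x \<in> cyc u" "x \<in> ortho (cyc u) UNIV" for x by (rule ortho_Int[OF g that])
  ultimately have "primary_decomp UNIV (Suc n) (w(n := u)) (q(n := lin_poly 1 ^ m))"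
    using primary_decomp_extend[OF _ ortho_sum[OF g regular_UNIV] _ regular_subspace[OF regular_ortho[OF g regular_UNIV]] u(1) u0 m]
    by blast
  then have "primary_cyclic_decomposition scale \<sigma> (Suc n) (w(n := u)) (q(n := lin_poly 1 ^ m))"
    by (simp add: primary_decomp_UNIV)
  then show ?thesis unfolding elementary_divisor_def by fastforce
qed

section \<open>Decompositions into free modules\<close>

lemma minus_id_power: "(minus_id \<sigma> ^^ k) x = act (lin_poly 1 ^ k) x"
  by (induction k) (simp_all add: act_mult minus_id_def act_lin_poly)

lemma minus_id_act: "minus_id \<sigma> = act (lin_poly 1)"
  by (auto simp: minus_id_def act_lin_poly)

text \<open>Distributing the odd exponent \<open>k - 1\<close> over both arguments leaves, up to
  sign, \<open>f w (\<sigma> w) - f w w\<close>, which vanishes by the definition of the asymmetry.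
  This is why only odd \<open>m\<close> matter.\<close>

lemma alt_even:
  assumes "even k"
  shows "alt S k"
  unfolding alt_def
proof (intro ballI impI)
  fix x assume x: "act (lin_poly 1 ^ k) x = 0"
  obtain j where j: "k = 2 * j" using assms by blast
  show "f (act (lin_poly 1 ^ (k - 1)) x) x = 0"
  proof (cases j)
    case 0
    then show ?thesis using x j by simp
  next
    case (Suc i)
    define w where "w = act (lin_poly 1 ^ i) x"
    have "act (lin_poly 1 ^ j) x = act (lin_poly 1) w" by (simp add: w_def Suc act_mult)
    then have "f w (act (lin_poly 1 ^ j) x) = f w (\<sigma> w) - f w w" by (simp add: act_lin_poly form_simps)
    then have "f (act (lin_poly 1 ^ i) x) (act (lin_poly 1 ^ j) x) = 0"
      using asym[of w w] by (simp add: w_def)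
    then show ?thesis using form_top[of 1 k x i j x] x j Suc by simp
  qed
qed

text \<open>There is no Jordan block of size \<open>m\<close> for the eigenvalue 1.\<close>

definition no_block :: "nat \<Rightarrow> bool" where
  "no_block m \<longleftrightarrow> (\<forall>x. act (lin_poly 1 ^ m) x = 0 \<longrightarrow> (\<exists>a b. x = a + act (lin_poly 1) b \<and>
     act (lin_poly 1 ^ (m - 1)) a = 0 \<and> act (lin_poly 1 ^ (m + 1)) b = 0))"

text \<open>Without blocks of size \<open>m\<close> the value reduces to pairings of
  \<open>(X - 1)^m b\<close> with \<open>a\<close> and with \<open>(X - 1) b\<close>. The first
  vanishes because \<open>(X - 1)^m\<close> kills \<open>a\<close>, the second because the total
  exponent is \<open>m + 1\<close>.\<close>

lemma alt_if_no_block: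
  assumes "no_block m" "m > 0"
  shows "alt S m"
  unfolding alt_def
proof (intro ballI impI)
  fix x assume "act (lin_poly 1 ^ m) x = 0"
  then obtain a b where ab: "x = a + act (lin_poly 1) b" "act (lin_poly 1 ^ (m - 1)) a = 0"
    "act (lin_poly 1 ^ (m + 1)) b = 0" using assms(1) unfolding no_block_def by blast
  have "lin_poly 1 ^ (m - 1) * lin_poly 1 = (lin_poly 1 ^ m :: 'a poly)"
    using assms(2) by (metis Suc_diff_1 power_Suc2)
  then have "act (lin_poly 1 ^ (m - 1)) x = act (lin_poly 1 ^ m) b"
    unfolding ab(1) act_add_right ab(2) by (metis act_mult add.left_neutral)
  moreover have "act (lin_poly 1 ^ m) a = 0" using act_power_mono[OF ab(2)] by simp
  then have "f (act (lin_poly 1 ^ m) b) a = 0"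
    unfolding adj star_power using star_lin_power[of 1 m a] by simp
  moreover have "f (act (lin_poly 1 ^ m) b) (act (lin_poly 1) b) = 0"
    using form_high[OF _ ab(3), of m 1 1 1 b] by simp
  ultimately show "f (act (lin_poly 1 ^ (m - 1)) x) x = 0" using ab(1) by (simp add: form_simps)
qed

context
  fixes r :: nat and U :: "nat \<Rightarrow> 'v set"
  assumes dec: "orthogonal_free_decomposition scale f \<sigma> r U"
begin

lemma free_module: "i \<in> {1..r} \<Longrightarrow> free_quotient_module scale \<sigma> (lin_poly 1 ^ i) (U i)"
  using dec unfolding orthogonal_free_decomposition_def lin_poly_def by blast

lemma free_invariant: "i \<in> {1..r} \<Longrightarrow> invariant (U i)"
  using free_module unfolding free_quotient_module_def invariant_def by blast

lemma free_kill: "i \<in> {1..r} \<Longrightarrow> x \<in> U i \<Longrightarrow> act (lin_poly 1 ^ i) x = 0"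
  using free_module unfolding free_quotient_module_def by blast

lemma free_orth: "i \<in> {1..r} \<Longrightarrow> j \<in> {1..r} \<Longrightarrow> i \<noteq> j \<Longrightarrow> x \<in> U i \<Longrightarrow> y \<in> U j \<Longrightarrow> f x y = 0"
  using dec unfolding orthogonal_free_decomposition_def by blast

lemma free_zero: "i \<in> {1..r} \<Longrightarrow> 0 \<in> U i"
  using free_invariant subspace_0 by (auto simp: invariant_def)

lemma gen_eigen_decomp:
  assumes "act (lin_poly 1 ^ k) x = 0"
  obtains h where "\<And>i. i \<in> {1..r} \<Longrightarrow> h i \<in> U i" "x = (\<Sum>i\<in>{1..r}. h i)"
    "\<And>i. i \<in> {1..r} \<Longrightarrow> act (lin_poly 1 ^ k) (h i) = 0"
proof -
  have ids: "internal_direct_sum scale {1..r} U (gen_eigenspace_1 \<sigma>)"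
    using dec by (simp add: orthogonal_free_decomposition_def)
  have "x \<in> gen_eigenspace_1 \<sigma>" using assms by (auto simp: gen_eigenspace_1_def minus_id_power)
  then obtain h where h: "\<forall>i\<in>{1..r}. h i \<in> U i" "x = (\<Sum>i\<in>{1..r}. h i)"
    using ids unfolding internal_direct_sum_def by auto
  have "(\<Sum>i\<in>{1..r}. act (lin_poly 1 ^ k) (h i)) = 0"
    using assms unfolding h(2) by (simp add: act_sum_right)
  moreover have "\<forall>i\<in>{1..r}. act (lin_poly 1 ^ k) (h i) \<in> U i"
    using h(1) invariant_act[OF free_invariant] by blast
  moreover have ind: "(\<forall>i\<in>{1..r}. u i \<in> U i) \<and> (\<Sum>i\<in>{1..r}. u i) = 0 \<Longrightarrow> \<forall>i\<in>{1..r}. u i = 0" for u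
    using ids unfolding internal_direct_sum_def by blast
  ultimately have "\<forall>i\<in>{1..r}. act (lin_poly 1 ^ k) (h i) = 0"
    using ind[of "\<lambda>i. act (lin_poly 1 ^ k) (h i)"] by blast
  with h that show thesis by blast
qed

lemma free_ker:
  assumes i: "i \<in> {1..r}" and x: "x \<in> U i" "act (lin_poly 1 ^ k) x = 0" and k: "k \<le> i"
  obtains y where "y \<in> U i" "x = act (lin_poly 1 ^ (i - k)) y"
proof -
  obtain B where B: "finite B" "B \<subseteq> U i"
    "\<And>u. u \<in> U i \<Longrightarrow> \<exists>p. u = (\<Sum>b\<in>B. act (p b) b)"
    "\<And>p. (\<Sum>b\<in>B. act (p b) b) = 0 \<Longrightarrow> \<forall>b\<in>B. lin_poly 1 ^ i dvd p b"
    using free_module[OF i] unfolding free_quotient_module_def by metis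
  obtain p where p: "x = (\<Sum>b\<in>B. act (p b) b)" using B(3)[OF x(1)] by blast
  have "(\<Sum>b\<in>B. act (lin_poly 1 ^ k * p b) b) = 0"
    using x(2) unfolding p by (simp add: act_sum_right act_mult)
  then have d: "\<forall>b\<in>B. lin_poly 1 ^ i dvd lin_poly 1 ^ k * p b" by (rule B(4))
  have "\<forall>b\<in>B. \<exists>q. p b = lin_poly 1 ^ (i - k) * q"
  proof
    fix b assume "b \<in> B"
    with d have "lin_poly 1 ^ k * lin_poly 1 ^ (i - k) dvd lin_poly 1 ^ k * p b"
      using k by (simp flip: power_add)
    then have "lin_poly 1 ^ (i - k) dvd p b" by (subst (asm) dvd_mult_cancel_left) auto
    then show "\<exists>q. p b = lin_poly 1 ^ (i - k) * q" by (auto simp: dvd_def)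
  qed
  then obtain q where q: "\<And>b. b \<in> B \<Longrightarrow> p b = lin_poly 1 ^ (i - k) * q b" by metis
  have "x = act (lin_poly 1 ^ (i - k)) (\<Sum>b\<in>B. act (q b) b)"
    unfolding p act_sum_right by (rule sum.cong) (simp_all add: q act_mult)
  moreover have "(\<Sum>b\<in>B. act (q b) b) \<in> U i"
    using B(2) free_invariant[OF i] invariant_act[OF free_invariant[OF i]]
    by (intro subspace_sum) (auto simp: invariant_def)
  ultimately show thesis using that by blast
qed

text \<open>Components in smaller blocks are killed by \<open>(X - 1)^(m-1)\<close>, and by freeness
  those in larger blocks are divisible by \<open>X - 1\<close>; nothing lies in between.\<close>

lemma no_block_if:
  assumes m: "m \<in> {1..r}" and "U m = {0}"
  shows "no_block m"
  unfolding no_block_def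
proof (intro allI impI)
  fix x assume "act (lin_poly 1 ^ m) x = 0"
  then obtain h where h: "\<And>i. i \<in> {1..r} \<Longrightarrow> h i \<in> U i" "x = (\<Sum>i\<in>{1..r}. h i)"
    "\<And>i. i \<in> {1..r} \<Longrightarrow> act (lin_poly 1 ^ m) (h i) = 0"
    by (rule gen_eigen_decomp) (rule that)
  have "\<exists>y. h i = act (lin_poly 1) y \<and> act (lin_poly 1 ^ (m + 1)) y = 0" if i: "i \<in> {1..r}" "i > m" for i
  proof -
    obtain z where z: "z \<in> U i" "h i = act (lin_poly 1 ^ (i - m)) z"
      using free_ker[OF i(1) h(1,3)[OF i(1)]] i(2) by (metis less_imp_le)
    define y where "y = act (lin_poly 1 ^ (i - m - 1)) z"
    have "i - m = Suc (i - m - 1)" using i(2) by simp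
    then have "lin_poly 1 ^ (i - m) = lin_poly 1 * (lin_poly 1 ^ (i - m - 1) :: 'a poly)"
      by (metis power_Suc)
    then have "h i = act (lin_poly 1) y" unfolding z(2) y_def by (simp add: act_mult)
    moreover have "act (lin_poly 1 ^ (m + 1)) y = act (lin_poly 1 ^ i) z"
      unfolding y_def act_mult[symmetric] power_add[symmetric] using i(2) by simp
    ultimately show ?thesis using free_kill[OF i(1) z(1)] by auto
  qed
  then obtain y where y: "\<And>i. i \<in> {1..r} \<Longrightarrow> i > m \<Longrightarrow> h i = act (lin_poly 1) (y i) \<and> act (lin_poly 1 ^ (m + 1)) (y i) = 0"
    by metis
  define a where "a = (\<Sum>i\<in>{i\<in>{1..r}. i < m}. h i)"
  define b where "b = (\<Sum>i\<in>{i\<in>{1..r}. i > m}. y i)"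
  have hm: "h m = 0" using h(1)[OF m] assms(2) by simp
  have "x = (\<Sum>i\<in>{i\<in>{1..r}. i < m} \<union> {i\<in>{1..r}. i > m}. h i)"
    unfolding h(2) by (rule sum.mono_neutral_right) (use hm in \<open>auto simp: not_less le_less\<close>)
  also have "\<dots> = a + (\<Sum>i\<in>{i\<in>{1..r}. i > m}. h i)"
    unfolding a_def by (rule sum.union_disjoint) auto
  also have "(\<Sum>i\<in>{i\<in>{1..r}. i > m}. h i) = act (lin_poly 1) b"
    unfolding b_def act_sum_right using y by (intro sum.cong) auto
  finally have "x = a + act (lin_poly 1) b" .
  moreover have "act (lin_poly 1 ^ (m - 1)) a = 0"
    unfolding a_def act_sum_right
    using act_power_mono[OF free_kill[OF _ h(1)], of _ "m - 1"] by (intro sum.neutral) auto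
  moreover have "act (lin_poly 1 ^ (m + 1)) b = 0"
    unfolding b_def act_sum_right using y by (intro sum.neutral) auto
  ultimately show "\<exists>a b. x = a + act (lin_poly 1) b \<and>
     act (lin_poly 1 ^ (m - 1)) a = 0 \<and> act (lin_poly 1 ^ (m + 1)) b = 0" by blast
qed

text \<open>Only the component in \<open>U m\<close> can contribute: smaller blocks are killed, and
  a component in \<open>U i\<close> with \<open>i > m\<close> is \<open>(X - 1)^(i-m) z\<close>,
  which gives total exponent \<open>(i - 1) + (i - m)\<close>, at least \<open>i\<close>.\<close>

lemma alt_iff_free:
  assumes m: "m \<in> {1..r}"
  shows "alt UNIV m \<longleftrightarrow> (\<forall>u\<in>U m. f (act (lin_poly 1 ^ (m - 1)) u) u = 0)"
proof
  assume "alt UNIV m"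
  then show "\<forall>u\<in>U m. f (act (lin_poly 1 ^ (m - 1)) u) u = 0"
    using free_kill[OF m] by (auto simp: alt_def)
next
  assume A: "\<forall>u\<in>U m. f (act (lin_poly 1 ^ (m - 1)) u) u = 0"
  show "alt UNIV m" unfolding alt_def
  proof (intro ballI impI)
    fix x assume "act (lin_poly 1 ^ m) x = 0"
    then obtain h where h: "\<And>i. i \<in> {1..r} \<Longrightarrow> h i \<in> U i" "x = (\<Sum>i\<in>{1..r}. h i)"
      "\<And>i. i \<in> {1..r} \<Longrightarrow> act (lin_poly 1 ^ m) (h i) = 0"
      by (rule gen_eigen_decomp) (rule that)
    have diag: "f (act (lin_poly 1 ^ (m - 1)) (h i)) (h i) = 0" if i: "i \<in> {1..r}" for i
    proof -
      consider "i = m" | "i < m" | "i > m" by linarith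
      then show ?thesis
      proof cases
        case 1
        then show ?thesis using A h(1)[OF i] by blast
      next
        case 2
        then show ?thesis using act_power_mono[OF free_kill[OF i h(1)[OF i]], of "m - 1"] by simp
      next
        case 3
        obtain z where z: "z \<in> U i" "h i = act (lin_poly 1 ^ (i - m)) z"
          using free_ker[OF i h(1,3)[OF i]] 3 by (metis less_imp_le)
        have "act (lin_poly 1 ^ (m - 1)) (h i) = act (lin_poly 1 ^ (i - 1)) z"
          unfolding z(2) act_mult[symmetric] power_add[symmetric] using 3 m by simp
        then show ?thesis
          using form_high[OF _ free_kill[OF i z(1)], of "i - 1" "i - m" 1 1 z] 3 z(2) by simp
      qed
    qed
    have "f (act (lin_poly 1 ^ (m - 1)) x) x
      = (\<Sum>j\<in>{1..r}. \<Sum>i\<in>{1..r}. f (act (lin_poly 1 ^ (m - 1)) (h i)) (h j))"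
      unfolding h(2) by (simp add: act_sum_right form_sum_left form_sum_right)
    also have "\<dots> = 0"
    proof (intro sum.neutral ballI)
      fix i j assume ij: "j \<in> {1..r}" "i \<in> {1..r}"
      show "f (act (lin_poly 1 ^ (m - 1)) (h i)) (h j) = 0"
      proof (cases "i = j")
        case False
        then show ?thesis using free_orth[OF ij(2,1)] h(1)[OF ij(1)]
          invariant_act[OF free_invariant[OF ij(2)] h(1)[OF ij(2)]] by blast
      qed (use diag ij in simp)
    qed
    finally show "f (act (lin_poly 1 ^ (m - 1)) x) x = 0" .
  qed
qed

lemma alt_large:
  assumes "m > r"
  shows "alt UNIV m"
  unfolding alt_def
proof (intro ballI impI)
  fix x assume "act (lin_poly 1 ^ m) x = 0"
  then obtain h where h: "\<And>i. i \<in> {1..r} \<Longrightarrow> h i \<in> U i" "x = (\<Sum>i\<in>{1..r}. h i)"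
    by (rule gen_eigen_decomp) (rule that)
  have "act (lin_poly 1 ^ (m - 1)) x = 0"
    unfolding h(2) act_sum_right
    using act_power_mono[OF free_kill[OF _ h(1)], of _ "m - 1"] assms by (intro sum.neutral) auto
  then show "f (act (lin_poly 1 ^ (m - 1)) x) x = 0" by simp
qed

text \<open>The generalized eigenspace for 1 is paired with itself, and its other components are
  orthogonal to \<open>U m\<close>, so a partner of \<open>y\<close> can be found inside
  \<open>U m\<close>.\<close>

lemma free_nondeg:
  assumes m: "m \<in> {1..r}" and y: "y \<in> U m" "\<And>u. u \<in> U m \<Longrightarrow> f y u = 0"
  shows "y = 0"
proof (rule ccontr)
  assume "y \<noteq> 0"
  from eigen_pairing[OF regular_UNIV _ this free_kill[OF m y(1)]]
  obtain z M where "act (lin_poly (1 / 1) ^ M) z = 0" "f y z \<noteq> 0" by blast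
  then have z: "act (lin_poly 1 ^ M) z = 0" "f y z \<noteq> 0" by simp_all
  obtain h where h: "\<And>i. i \<in> {1..r} \<Longrightarrow> h i \<in> U i" "z = (\<Sum>i\<in>{1..r}. h i)"
    by (rule gen_eigen_decomp[OF z(1)]) (rule that)
  have "f y (h i) = 0" if "i \<in> {1..r}" for i
    using y(2) free_orth[OF m that _ y(1) h(1)[OF that]] h(1)[OF that] by (cases "i = m") auto
  then have "f y z = 0" unfolding h(2) form_sum_right by simp
  with z(2) show False ..
qed

text \<open>Changing a representative by a multiple of \<open>X - 1\<close> raises the total
  exponent to \<open>m\<close>, so the description in \<open>residual_form\<close> has a unique
  solution.\<close>

lemma residual_value:
  assumes m: "m \<in> {1..r}" and u: "u \<in> U m" and v: "v \<in> U m"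
  shows "residual_form f \<sigma> m (coset (minus_id \<sigma> ` U m) u) (coset (minus_id \<sigma> ` U m) v)
    = f (act (lin_poly 1 ^ (m - 1)) u) v"
proof -
  have c: "f (act (lin_poly 1 ^ (m - 1)) (u + act (lin_poly 1) a)) (v + act (lin_poly 1) b)
      = f (act (lin_poly 1 ^ (m - 1)) u) v" if "a \<in> U m" "b \<in> U m" for a b
  proof -
    have "lin_poly 1 ^ (m - 1) * lin_poly 1 = (lin_poly 1 ^ m :: 'a poly)"
      using m by (metis One_nat_def Suc_le_eq Suc_diff_1 atLeastAtMost_iff power_Suc2)
    then have "act (lin_poly 1 ^ (m - 1)) (act (lin_poly 1) a) = 0"
      using free_kill[OF m that(1)] by (metis act_mult)
    moreover have "f (act (lin_poly 1 ^ (m - 1)) u) (act (lin_poly 1) b) = 0"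
      using form_high[OF _ free_kill[OF m u], of "m - 1" 1 1 1 b] m by simp
    ultimately show ?thesis by (simp add: act_add_right form_simps)
  qed
  have uc: "u \<in> coset (minus_id \<sigma> ` U m) u" "v \<in> coset (minus_id \<sigma> ` U m) v"
    unfolding coset_def minus_id_act using free_zero[OF m] act_zero_right by force+
  show ?thesis
    unfolding residual_form_def minus_id_power
  proof (rule the_equality)
    show "\<forall>x\<in>coset (minus_id \<sigma> ` U m) u. \<forall>y\<in>coset (minus_id \<sigma> ` U m) v.
      f (act (lin_poly 1 ^ (m - 1)) x) y = f (act (lin_poly 1 ^ (m - 1)) u) v"
      unfolding coset_def minus_id_act using c by auto
  qed (metis uc)
qed

lemma alternating_iff:
  assumes m: "m \<in> {1..r}"
  shows "quotient_alternating (U m) (minus_id \<sigma> ` U m) (residual_form f \<sigma> m) \<longleftrightarrow> alt UNIV m"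
  unfolding alt_iff_free[OF m] quotient_alternating_def quotient_space_def
  using residual_value[OF m] by auto

lemma residual_nondegenerate_symmetric:
  assumes m: "m \<in> {1..r}" and odd: "odd m"
  shows "residual_form_nondegenerate_symmetric scale f \<sigma> m (U m)"
proof -
  define W where "W = minus_id \<sigma> ` U m"
  define h where "h = residual_form f \<sigma> m"
  have hv: "h (coset W u) (coset W v) = f (act (lin_poly 1 ^ (m - 1)) u) v" if "u \<in> U m" "v \<in> U m" for u v
    unfolding h_def W_def using residual_value[OF m that] .
  have sub: "subspace (U m)" using free_invariant[OF m] by (simp add: invariant_def)
  have sym: "f (act (lin_poly 1 ^ (m - 1)) v) u = f (act (lin_poly 1 ^ (m - 1)) u) v"
    if "u \<in> U m" "v \<in> U m" for u v
    using top_sym[of 1 m u v] free_kill[OF m] that m odd by simp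
  have bil: "quotient_bilinear_form scale (U m) W h"
    unfolding quotient_bilinear_form_def
    using hv sub by (simp add: subspace_add subspace_scale act_add_right act_scale_right form_simps)
  have qsym: "quotient_symmetric (U m) W h"
    unfolding quotient_symmetric_def quotient_space_def using hv sym by auto
  have "quotient_nondegenerate scale (U m) W h"
    unfolding quotient_nondegenerate_def
  proof (intro allI impI)
    fix bs assume bs: "ordered_basis_mod scale (U m) W bs"
    define n where "n = length bs"
    have bsU: "bs ! i \<in> U m" if "i < n" for i
      using bs that unfolding ordered_basis_mod_def n_def by auto
    have rep: "\<exists>!c. c \<in> carrier_vec n \<and> u - (\<Sum>i<n. vec_index c i *s bs ! i) \<in> W" if "u \<in> U m" for u
      using bs that unfolding ordered_basis_mod_def n_def by blast
    define A where "A = gram_mat h (map (coset W) bs)"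
    have A: "A \<in> carrier_mat n n" by (simp add: A_def gram_mat_def n_def)
    have Aij: "A $$ (i, j) = f (act (lin_poly 1 ^ (m - 1)) (bs ! i)) (bs ! j)" if "i < n" "j < n" for i j
      using that hv bsU by (simp add: A_def gram_mat_def n_def)
    \<comment> \<open>A kernel vector \<open>c\<close> of the Gram matrix yields \<open>x\<close>
      with \<open>(X - 1)^(m-1) x\<close> orthogonal to \<open>U m\<close>, hence zero. Freeness
      places \<open>x\<close> in \<open>W\<close>, so \<open>c\<close> and the zero vector are both
      coordinates of the zero coset, and uniqueness gives \<open>c = 0\<close>.\<close>
    have "det A \<noteq> 0"
    proof
      assume "det A = 0"
      then obtain c where c: "c \<in> carrier_vec n" "c \<noteq> 0\<^sub>v n" "A *\<^sub>v c = 0\<^sub>v n"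
        using det_0_iff_vec_prod_zero_field[OF A] by blast
      define x where "x = (\<Sum>j<n. vec_index c j *s bs ! j)"
      have xU: "x \<in> U m" unfolding x_def using bsU sub by (intro subspace_sum subspace_scale) auto
      have bx: "f (act (lin_poly 1 ^ (m - 1)) (bs ! i)) x = 0" if "i < n" for i
      proof -
        have "0 = vec_index (A *\<^sub>v c) i" using c(3) that by simp
        also have "\<dots> = (\<Sum>j<n. A $$ (i, j) * vec_index c j)"
          using A c(1) that by (simp add: scalar_prod_def row_def lessThan_atLeast0)
        also have "\<dots> = f (act (lin_poly 1 ^ (m - 1)) (bs ! i)) x"
          unfolding x_def form_sum_right using that by (intro sum.cong) (auto simp: Aij form_simps)
        finally show ?thesis by simp
      qed
      have W0: "f (act (lin_poly 1 ^ (m - 1)) w) y = 0" if w: "w \<in> W" and "y \<in> U m" for w y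
      proof -
        obtain z where z: "z \<in> U m" "w = act (lin_poly 1) z" using w unfolding W_def minus_id_act by blast
        have "act (lin_poly 1 ^ (m - 1)) w = act (lin_poly 1) (act (lin_poly 1 ^ (m - 1)) z)"
          unfolding z(2) by (rule act_commute)
        also have "\<dots> = 0" using free_kill[OF m z(1)] m by (intro act_top) auto
        finally show ?thesis by simp
      qed
      have ux: "f (act (lin_poly 1 ^ (m - 1)) u) x = 0" if u: "u \<in> U m" for u
      proof -
        obtain d where d: "u - (\<Sum>i<n. vec_index d i *s bs ! i) \<in> W" using rep[OF u] by blast
        define w where "w = u - (\<Sum>i<n. vec_index d i *s bs ! i)"
        have "u = w + (\<Sum>i<n. vec_index d i *s bs ! i)" by (simp add: w_def)
        moreover have "f (act (lin_poly 1 ^ (m - 1)) w) x = 0" using W0 d xU unfolding w_def by blast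
        ultimately show ?thesis
          using bx by (simp add: act_add_right act_sum_right act_scale_right form_sum_left form_simps)
      qed
      have "act (lin_poly 1 ^ (m - 1)) x = 0"
      proof (rule free_nondeg[OF m])
        show "act (lin_poly 1 ^ (m - 1)) x \<in> U m" by (rule invariant_act[OF free_invariant[OF m] xU])
        show "f (act (lin_poly 1 ^ (m - 1)) x) u = 0" if "u \<in> U m" for u
          using sym[OF that xU] ux[OF that] by simp
      qed
      then obtain y where y: "y \<in> U m" "x = act (lin_poly 1 ^ (m - (m - 1))) y"
        using free_ker[OF m xU, of "m - 1"] by auto
      have "m - (m - 1) = 1" using m by auto
      then have xW: "x = act (lin_poly 1) y" using y(2) by simp
      have "(0 - x) = act (lin_poly 1) (- y)" by (simp add: xW act_minus_right)
      then have "0 - x \<in> W" unfolding W_def minus_id_act using subspace_neg[OF sub y(1)] by blast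
      then have "c \<in> carrier_vec n \<and> 0 - (\<Sum>i<n. vec_index c i *s bs ! i) \<in> W" using c(1) by (simp add: x_def)
      moreover have "0 \<in> W" unfolding W_def minus_id_act using free_zero[OF m] act_zero_right by (metis image_eqI)
      then have "0\<^sub>v n \<in> carrier_vec n \<and> 0 - (\<Sum>i<n. vec_index (0\<^sub>v n) i *s bs ! i) \<in> W" by simp
      ultimately have "c = 0\<^sub>v n" using rep[OF free_zero[OF m]] by blast
      with c(2) show False ..
    qed
    from det_non_zero_imp_unit[OF A this, of "()"] obtain B where B: "B \<in> carrier_mat n n" "B * A = 1\<^sub>m n" "A * B = 1\<^sub>m n"
      unfolding Units_def ring_mat_def by auto
    then show "invertible_mat (gram_mat h (map (coset W) bs))"
      unfolding A_def[symmetric] invertible_mat_def inverts_mat_def using A by auto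
  qed
  then show ?thesis
    unfolding residual_form_nondegenerate_symmetric_def Let_def W_def[symmetric] h_def[symmetric] minus_id_power
    using hv bil qsym by blast
qed

end

end

section \<open>Existence of the asymmetry and of the minimal polynomial\<close>

lemma left_inverse_kernel:
  fixes a b :: "nat \<Rightarrow> nat \<Rightarrow> 'a::comm_ring_1"
  assumes "\<And>i k. i < n \<Longrightarrow> k < n \<Longrightarrow> (\<Sum>j<n. a i j * b j k) = (if i = k then 1 else 0)"
    and "\<And>j. j < n \<Longrightarrow> (\<Sum>i<n. r i * a i j) = 0" and "k < n"
  shows "r k = 0"
proof -
  have "r k = (\<Sum>i<n. r i * (if i = k then 1 else 0))"
    using assms(3) by (simp add: if_distrib cong: if_cong)
  also have "\<dots> = (\<Sum>i<n. \<Sum>j<n. r i * a i j * b j k)"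
    using assms(1,3) by (intro sum.cong refl) (simp add: sum_distrib_left mult.assoc flip: assms(1))
  also have "\<dots> = (\<Sum>j<n. (\<Sum>i<n. r i * a i j) * b j k)"
    unfolding sum_distrib_right by (rule sum.swap)
  also have "\<dots> = 0" using assms(2) by (intro sum.neutral) simp
  finally show ?thesis .
qed

context finite_dimensional_vector_space
begin

text \<open>Invertibility of one Gram matrix is converted into the vanishing of both radicals: the
  two sides of the inverse treat the two arguments.\<close>

lemma
  assumes bil: "bilinear_form scale f" and nd: "nondegenerate scale f"
  shows nondegenerate_left: "(\<And>v. f u v = 0) \<Longrightarrow> u = 0"
    and nondegenerate_right: "(\<And>v. f v u = 0) \<Longrightarrow> u = 0"
proof -
  have lin: "module_hom scale (*) (\<lambda>u. f u z)" "module_hom scale (*) (\<lambda>u. f z u)" for z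
    using bil by (auto simp: bilinear_form_def module_hom_iff_linear)
  obtain bs where bs: "set bs = Basis" "distinct bs" using finite_distinct_list[OF finite_Basis] by blast
  define n where "n = length bs"
  define A where "A = gram_mat f bs"
  have "ordered_basis scale bs"
    unfolding ordered_basis_def bs(1) using bs(2) independent_Basis span_Basis by blast
  then have "invertible_mat A" using nd by (auto simp: nondegenerate_def A_def)
  then obtain B where B: "A * B = 1\<^sub>m n" "B * A = 1\<^sub>m (dim_row B)"
    unfolding invertible_mat_def inverts_mat_def by (auto simp: A_def gram_mat_def n_def)
  have dA: "A \<in> carrier_mat n n" by (simp add: A_def gram_mat_def n_def)
  have "dim_col B = n" using B(1) by (metis index_mult_mat(3) index_one_mat(3))
  moreover have "dim_row B = n" using B(2) dA by (metis carrier_matD(2) index_mult_mat(3) index_one_mat(3))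
  ultimately have dB: "B \<in> carrier_mat n n" by auto
  have Aij: "A $$ (i, j) = f (bs ! i) (bs ! j)" if "i < n" "j < n" for i j
    using that by (simp add: A_def gram_mat_def n_def)
  have AB: "(\<Sum>j<n. f (bs ! i) (bs ! j) * B $$ (j, k)) = (if i = k then 1 else 0)" if "i < n" "k < n" for i k
  proof -
    have "(A * B) $$ (i, k) = (\<Sum>j<n. f (bs ! i) (bs ! j) * B $$ (j, k))"
      using dA dB that by (simp add: scalar_prod_def lessThan_atLeast0 Aij)
    then show ?thesis unfolding B(1) using that by simp
  qed
  have BA: "(\<Sum>j<n. f (bs ! j) (bs ! i) * B $$ (k, j)) = (if i = k then 1 else 0)" if "i < n" "k < n" for i k
  proof -
    have "(B * A) $$ (k, i) = (\<Sum>j<n. B $$ (k, j) * f (bs ! j) (bs ! i))"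
      using dA dB that by (simp add: scalar_prod_def lessThan_atLeast0 Aij)
    then show ?thesis unfolding B(2) using that dB by (simp add: mult.commute eq_commute)
  qed
  have rep: "\<exists>r. u = (\<Sum>i<n. r i *s bs ! i)" for u
  proof -
    have "u \<in> span Basis" using span_Basis by simp
    then obtain r where "u = (\<Sum>b\<in>set bs. r b *s b)" unfolding span_finite[OF finite_Basis] bs(1) by blast
    also have "\<dots> = (\<Sum>i<n. r (bs ! i) *s bs ! i)"
      using sum.reindex_bij_betw[OF bij_betw_nth[OF bs(2), of "{..<n}" "set bs"], of "\<lambda>b. r b *s b"]
      by (simp add: n_def)
    finally show ?thesis by (intro exI[of _ "\<lambda>i. r (bs ! i)"])
  qed
  show "u = 0" if "\<And>v. f u v = 0"
  proof -
    obtain r where r: "u = (\<Sum>i<n. r i *s bs ! i)" using rep by blast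
    have "(\<Sum>i<n. r i * f (bs ! i) (bs ! j)) = 0" for j
      using that[of "bs ! j"] unfolding r
      by (simp add: module_hom.sum[OF lin(1)] module_hom.scale[OF lin(1)])
    from left_inverse_kernel[OF AB this] show ?thesis unfolding r by simp
  qed
  show "u = 0" if "\<And>v. f v u = 0"
  proof -
    obtain r where r: "u = (\<Sum>i<n. r i *s bs ! i)" using rep by blast
    have "(\<Sum>i<n. r i * f (bs ! j) (bs ! i)) = 0" for j
      using that[of "bs ! j"] unfolding r
      by (simp add: module_hom.sum[OF lin(2)] module_hom.scale[OF lin(2)])
    from left_inverse_kernel[of n "\<lambda>i j. f (bs ! j) (bs ! i)" "\<lambda>j k. B $$ (k, j)", OF BA this]
    show ?thesis unfolding r by simp
  qed
qed

text \<open>\<open>L\<close> and \<open>L'\<close> encode a vector by its values against a basis, on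
  either side of the form. Both are bijective by non-degeneracy and a dimension count, and the
  asymmetry is \<open>L'\<close> followed by the inverse of \<open>L\<close>.\<close>

lemma asymmetry_exists:
  assumes bil: "bilinear_form scale f" and nd: "nondegenerate scale f"
  shows "\<exists>\<sigma>. \<sigma> \<in> GL scale \<and> (\<forall>u v. f v u = f u (\<sigma> v))"
proof -
  have lin: "module_hom scale (*) (\<lambda>u. f u z)" "module_hom scale (*) (\<lambda>u. f z u)" for z
    using bil by (auto simp: bilinear_form_def module_hom_iff_linear)
  note fs = module_hom.add[OF lin(1)] module_hom.add[OF lin(2)] module_hom.scale[OF lin(1)]
    module_hom.scale[OF lin(2)] module_hom.zero[OF lin(1)] module_hom.zero[OF lin(2)]
    module_hom.diff[OF lin(2)]
  define L where "L w = (\<Sum>b\<in>Basis. f b w *s b)" for w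
  define L' where "L' w = (\<Sum>b\<in>Basis. f w b *s b)" for w
  have lL: "Vector_Spaces.linear scale scale L" "Vector_Spaces.linear scale scale L'"
    unfolding L_def L'_def
    by (unfold_locales, simp_all add: fs scale_left_distrib sum.distrib scale_sum_right)
  have coeff0: "h b = 0" if "(\<Sum>b\<in>Basis. h b *s b) = 0" "b \<in> Basis" for h b
    using independentD[OF independent_Basis finite_Basis order_refl that] .
  have UNIV0: "f u w = 0" if "\<And>b. b \<in> Basis \<Longrightarrow> f b w = 0" for u w
  proof -
    have "span Basis \<subseteq> {u. f u w = 0}"
      by (rule span_minimal) (auto simp: that subspace_def fs)
    then show ?thesis using span_Basis by auto
  qed
  have UNIV0': "f w u = 0" if "\<And>b. b \<in> Basis \<Longrightarrow> f w b = 0" for u w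
  proof -
    have "span Basis \<subseteq> {u. f w u = 0}"
      by (rule span_minimal) (auto simp: that subspace_def fs)
    then show ?thesis using span_Basis by auto
  qed
  have "inj L"
    unfolding module_hom.inj_iff_eq_0[OF lL(1)[folded module_hom_iff_linear]]
  proof (intro allI impI)
    fix w assume "L w = 0"
    then have "f b w = 0" if "b \<in> Basis" for b using coeff0[of "\<lambda>b. f b w", OF _ that] by (simp add: L_def)
    then show "w = 0" using nondegenerate_right[OF bil nd] UNIV0 by blast
  qed
  have "inj L'"
    unfolding module_hom.inj_iff_eq_0[OF lL(2)[folded module_hom_iff_linear]]
  proof (intro allI impI)
    fix w assume "L' w = 0"
    then have "f w b = 0" if "b \<in> Basis" for b using coeff0[of "\<lambda>b. f w b", OF _ that] by (simp add: L'_def)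
    then show "w = 0" using nondegenerate_left[OF bil nd] UNIV0' by blast
  qed
  have sL: "surj L" "surj L'"
    using linear_inj_imp_surj[OF lL(1) \<open>inj L\<close>] linear_inj_imp_surj[OF lL(2) \<open>inj L'\<close>] by auto
  define \<sigma> where "\<sigma> = inv_into UNIV L \<circ> L'"
  have L\<sigma>: "L (\<sigma> v) = L' v" for v
    unfolding \<sigma>_def using surj_f_inv_f[OF sL(1)] by simp
  have "bij \<sigma>"
    unfolding \<sigma>_def using \<open>inj L\<close> \<open>inj L'\<close> sL by (intro bij_comp bij_imp_bij_inv) (auto simp: bij_def)
  moreover have "Vector_Spaces.linear scale scale \<sigma>"
  proof -
    have "L (\<sigma> (x + y)) = L (\<sigma> x + \<sigma> y)" "L (\<sigma> (c *s x)) = L (c *s \<sigma> x)" for x y c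
      using module_hom.add[OF lL(1)[folded module_hom_iff_linear]] module_hom.scale[OF lL(1)[folded module_hom_iff_linear]]
        module_hom.add[OF lL(2)[folded module_hom_iff_linear]] module_hom.scale[OF lL(2)[folded module_hom_iff_linear]]
      by (simp_all add: L\<sigma>)
    then have "\<sigma> (x + y) = \<sigma> x + \<sigma> y" "\<sigma> (c *s x) = c *s \<sigma> x" for x y c
      using injD[OF \<open>inj L\<close>] by blast+
    then show ?thesis by unfold_locales
  qed
  moreover have "f v u = f u (\<sigma> v)" for u v
  proof -
    have "(\<Sum>b\<in>Basis. (f b (\<sigma> v) - f v b) *s b) = 0"
      using L\<sigma>[of v] unfolding L_def L'_def by (simp add: scale_left_diff_distrib sum_subtractf)
    then have 1: "f b (\<sigma> v) - f v b = 0" if "b \<in> Basis" for b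
      using coeff0[OF _ that, of "\<lambda>b. f b (\<sigma> v) - f v b"] by blast
    have "span Basis \<subseteq> {u. f v u = f u (\<sigma> v)}"
      by (rule span_minimal) (use 1 in \<open>auto simp: subspace_def fs\<close>)
    then show ?thesis using span_Basis by auto
  qed
  ultimately show ?thesis by (auto simp: GL_def)
qed

lemma asymmetry_props:
  assumes bil: "bilinear_form scale f" and nd: "nondegenerate scale f"
  shows "asymmetry scale f \<in> GL scale \<and> (\<forall>u v. f v u = f u (asymmetry scale f v))"
proof -
  have "\<sigma> = \<tau>"
    if a: "\<sigma> \<in> GL scale \<and> (\<forall>u v. f v u = f u (\<sigma> v))" "\<tau> \<in> GL scale \<and> (\<forall>u v. f v u = f u (\<tau> v))"
    for \<sigma> \<tau>
  proof
    fix v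
    have lin: "module_hom scale (*) (\<lambda>u. f z u)" for z
      using bil by (auto simp: bilinear_form_def module_hom_iff_linear)
    have "f u (\<sigma> v - \<tau> v) = 0" for u
      using a unfolding module_hom.diff[OF lin] by (metis diff_self)
    from nondegenerate_right[OF bil nd this] show "\<sigma> v = \<tau> v" by simp
  qed
  then have "\<exists>!\<sigma>. \<sigma> \<in> GL scale \<and> (\<forall>u v. f v u = f u (\<sigma> v))"
    using asymmetry_exists[OF bil nd] by blast
  from theI'[OF this] show ?thesis unfolding asymmetry_def .
qed

end

lemma (in endomorphism) act_monom: "act (monom c i) v = c *s (\<sigma> ^^ i) v"
  by (induction i) (simp_all add: monom_0 monom_Suc act_pCons hom_scale)

text \<open>Injectivity permits stripping all factors \<open>X\<close> from an annihilating
  polynomial. The remaining one has non-zero constant term and can be solved for the identity, which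
  exhibits the inverse as a polynomial.\<close>

lemma (in endomorphism) act_inverse_exists:
  assumes "inj \<sigma>" "\<Omega> \<noteq> 0" "\<And>v. act \<Omega> v = 0"
  obtains \<rho> where "\<And>v. act ([:0, 1:] * \<rho>) v = v"
proof -
  have X: "lin_poly 0 = ([:0, 1:] :: 'a poly)" by (simp add: lin_poly_def)
  obtain j q where q: "\<Omega> = lin_poly 0 ^ j * q" "poly q 0 \<noteq> 0" by (rule lin_poly_power_factor[OF assms(2)])
  have zero: "v = 0" if "act (lin_poly 0 ^ i) v = 0" for i v
    using that
  proof (induction i arbitrary: v)
    case (Suc i)
    then have "\<sigma> (act (lin_poly 0 ^ i) v) = \<sigma> 0" by (simp only: power_Suc act_mult X act_X hom_0)
    then show ?case using Suc.IH injD[OF assms(1)] by blast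
  qed simp
  have q0: "act q v = 0" for v
    using assms(3)[of v] unfolding q(1) act_mult by (rule zero)
  obtain h where h: "q = [:poly q 0:] + lin_poly 0 * h" using poly_root_split by blast
  have "act (lin_poly 0 * h) v = - (poly q 0 *s v)" for v
    using q0[of v] by (subst (asm) h) (simp add: poly_act_add eq_neg_iff_add_eq_0 add.commute)
  then have "act ([:0, 1:] * smult (- 1 / poly q 0) h) v = v" for v
    using q(2) unfolding mult_smult_right poly_act_smult X[symmetric] by simp
  then show thesis by (rule that)
qed

lemma poly_act_conjugate:
  assumes "endomorphism scale \<sigma>" "endomorphism scale \<tau>"
    and x: "Vector_Spaces.linear scale scale x" "\<tau> \<circ> x = x \<circ> \<sigma>"
  shows "poly_act scale \<tau> p (x v) = x (poly_act scale \<sigma> p v)"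
proof -
  interpret A: endomorphism scale \<sigma> by fact
  interpret C: endomorphism scale \<tau> by fact
  note x_hom = x(1)[folded module_hom_iff_linear]
  have "\<tau> (x w) = x (\<sigma> w)" for w using fun_cong[OF x(2), of w] by simp
  then show ?thesis
    by (induction p) (simp_all add: A.act_pCons C.act_pCons module_hom.zero[OF x_hom]
      module_hom.add[OF x_hom] module_hom.scale[OF x_hom])
qed

section \<open>Annihilating polynomials in finite dimension\<close>

locale fd_endomorphism = finite_dimensional_vector_space scale Basis + endomorphism scale \<sigma>
  for scale :: "'a::field \<Rightarrow> 'v::ab_group_add \<Rightarrow> 'v" (infixr \<open>*s\<close> 75)
    and Basis :: "'v set" and \<sigma> :: "'v \<Rightarrow> 'v"
begin

lemma annihilator_exists_at: "\<exists>p. p \<noteq> 0 \<and> act p v = 0"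
proof -
  define n where "n = dim (UNIV :: 'v set)"
  define e where "e i = (\<sigma> ^^ i) v" for i
  show ?thesis
  \<comment> \<open>Dependence is a property of sets of vectors, so coinciding iterates have to be
    treated separately; they give a difference of monomials.\<close>
  proof (cases "inj_on e {..n}")
    case False
    then obtain i j where ij: "i \<noteq> j" "e i = e j" by (auto simp: inj_on_def)
    have "coeff (monom 1 i - monom 1 j :: 'a poly) i = 1" using ij(1) by simp
    then have "monom 1 i - monom 1 j \<noteq> (0 :: 'a poly)" by (metis coeff_0 zero_neq_one)
    moreover have "act (monom 1 i - monom 1 j) v = 0"
      using ij(2) by (simp add: poly_act_diff act_monom e_def)
    ultimately show ?thesis by blast
  next
    case True
    have "card (e ` {..n}) = Suc n" using card_image[OF True] by simp
    then have "dependent (e ` {..n})"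
      using independent_card_le_dim[of "e ` {..n}" UNIV] unfolding n_def by fastforce
    then obtain u i where u: "(\<Sum>x\<in>e ` {..n}. u x *s x) = 0" "i \<le> n" "u (e i) \<noteq> 0"
      unfolding dependent_finite[OF finite_imageI[OF finite_atMost]] by auto
    define p where "p = (\<Sum>i\<le>n. monom (u (e i)) i)"
    have "coeff p i = u (e i)" using u(2) by (simp add: p_def coeff_sum)
    then have "p \<noteq> 0" using u(3) by auto
    moreover have "act p v = 0"
      using u(1) unfolding sum.reindex[OF True] by (simp add: p_def poly_act_sum act_monom e_def)
    ultimately show ?thesis by blast
  qed
qed

lemma annihilator_exists: "\<exists>p. p \<noteq> 0 \<and> (\<forall>v. act p v = 0)"
proof -
  obtain P where P: "\<And>v. P v \<noteq> 0 \<and> act (P v) v = 0" using annihilator_exists_at by metis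
  define p where "p = prod P Basis"
  have "act p b = 0" if "b \<in> Basis" for b
    using act_dvd_0 P that unfolding p_def by (meson dvd_prodI finite_Basis)
  then have "span Basis \<subseteq> {v. act p v = 0}" by (intro span_minimal subspace_kernel_act) auto
  moreover have "p \<noteq> 0" unfolding p_def using P finite_Basis by simp
  ultimately show ?thesis using span_Basis by auto
qed

text \<open>\<open>min_poly\<close> is a definite description, so existence (least degree and
  division with remainder) and uniqueness (monic associates) come before its annihilating property
  can be extracted.\<close>

lemma min_poly_annihilates: "act (min_poly scale \<sigma>) v = 0"
proof -
  define Q where "Q p \<longleftrightarrow> lead_coeff p = 1 \<and> (\<forall>v. act p v = 0) \<and> (\<forall>q. (\<forall>v. act q v = 0) \<longrightarrow> p dvd q)" for p
  have ex: "\<exists>p. Q p"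
  proof -
    define d where "d = (LEAST d. \<exists>p. p \<noteq> 0 \<and> (\<forall>v. act p v = 0) \<and> degree p = d)"
    have "\<exists>d p. p \<noteq> 0 \<and> (\<forall>v. act p v = 0) \<and> degree p = d" using annihilator_exists by blast
    from LeastI_ex[OF this] obtain p where p: "p \<noteq> 0" "\<And>v. act p v = 0" "degree p = d"
      unfolding d_def[symmetric] by blast
    have least: "d \<le> degree q" if "q \<noteq> 0" "\<And>v. act q v = 0" for q
      unfolding d_def using that by (intro Least_le) blast
    have pd: "p dvd q" if "\<And>v. act q v = 0" for q
    proof -
      have "q mod p = q - q div p * p" by (simp add: minus_div_mult_eq_mod)
      then have "act (q mod p) v = 0" for v using that p(2) by (simp add: poly_act_diff act_mult)
      then have "q mod p = 0" using least[of "q mod p"] degree_mod_less[OF p(1), of q] p(3) by fastforce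
      then show ?thesis by (simp add: mod_eq_0_iff_dvd)
    qed
    define m where "m = smult (inverse (lead_coeff p)) p"
    have "Q m" unfolding Q_def m_def
      using p pd by (auto simp: poly_act_smult smult_dvd_iff)
    then show ?thesis by blast
  qed
  have unique: "p = q" if pq: "Q p" "Q q" for p q
  proof -
    have dvd: "p dvd q" "q dvd p" and lead: "lead_coeff p = 1" "lead_coeff q = 1"
      using pq unfolding Q_def by blast+
    then have nz: "p \<noteq> 0" "q \<noteq> 0" by auto
    obtain k where k: "q = p * k" using dvd(1) by (rule dvdE)
    have "degree q = degree p" using dvd nz by (simp add: dvd_imp_degree_le order_antisym)
    then have "degree k = 0" using k nz by (simp add: degree_mult_eq)
    then obtain c where "k = [:c:]" by (rule degree_eq_zeroE)
    then show ?thesis using k lead nz by (cases "c = 0") (simp_all add: lead_coeff_mult)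
  qed
  have "Q (THE p. Q p)" by (rule theI', rule ex_ex1I[OF ex unique])
  then show ?thesis unfolding min_poly_def Q_def by blast
qed

end

section \<open>Equivalence of forms with similar asymmetries\<close>

context two_forms
begin

lemma iso_UNIV_iff: "iso UNIV UNIV \<longleftrightarrow> equivalent_forms scale f g"
proof
  assume "iso UNIV UNIV"
  then obtain x where "Vector_Spaces.linear scale scale x" "x ` UNIV = UNIV" "inj_on x UNIV"
    "\<And>a b. a \<in> UNIV \<Longrightarrow> b \<in> UNIV \<Longrightarrow> g (x a) (x b) = f a b"
    by (rule iso_map[OF F.regular_UNIV G.regular_UNIV]) (rule that)
  then show "equivalent_forms scale f g" by (auto simp: equivalent_forms_def GL_def bij_def)
next
  assume "equivalent_forms scale f g"
  then obtain x where x: "bij x" "\<And>u v. g (x u) (x v) = f u v"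
    by (auto simp: equivalent_forms_def GL_def)
  define R where "R = range (\<lambda>a. (a, x a))"
  have "fst ` R = UNIV" "snd ` R = UNIV" using x(1) by (auto simp: R_def image_image bij_def)
  then show "iso UNIV UNIV"
    unfolding iso_def compat_def using x(2) by (intro exI[of _ R]) (auto simp: R_def)
qed

lemma alt_if_equivalent:
  "equivalent_forms scale f g \<Longrightarrow> F.alt UNIV k \<longleftrightarrow> G.alt UNIV k"
  using iso_alt[OF F.regular_UNIV G.regular_UNIV] iso_UNIV_iff by blast

context
  fixes x
  assumes x: "Vector_Spaces.linear scale scale x" "bij x" "\<tau> \<circ> x = x \<circ> \<sigma>"
begin

lemma similar_act: "G.act p (x v) = x (F.act p v)"
  by (rule poly_act_conjugate[OF F.endomorphism_axioms G.endomorphism_axioms x(1,3)])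

lemma similar_0_iff: "x v = 0 \<longleftrightarrow> v = 0"
  using x(2) module_hom.zero[OF x(1)[folded module_hom_iff_linear]] by (metis bij_pointE)

lemma similar_dim: "F.dim (F.ker UNIV p) = F.dim (G.ker UNIV p)"
proof -
  have "G.ker UNIV p \<subseteq> x ` F.ker UNIV p"
  proof
    fix w assume w: "w \<in> G.ker UNIV p"
    obtain v where v: "w = x v" using x(2) by (metis bij_pointE)
    then have "F.act p v = 0" using w similar_act[of p v] similar_0_iff by (simp add: G.ker_def)
    then show "w \<in> x ` F.ker UNIV p" using v by (auto simp: F.ker_def)
  qed
  moreover have "x ` F.ker UNIV p \<subseteq> G.ker UNIV p"
    using similar_act similar_0_iff by (auto simp: F.ker_def G.ker_def)
  ultimately have "x ` F.ker UNIV p = G.ker UNIV p" by blast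
  moreover have "inj_on x (F.span (F.ker UNIV p))"
    using x(2) by (auto simp: bij_def intro: inj_on_subset)
  ultimately show ?thesis using F.fd.dim_image_eq[OF x(1), of "F.ker UNIV p"] by simp
qed

lemma similar_no_block: "F.no_block m \<Longrightarrow> G.no_block m"
  unfolding G.no_block_def
proof (intro allI impI)
  fix w assume nb: "F.no_block m" and w: "G.act (lin_poly 1 ^ m) w = 0"
  obtain v where v: "w = x v" using x(2) by (metis bij_pointE)
  then have "F.act (lin_poly 1 ^ m) v = 0" using w similar_act similar_0_iff by simp
  then obtain a b where ab: "v = a + F.act (lin_poly 1) b" "F.act (lin_poly 1 ^ (m - 1)) a = 0"
    "F.act (lin_poly 1 ^ (m + 1)) b = 0" using nb unfolding F.no_block_def by blast
  have "w = x a + G.act (lin_poly 1) (x b)"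
    unfolding v ab(1) similar_act module_hom.add[OF x(1)[folded module_hom_iff_linear]] ..
  moreover have "G.act (lin_poly 1 ^ (m - 1)) (x a) = 0" "G.act (lin_poly 1 ^ (m + 1)) (x b) = 0"
    unfolding similar_act ab similar_0_iff by simp_all
  ultimately show "\<exists>a b. w = a + G.act (lin_poly 1) b \<and> G.act (lin_poly 1 ^ (m - 1)) a = 0 \<and>
      G.act (lin_poly 1 ^ (m + 1)) b = 0" by blast
qed

lemma equivalent_if_alt:
  assumes "quadratically_closed TYPE('a)" "\<And>k. (2::'a) = 0 \<Longrightarrow> F.alt UNIV k \<longleftrightarrow> G.alt UNIV k"
  shows "equivalent_forms scale f g"
  using iso_if_same_type[OF assms(1) F.regular_UNIV G.regular_UNIV similar_dim assms(2)] iso_UNIV_iff by blast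

lemma equivalent_if_no_odd_divisor:
  assumes qc: "quadratically_closed TYPE('a)"
    and no: "(2::'a) = 0 \<Longrightarrow> \<not> (\<exists>m. odd m \<and> elementary_divisor scale \<sigma> (lin_poly 1 ^ m))"
  shows "equivalent_forms scale f g"
proof (rule equivalent_if_alt[OF qc])
  fix k assume two: "(2::'a) = 0"
  note x_hom = x(1)[folded module_hom_iff_linear]
  \<comment> \<open>Pulling \<open>g\<close> back along the similarity gives a form whose asymmetry
    is \<open>\<sigma>\<close> itself. The hypothesis on the elementary divisors of
    \<open>\<sigma>\<close> then applies to it directly.\<close>
  interpret H: asym_form scale Basis \<sigma> "\<lambda>u v. g (x u) (x v)" \<rho> roots
  proof
    show "bilinear_form scale (\<lambda>u v. g (x u) (x v))"
      unfolding bilinear_form_def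
      by (intro conjI allI; unfold_locales;
          simp add: G.form_simps module_hom.add[OF x_hom] module_hom.scale[OF x_hom] algebra_simps)
    show "u = 0" if "\<And>v. g (x u) (x v) = 0" for u
    proof -
      have "g (x u) w = 0" for w using that x(2) by (metis bij_pointE)
      then show ?thesis using G.nondeg similar_0_iff by blast
    qed
    show "g (x v) (x u) = g (x u) (x (\<sigma> v))" for u v
      using G.asym[of "x v" "x u"] fun_cong[OF x(3), of v] by simp
  qed (rule F.inv F.split)+
  show "F.alt UNIV k \<longleftrightarrow> G.alt UNIV k"
  proof (cases "even k")
    case True
    then show ?thesis using F.alt_even G.alt_even by blast
  next
    case False
    have "F.alt UNIV k" "H.alt UNIV k"
      using no[OF two] False F.elementary_divisor_if[OF qc odd_pos[OF False]]
        H.elementary_divisor_if[OF qc odd_pos[OF False]]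
      unfolding F.alt_def H.alt_def by blast+
    moreover have "G.alt UNIV k" unfolding G.alt_def
    proof (intro ballI impI)
      fix w assume w: "G.act (lin_poly 1 ^ k) w = 0"
      obtain v where v: "w = x v" using x(2) by (metis bij_pointE)
      show "g (G.act (lin_poly 1 ^ (k - 1)) w) w = 0"
        using \<open>H.alt UNIV k\<close> w unfolding H.alt_def v similar_act similar_0_iff by simp
    qed
    ultimately show ?thesis by simp
  qed
qed

lemma equivalent_iff:
  assumes qc: "quadratically_closed TYPE('a)"
    and U: "orthogonal_free_decomposition scale f \<sigma> r U" and W: "orthogonal_free_decomposition scale g \<tau> r W"
  shows "equivalent_forms scale f g \<longleftrightarrow> (\<forall>m\<in>{1..r}. odd m \<and> U m \<noteq> {0} \<longrightarrow>
    (quotient_alternating (U m) (minus_id \<sigma> ` U m) (residual_form f \<sigma> m) \<longleftrightarrow>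
     quotient_alternating (W m) (minus_id \<tau> ` W m) (residual_form g \<tau> m)))" (is "_ \<longleftrightarrow> ?R")
proof
  assume "equivalent_forms scale f g"
  then show ?R using alt_if_equivalent F.alternating_iff[OF U] G.alternating_iff[OF W] by blast
next
  assume R: ?R
  have "F.alt UNIV k \<longleftrightarrow> G.alt UNIV k" for k
  proof -
    consider "even k" | "k > r" | "odd k" "k \<in> {1..r}" "U k = {0}" | "odd k" "k \<in> {1..r}" "U k \<noteq> {0}"
      by (cases "even k"; cases "k > r"; cases "U k = {0}") (auto simp: not_less Suc_leI odd_pos)
    then show ?thesis
    proof cases
      case 1
      then show ?thesis using F.alt_even G.alt_even by blast
    next
      case 2
      then show ?thesis using F.alt_large[OF U] G.alt_large[OF W] by blast
    next
      \<comment> \<open>The comparison of types is assumed only where \<open>U k\<close> is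
        non-zero. If it is zero, there is no block of size \<open>k\<close>; this passes to
        \<open>\<tau>\<close> by similarity, so both forms are alternating at
        \<open>k\<close>.\<close>
      case 3
      then have "F.no_block k" using F.no_block_if[OF U] by blast
      then show ?thesis
        using F.alt_if_no_block G.alt_if_no_block similar_no_block 3(2) by auto
    next
      case 4
      then show ?thesis using R F.alternating_iff[OF U 4(2)] G.alternating_iff[OF W 4(2)] by blast
    qed
  qed
  then show "equivalent_forms scale f g" by (intro equivalent_if_alt[OF qc])
qed

end

end

theorem theorem8p2:
  fixes s :: "'a::field \<Rightarrow> 'v::ab_group_add \<Rightarrow> 'v"
    and Basis :: "'v set"
    and f g :: "'v \<Rightarrow> 'v \<Rightarrow> 'a"
    and \<sigma> \<tau> :: "'v \<Rightarrow> 'v"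
  assumes "quadratically_closed TYPE('a)"
    and "finite_dimensional_vector_space s Basis"
    and "(UNIV :: 'v set) \<noteq> {0}"
    and "bilinear_form s f" and "nondegenerate s f" and "split_form s f"
    and "bilinear_form s g" and "nondegenerate s g" and "split_form s g"
    and "\<sigma> = asymmetry s f" and "\<tau> = asymmetry s g"
    and "similar_maps s \<sigma> \<tau>"
  shows
    "(CHAR('a) \<noteq> 2 \<or>
        CHAR('a) = 2 \<and> \<not> (\<exists>m. odd m \<and> elementary_divisor s \<sigma> ([:- 1, 1:] ^ m))
      \<longrightarrow> equivalent_forms s f g) \<and>
     (CHAR('a) = 2 \<and> (\<exists>m. odd m \<and> elementary_divisor s \<sigma> ([:- 1, 1:] ^ m))
      \<longrightarrow> (\<forall>r U W.
            orthogonal_free_decomposition s f \<sigma> r U \<and>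
            orthogonal_free_decomposition s g \<tau> r W
            \<longrightarrow>
            (\<forall>m\<in>{1..r}. odd m \<longrightarrow>
               residual_form_nondegenerate_symmetric s f \<sigma> m (U m) \<and>
               residual_form_nondegenerate_symmetric s g \<tau> m (W m)) \<and>
            (equivalent_forms s f g \<longleftrightarrow>
             (\<forall>m\<in>{1..r}. odd m \<and> U m \<noteq> {0} \<longrightarrow>
                (let f_alt = quotient_alternating (U m) (minus_id \<sigma> ` U m) (residual_form f \<sigma> m);
                     g_alt = quotient_alternating (W m) (minus_id \<tau> ` W m) (residual_form g \<tau> m)
                 in f_alt \<and> g_alt \<or> \<not> f_alt \<and> \<not> g_alt)))))"
proof -
  interpret V: finite_dimensional_vector_space s Basis by fact
  have \<sigma>: "\<sigma> \<in> GL s" "\<And>u v. f v u = f u (\<sigma> v)"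
    using V.asymmetry_props[OF \<open>bilinear_form s f\<close> \<open>nondegenerate s f\<close>] \<open>\<sigma> = asymmetry s f\<close> by auto
  have \<tau>: "\<tau> \<in> GL s" "\<And>u v. g v u = g u (\<tau> v)"
    using V.asymmetry_props[OF \<open>bilinear_form s g\<close> \<open>nondegenerate s g\<close>] \<open>\<tau> = asymmetry s g\<close> by auto
  obtain x where x: "Vector_Spaces.linear s s x" "bij x" "\<tau> \<circ> x = x \<circ> \<sigma>"
    using \<open>similar_maps s \<sigma> \<tau>\<close> by (auto simp: similar_maps_def GL_def)
  note x_hom = x(1)[folded module_hom_iff_linear]
  interpret A: fd_endomorphism s Basis \<sigma>
    using \<sigma>(1) by (intro fd_endomorphism.intro endomorphism.intro V.finite_dimensional_vector_space_axioms
      V.vector_space_axioms endomorphism_axioms.intro) (simp add: GL_def)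
  interpret C: fd_endomorphism s Basis \<tau>
    using \<tau>(1) by (intro fd_endomorphism.intro endomorphism.intro V.finite_dimensional_vector_space_axioms
      V.vector_space_axioms endomorphism_axioms.intro) (simp add: GL_def)
  have conj: "C.act p (x v) = x (A.act p v)" for p v
    by (rule poly_act_conjugate[OF A.endomorphism_axioms C.endomorphism_axioms x(1,3)])
  obtain c roots where c: "c \<noteq> 0" "min_poly s \<sigma> = Polynomial.smult c (\<Prod>a\<leftarrow>roots. [:- a, 1:])"
    using \<open>split_form s f\<close> \<open>\<sigma> = asymmetry s f\<close> by (auto simp: split_form_def splits_def)
  have rA: "A.act (\<Prod>a\<leftarrow>roots. lin_poly a) v = 0" for v
    using A.min_poly_annihilates[of v] c by (simp add: V.poly_act_smult lin_poly_def)
    have "inj \<sigma>" using \<sigma>(1) by (auto simp: GL_def bij_def)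
  obtain \<rho> where \<rho>: "\<And>v. A.act ([:0, 1:] * \<rho>) v = v"
    using A.act_inverse_exists[OF \<open>inj \<sigma>\<close> prod_roots_nonzero rA] by blast
  have surj: "\<exists>v. w = x v" for w using x(2) by (metis bij_pointE)
  \<comment> \<open>The similarity conjugates polynomials in \<open>\<sigma>\<close> to polynomials
    in \<open>\<tau>\<close>, so the same \<open>\<rho>\<close> and \<open>roots\<close> serve both
    forms.\<close>
  interpret two_forms s Basis \<sigma> f \<tau> g \<rho> roots
  proof (intro two_forms.intro asym_form.intro asym_form_axioms.intro)
    show "C.act ([:0, 1:] * \<rho>) w = w" "C.act (\<Prod>a\<leftarrow>roots. lin_poly a) w = 0" for w
      using surj[of w] conj \<rho> rA module_hom.zero[OF x_hom] by auto
    show "u = 0" if "\<And>v. f u v = 0" for u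
      by (rule V.nondegenerate_left[OF \<open>bilinear_form s f\<close> \<open>nondegenerate s f\<close> that])
    show "u = 0" if "\<And>v. g u v = 0" for u
      by (rule V.nondegenerate_left[OF \<open>bilinear_form s g\<close> \<open>nondegenerate s g\<close> that])
  qed (fact \<rho> rA \<sigma>(2) \<tau>(2) \<open>bilinear_form s f\<close> \<open>bilinear_form s g\<close> V.finite_dimensional_vector_space_axioms
      A.endomorphism_axioms C.endomorphism_axioms)+
  show ?thesis
  proof (intro conjI impI allI ballI)
    assume "CHAR('a) \<noteq> 2 \<or> CHAR('a) = 2 \<and> \<not> (\<exists>m. odd m \<and> elementary_divisor s \<sigma> ([:- 1, 1:] ^ m))"
    then show "equivalent_forms s f g"
      by (intro equivalent_if_no_odd_divisor[OF x \<open>quadratically_closed TYPE('a)\<close>])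
        (auto simp: CHAR_eq_2_iff lin_poly_def)
  next
    fix r U W
    assume UW: "orthogonal_free_decomposition s f \<sigma> r U \<and> orthogonal_free_decomposition s g \<tau> r W"
    then show "residual_form_nondegenerate_symmetric s f \<sigma> m (U m)"
      "residual_form_nondegenerate_symmetric s g \<tau> m (W m)" if "m \<in> {1..r}" "odd m" for m
      using F.residual_nondegenerate_symmetric G.residual_nondegenerate_symmetric that by blast+
    show "equivalent_forms s f g \<longleftrightarrow>
             (\<forall>m\<in>{1..r}. odd m \<and> U m \<noteq> {0} \<longrightarrow>
                (let f_alt = quotient_alternating (U m) (minus_id \<sigma> ` U m) (residual_form f \<sigma> m);
                     g_alt = quotient_alternating (W m) (minus_id \<tau> ` W m) (residual_form g \<tau> m)
                 in f_alt \<and> g_alt \<or> \<not> f_alt \<and> \<not> g_alt))"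
      using equivalent_iff[OF x \<open>quadratically_closed TYPE('a)\<close> conjunct1[OF UW] conjunct2[OF UW]]
      unfolding Let_def by blast
  qed
qed

end
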